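(* Assume the semigroup $(T_t)$ is symmetric, i.e. each $T_t$ is self-adjoint on $L_2(m)$, so that its generator $L$ is self-adjoint and $-L$ is nonnegative. Let $H=(-L)^{1/2}$ be the canonical square root of $-L$. Then for any $\mu\in\mathcal M(E)$ with $\mu\ll m$, writing $f=(d\mu/dm)^{1/2}$, we have $I(\mu)<\infty$ if and only if $f\in\mathcal D(H)$, and in that case $I(\mu)=\|Hf\|_2^2$.
   Context: Setting. $E$ is a topological Lusin space (Hausdorff, continuous bijective image of a Polish space); $\mathcal B(E)$ its Borel $\sigma$-algebra, assumed generated by the continuous real functions. $m$ is a $\sigma$-finite measure on $E$ with $m(E)>0$. $B_b^+(E)$: bounded nonnegative measurable functions; $\mathcal M(E)$: probability measures on $E$. $p_t(x,\cdot)$, $t\ge0$, is a transition probability function (probability measures, jointly measurable in $(t,x)$, $p_0(x,A)=1_A(x)$); $p_tf(x)=\int f\,dp_t(x,\cdot)$. $(T_t)$ is a strongly continuous semigroup on $L_2(m)$ with $p_tf$ a representative of $T_tf$ for every bounded measurable $f$ with $\int f^2dm<\infty$; $L$ is its $L_2(m)$-generator with domain $\mathcal D(L)$. There is a progressively measurable Markov process $(\Omega,X_t,P^x)$ with transition function $p_t$, $P^x(X_0=x)=1$, infinite lifetime. Definitions. $D=\{u\in B_b^+(E):\int u\,dm<\infty\}$. $D_1$: functions $v=\frac1t\int_0^tp_s\tilde u\,ds$, $\tilde u=p_\eta u$, $u\in D$, $t>0$, $\eta\ge0$, with $\hat Lv=\frac1t(p_t\tilde u-\tilde u)$. $\hat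 I(\mu)=-\inf\{\int\frac{\hat Lv}{v+\varepsilon}d\mu:v\in D_1,\varepsilon>0\}$; $I(\mu)=\hat I(\mu)$ if $\mu\ll m$, $+\infty$ otherwise. *)

theory Defs
  imports "HOL-Probability.Probability"
begin

definition lusin_image :: "('b::polish_space \<Rightarrow> 'a::t2_space) \<Rightarrow> bool" where
  "lusin_image g \<longleftrightarrow> continuous_on UNIV g \<and> bij g"

definition borel_gen_by_continuous :: "'a::topological_space itself \<Rightarrow> bool" where
  "borel_gen_by_continuous _ \<longleftrightarrow>
     sets (borel :: 'a measure) =
       sigma_sets UNIV {f -` U | f U. continuous_on (UNIV::'a set) f \<and> open (U :: real set)}"

definition transition_function :: "(real \<Rightarrow> 'a::topological_space \<Rightarrow> 'a measure) \<Rightarrow> bool" where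
  "transition_function p \<longleftrightarrow>
     (\<forall>t\<ge>0. \<forall>x. prob_space (p t x) \<and> sets (p t x) = sets borel) \<and>
     (\<forall>A\<in>sets borel. (\<lambda>(t,x). measure (p t x) A)
          \<in> borel_measurable (restrict_space (borel :: real measure) {0..} \<Otimes>\<^sub>M (borel :: 'a measure))) \<and>
     (\<forall>x. \<forall>A\<in>sets borel. measure (p 0 x) A = indicator A x) \<and>
     (\<forall>s\<ge>0. \<forall>t\<ge>0. \<forall>x. \<forall>A\<in>sets borel.
          measure (p (s + t) x) A = (\<integral>y. measure (p t y) A \<partial>(p s x)))"

definition ptf :: "(real \<Rightarrow> 'a \<Rightarrow> 'a measure) \<Rightarrow> real \<Rightarrow> ('a \<Rightarrow> real) \<Rightarrow> 'a \<Rightarrow> real" where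
  "ptf p t f x = (\<integral>y. f y \<partial>(p t x))"

definition L2 :: "'a measure \<Rightarrow> ('a \<Rightarrow> real) set" where
  "L2 m = {f. f \<in> borel_measurable m \<and> integrable m (\<lambda>x. (f x)\<^sup>2)}"

definition L2inner :: "'a measure \<Rightarrow> ('a \<Rightarrow> real) \<Rightarrow> ('a \<Rightarrow> real) \<Rightarrow> real" where
  "L2inner m f g = (\<integral>x. f x * g x \<partial>m)"

definition L2norm :: "'a measure \<Rightarrow> ('a \<Rightarrow> real) \<Rightarrow> real" where
  "L2norm m f = sqrt (\<integral>x. (f x)\<^sup>2 \<partial>m)"

text \<open>T is a strongly continuous semigroup of bounded linear operators on L2(m)
  (operators act on representatives and respect m-a.e. equality).\<close>
definition strongly_continuous_semigroup ::
    "'a measure \<Rightarrow> (real \<Rightarrow> ('a \<Rightarrow> real) \<Rightarrow> ('a \<Rightarrow> real)) \<Rightarrow> bool" where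
  "strongly_continuous_semigroup m T \<longleftrightarrow>
     (\<forall>t\<ge>0. \<forall>f\<in>L2 m. T t f \<in> L2 m) \<and>
     (\<forall>t\<ge>0. \<forall>f\<in>L2 m. \<forall>g\<in>L2 m. (AE x in m. f x = g x) \<longrightarrow> (AE x in m. T t f x = T t g x)) \<and>
     (\<forall>t\<ge>0. \<forall>f\<in>L2 m. \<forall>g\<in>L2 m. \<forall>a b::real.
        AE x in m. T t (\<lambda>y. a * f y + b * g y) x = a * T t f x + b * T t g x) \<and>
     (\<forall>t\<ge>0. \<exists>C. \<forall>f\<in>L2 m. L2norm m (T t f) \<le> C * L2norm m f) \<and>
     (\<forall>f\<in>L2 m. AE x in m. T 0 f x = f x) \<and>
     (\<forall>s\<ge>0. \<forall>t\<ge>0. \<forall>f\<in>L2 m. AE x in m. T (s + t) f x = T s (T t f) x) \<and>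
     (\<forall>f\<in>L2 m. ((\<lambda>t. L2norm m (\<lambda>x. T t f x - f x)) \<longlongrightarrow> 0) (at_right 0))"

definition represents :: "'a::topological_space measure \<Rightarrow> (real \<Rightarrow> 'a \<Rightarrow> 'a measure)
    \<Rightarrow> (real \<Rightarrow> ('a \<Rightarrow> real) \<Rightarrow> ('a \<Rightarrow> real)) \<Rightarrow> bool" where
  "represents m p T \<longleftrightarrow>
     (\<forall>t\<ge>0. \<forall>f. f \<in> borel_measurable borel \<and> bounded (range f) \<and> integrable m (\<lambda>x. (f x)\<^sup>2)
        \<longrightarrow> (AE x in m. T t f x = ptf p t f x))"

definition symmetric_semigroup :: "'a measure \<Rightarrow> (real \<Rightarrow> ('a \<Rightarrow> real) \<Rightarrow> ('a \<Rightarrow> real)) \<Rightarrow> bool" where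
  "symmetric_semigroup m T \<longleftrightarrow>
     (\<forall>t\<ge>0. \<forall>f\<in>L2 m. \<forall>g\<in>L2 m. L2inner m (T t f) g = L2inner m f (T t g))"

definition generator_limit :: "'a measure \<Rightarrow> (real \<Rightarrow> ('a \<Rightarrow> real) \<Rightarrow> ('a \<Rightarrow> real))
    \<Rightarrow> ('a \<Rightarrow> real) \<Rightarrow> ('a \<Rightarrow> real) \<Rightarrow> bool" where
  "generator_limit m T f g \<longleftrightarrow> f \<in> L2 m \<and> g \<in> L2 m \<and>
     ((\<lambda>t. L2norm m (\<lambda>x. (T t f x - f x) / t - g x)) \<longlongrightarrow> 0) (at_right 0)"

definition generator_domain :: "'a measure \<Rightarrow> (real \<Rightarrow> ('a \<Rightarrow> real) \<Rightarrow> ('a \<Rightarrow> real))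
    \<Rightarrow> ('a \<Rightarrow> real) set" where
  "generator_domain m T = {f. \<exists>g. generator_limit m T f g}"

text \<open>(DH, H) is a densely defined, self-adjoint (H = H*), nonnegative operator on L2(m)
  with H composed with H = -L (including D(H o H) = D(L)).  By uniqueness of nonnegative self-adjoint
  square roots this characterizes the canonical square root (-L)^(1/2).\<close>
definition is_sqrt_neg_generator :: "'a measure \<Rightarrow> (real \<Rightarrow> ('a \<Rightarrow> real) \<Rightarrow> ('a \<Rightarrow> real))
    \<Rightarrow> ('a \<Rightarrow> real) set \<Rightarrow> (('a \<Rightarrow> real) \<Rightarrow> ('a \<Rightarrow> real)) \<Rightarrow> bool" where
  "is_sqrt_neg_generator m T DH H \<longleftrightarrow>
     DH \<subseteq> L2 m \<and> (\<forall>f\<in>DH. H f \<in> L2 m) \<and>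
     (\<forall>g\<in>L2 m. \<forall>e>0. \<exists>f\<in>DH. L2norm m (\<lambda>x. f x - g x) < e) \<and>
     (\<forall>g\<in>L2 m. g \<in> DH \<longleftrightarrow> (\<exists>h\<in>L2 m. \<forall>f\<in>DH. L2inner m (H f) g = L2inner m f h)) \<and>
     (\<forall>f\<in>DH. \<forall>g\<in>DH. L2inner m (H f) g = L2inner m f (H g)) \<and>
     (\<forall>f\<in>DH. L2inner m (H f) f \<ge> 0) \<and>
     (\<forall>f\<in>L2 m. f \<in> generator_domain m T \<longleftrightarrow> f \<in> DH \<and> H f \<in> DH) \<and>
     (\<forall>f\<in>DH. H f \<in> DH \<longrightarrow> generator_limit m T f (\<lambda>x. - H (H f) x))"

definition Dset :: "'a measure \<Rightarrow> ('a::topological_space \<Rightarrow> real) set" where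
  "Dset m = {u. u \<in> borel_measurable borel \<and> bounded (range u) \<and> (\<forall>x. 0 \<le> u x)
               \<and> (\<integral>\<^sup>+x. ennreal (u x) \<partial>m) < \<infinity>}"

definition D1v :: "(real \<Rightarrow> 'a \<Rightarrow> 'a measure) \<Rightarrow> ('a \<Rightarrow> real) \<Rightarrow> real \<Rightarrow> real \<Rightarrow> 'a \<Rightarrow> real" where
  "D1v p u t \<eta> x = (1 / t) * (LBINT s=0..t. ptf p s (ptf p \<eta> u) x)"

definition D1Lv :: "(real \<Rightarrow> 'a \<Rightarrow> 'a measure) \<Rightarrow> ('a \<Rightarrow> real) \<Rightarrow> real \<Rightarrow> real \<Rightarrow> 'a \<Rightarrow> real" where
  "D1Lv p u t \<eta> x = (1 / t) * (ptf p t (ptf p \<eta> u) x - ptf p \<eta> u x)"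

definition Ihat :: "'a measure \<Rightarrow> (real \<Rightarrow> 'a::topological_space \<Rightarrow> 'a measure) \<Rightarrow> 'a measure \<Rightarrow> ereal" where
  "Ihat m p \<mu> = - (INF z \<in> {(u, t, \<eta>, \<epsilon>). u \<in> Dset m \<and> t > 0 \<and> \<eta> \<ge> 0 \<and> \<epsilon> > 0}.
      (case z of (u, t, \<eta>, \<epsilon>) \<Rightarrow>
         ereal (\<integral>x. D1Lv p u t \<eta> x / (D1v p u t \<eta> x + \<epsilon>) \<partial>\<mu>)))"

definition Irate :: "'a measure \<Rightarrow> (real \<Rightarrow> 'a::topological_space \<Rightarrow> 'a measure) \<Rightarrow> 'a measure \<Rightarrow> ereal" where
  "Irate m p \<mu> = (if absolutely_continuous m \<mu> then Ihat m p \<mu> else \<infinity>)"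

end

theory Submission
  imports Defs
begin

text \<open>
  Both sides are compared with the approximating forms \<open>E\<^sub>t f = \<langle>f - T\<^sub>t f, f\<rangle> / t\<close>.

  If \<open>f \<in> D(H)\<close> then \<open>E\<^sub>t f \<le> \<parallel>H f\<parallel>\<^sup>2\<close>; conversely, if \<open>E\<^sub>t f \<le> C\<close> for all \<open>t > 0\<close>, then
  \<open>f \<in> D(H)\<close> and \<open>\<parallel>H f\<parallel>\<^sup>2 \<le> C\<close>. Instead of the spectral theorem one uses that \<open>t \<mapsto> \<langle>T\<^sub>t k, k\<rangle>\<close> is
  midpoint convex, together with the resolvents of \<open>H\<^sup>2\<close>, which exist by the Riesz argument in the
  graph norm of \<open>H\<close>.

  If \<open>E\<^sub>h f \<le> C\<close> for all \<open>h > 0\<close> then \<open>I(\<mu>) \<le> C\<close>: for \<open>z > 0\<close>, symmetry of \<open>m(dx) p\<^sub>h(x, dy)\<close> and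
  \<open>2 f(x) f(y) \<le> f(x)\<^sup>2 z(y) / z(x) + f(y)\<^sup>2 z(x) / z(y)\<close> give \<open>\<langle>T\<^sub>h f, f\<rangle> \<le> \<integral> p\<^sub>h z / z d\<mu>\<close>; take
  \<open>z = v + \<epsilon>\<close> with \<open>v \<in> D\<^sub>1\<close> and let \<open>h \<rightarrow> 0\<close>.

  Conversely \<open>E\<^sub>t f \<le> I(\<mu>)\<close>: integrating the definition of \<open>I\<close> along \<open>s \<mapsto> p\<^sub>s u\<close> yields
  \<open>\<integral> ln ((p\<^sub>t u + \<epsilon>) / (u + \<epsilon>)) d\<mu> \<ge> - t I(\<mu>)\<close>, and since \<open>ln y \<le> y - 1\<close> this gives
  \<open>\<integral> 1 - (p\<^sub>t u + \<epsilon>) / (u + \<epsilon>) d\<mu> \<le> t I(\<mu>)\<close>; let \<open>u \<up> f\<close> and \<open>\<epsilon> \<rightarrow> 0\<close>.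
\<close>

subsection \<open>Semi-inner products on sets of functions\<close>

text \<open>Operators act on functions, and \<open>T t\<close> and \<open>H\<close> are pinned down
  only up to null sets. Equations between them are therefore stated as equations of inner products
  against test functions, and the Hilbert space arguments use semidefinite forms on sets of
  functions.

  Two gaps shape the probabilistic half. First, \<open>p\<close> describes \<open>T\<close> only on
  bounded square integrable functions, while \<open>f\<close> may be unbounded and \<open>m\<close>
  infinite; truncations and monotone limits of nonnegative double integrals bridge this.
  Contractivity of \<open>T t\<close> is derived too: symmetry makes \<open>m\<close> invariant, and
  Jensen's inequality does the rest. Second, the functional does not offer the logarithmic
  derivative along s \<mapsto> p_s u itself: an element of D_1 has an exact difference quotient in
  the numerator but a time average in the denominator. Taking for \<open>\<eta>\<close> the points
  of a time grid gives a Riemann sum, and replacing the denominators costs the square of the step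
  per term, provided p_s u is Lipschitz in s. This holds when u is itself a time average; the
  averaging, and then the integrability of u, are removed by limits.\<close>

lemma discriminant_nonpos:
  fixes P Q R :: real
  assumes "\<And>a b. 0 \<le> a\<^sup>2 * P + 2 * a * b * Q + b\<^sup>2 * R"
  shows "Q\<^sup>2 \<le> P * R"
proof -
  have R0: "0 \<le> R" using assms[of 0 1] by simp
  show ?thesis
  proof (cases "R = 0")
    case False
    \<comment> \<open>For a = R the form is minimal at b = -Q.\<close>
    have "0 \<le> R * (P * R - Q\<^sup>2)"
      using assms[of R "- Q"] by (simp add: algebra_simps power2_eq_square)
    then show ?thesis using R0 False by (simp add: zero_le_mult_iff)
  next
    case True
    have "Q = 0"
    proof (rule ccontr)
      assume "Q \<noteq> 0"
      \<comment> \<open>With R = 0 and a = 1 the form is affine in b, and this b gives it the value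
        -1.\<close>
      then show False using assms[of 1 "- (P + 1) / (2 * Q)"] True by (simp add: field_simps)
    qed
    then show ?thesis using True by simp
  qed
qed

text \<open>\<open>B\<close> is only semidefinite, because functions equal almost everywhere are not
  identified. The axioms are shared by the inner product on \<open>L2 m\<close> and on
  \<open>DH\<close>, the forms \<langle>f - T_t f, g\<rangle> and the graph forms of
  \<open>H\<close>.\<close>

locale semi_inner =
  fixes V :: "('a \<Rightarrow> real) set" and B :: "('a \<Rightarrow> real) \<Rightarrow> ('a \<Rightarrow> real) \<Rightarrow> real"
  assumes nonempty: "V \<noteq> {}"
    and lin_closed: "f \<in> V \<Longrightarrow> g \<in> V \<Longrightarrow> (\<lambda>x. a * f x + b * g x) \<in> V"
    and lin_left: "f \<in> V \<Longrightarrow> g \<in> V \<Longrightarrow> h \<in> V \<Longrightarrow>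
      B (\<lambda>x. a * f x + b * g x) h = a * B f h + b * B g h"
    and sym: "f \<in> V \<Longrightarrow> g \<in> V \<Longrightarrow> B f g = B g f"
    and nonneg: "f \<in> V \<Longrightarrow> 0 \<le> B f f"
begin

lemma diff_closed: "f \<in> V \<Longrightarrow> g \<in> V \<Longrightarrow> (\<lambda>x. f x - g x) \<in> V"
  using lin_closed[of f g 1 "-1"] by simp

lemma diff_left: "f \<in> V \<Longrightarrow> g \<in> V \<Longrightarrow> h \<in> V \<Longrightarrow> B (\<lambda>x. f x - g x) h = B f h - B g h"
  using lin_left[of f g h 1 "-1"] by simp

lemma lin_right: "f \<in> V \<Longrightarrow> g \<in> V \<Longrightarrow> h \<in> V \<Longrightarrow>
    B h (\<lambda>x. a * f x + b * g x) = a * B h f + b * B h g"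
  by (simp add: lin_left lin_closed sym[of h])

lemma quad: "f \<in> V \<Longrightarrow> g \<in> V \<Longrightarrow>
    B (\<lambda>x. a * f x + b * g x) (\<lambda>x. a * f x + b * g x) = a\<^sup>2 * B f f + 2 * a * b * B f g + b\<^sup>2 * B g g"
  by (simp add: lin_left lin_right lin_closed sym[of g f] power2_eq_square algebra_simps)

lemma quad_diff: "f \<in> V \<Longrightarrow> g \<in> V \<Longrightarrow>
    B (\<lambda>x. f x - g x) (\<lambda>x. f x - g x) = B f f - 2 * B f g + B g g"
  using quad[of f g 1 "-1"] by simp

lemma cauchy_schwarz: "f \<in> V \<Longrightarrow> g \<in> V \<Longrightarrow> (B f g)\<^sup>2 \<le> B f f * B g g"
  using nonneg[OF lin_closed[of f g]] by (intro discriminant_nonpos) (simp add: quad)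

lemma cauchy_schwarz_abs: "f \<in> V \<Longrightarrow> g \<in> V \<Longrightarrow> \<bar>B f g\<bar> \<le> sqrt (B f f) * sqrt (B g g)"
  using real_sqrt_le_mono[OF cauchy_schwarz[of f g]] by (simp add: real_sqrt_mult)

text \<open>The filter is arbitrary because the lemma serves both sequences and limits as t
  decreases to 0.\<close>

lemma tendsto_left:
  assumes "\<And>n. X n \<in> V" "f \<in> V" "g \<in> V"
    and "((\<lambda>n. B (\<lambda>x. X n x - f x) (\<lambda>x. X n x - f x)) \<longlongrightarrow> 0) F"
  shows "((\<lambda>n. B (X n) g) \<longlongrightarrow> B f g) F"
proof (rule LIM_zero_cancel, rule tendsto_rabs_zero_cancel, rule tendsto_sandwich)
  let ?d = "\<lambda>n. B (\<lambda>x. X n x - f x) (\<lambda>x. X n x - f x)"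
  show "\<forall>\<^sub>F n in F. 0 \<le> \<bar>B (X n) g - B f g\<bar>" by simp
  show "\<forall>\<^sub>F n in F. \<bar>B (X n) g - B f g\<bar> \<le> sqrt (?d n) * sqrt (B g g)"
    using cauchy_schwarz_abs[OF diff_closed[OF assms(1) assms(2)] assms(3)] assms(1-3) by (simp add: diff_left)
  show "((\<lambda>n. sqrt (?d n) * sqrt (B g g)) \<longlongrightarrow> 0) F"
    using tendsto_mult_right[OF tendsto_real_sqrt[OF assms(4)], of "sqrt (B g g)"] by simp
qed simp

lemma tendsto_quad:
  assumes "\<And>n. X n \<in> V" "f \<in> V"
    and "((\<lambda>n. B (\<lambda>x. X n x - f x) (\<lambda>x. X n x - f x)) \<longlongrightarrow> 0) F"
  shows "((\<lambda>n. B (X n) (X n)) \<longlongrightarrow> B f f) F"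
proof -
  let ?d = "\<lambda>n. B (\<lambda>x. X n x - f x) (\<lambda>x. X n x - f x)"
  have "B (X n) (X n) = ?d n + 2 * B (X n) f - B f f" for n
    using quad_diff[OF assms(1) assms(2), of n] by simp
  moreover have "((\<lambda>n. ?d n + 2 * B (X n) f - B f f) \<longlongrightarrow> 0 + 2 * B f f - B f f) F"
    by (intro tendsto_intros assms tendsto_left)
  ultimately show ?thesis by simp
qed

lemma tendsto_inner:
  assumes "\<And>n. X n \<in> V" "\<And>n. Y n \<in> V" "f \<in> V" "g \<in> V"
    and X: "((\<lambda>n. B (\<lambda>x. X n x - f x) (\<lambda>x. X n x - f x)) \<longlongrightarrow> 0) F"
    and Y: "((\<lambda>n. B (\<lambda>x. Y n x - g x) (\<lambda>x. Y n x - g x)) \<longlongrightarrow> 0) F"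
  shows "((\<lambda>n. B (X n) (Y n)) \<longlongrightarrow> B f g) F"
proof -
  let ?d = "\<lambda>n. B (\<lambda>x. X n x - f x) (\<lambda>x. X n x - f x)"
  have "((\<lambda>n. B (\<lambda>x. X n x - f x) (Y n)) \<longlongrightarrow> 0) F"
  proof (rule tendsto_rabs_zero_cancel, rule tendsto_sandwich)
    show "\<forall>\<^sub>F n in F. 0 \<le> \<bar>B (\<lambda>x. X n x - f x) (Y n)\<bar>" by simp
    show "\<forall>\<^sub>F n in F. \<bar>B (\<lambda>x. X n x - f x) (Y n)\<bar> \<le> sqrt (?d n) * sqrt (B (Y n) (Y n))"
      by (intro always_eventually allI cauchy_schwarz_abs diff_closed assms)
    have "((\<lambda>n. sqrt (?d n) * sqrt (B (Y n) (Y n))) \<longlongrightarrow> sqrt 0 * sqrt (B g g)) F"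
      by (intro tendsto_mult tendsto_real_sqrt X tendsto_quad assms)
    then show "((\<lambda>n. sqrt (?d n) * sqrt (B (Y n) (Y n))) \<longlongrightarrow> 0) F" by simp
  qed simp
  moreover have "((\<lambda>n. B f (Y n)) \<longlongrightarrow> B f g) F"
    using tendsto_left[OF assms(2,4,3) Y] sym[OF assms(3,2)] sym[OF assms(3,4)] by simp
  ultimately have "((\<lambda>n. B (\<lambda>x. X n x - f x) (Y n) + B f (Y n)) \<longlongrightarrow> 0 + B f g) F"
    by (rule tendsto_add)
  then show ?thesis using assms by (simp add: diff_left)
qed

text \<open>The sequence minimises \<open>B k k - 2 * l k\<close>.\<close>
lemma riesz_sequence:
  assumes lin: "\<And>f g a b. f \<in> V \<Longrightarrow> g \<in> V \<Longrightarrow> l (\<lambda>x. a * f x + b * g x) = a * l f + b * l g"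
    and bound: "\<And>f. f \<in> V \<Longrightarrow> (l f)\<^sup>2 \<le> C * B f f"
  obtains X where "\<And>n. X n \<in> V"
    and "\<And>e. 0 < e \<Longrightarrow> \<exists>N. \<forall>m\<ge>N. \<forall>n\<ge>N. B (\<lambda>x. X m x - X n x) (\<lambda>x. X m x - X n x) < e"
    and "\<And>g. g \<in> V \<Longrightarrow> (\<lambda>n. B (X n) g) \<longlonglongrightarrow> l g"
proof -
  define q where "q f = B f f - 2 * l f" for f
  have q_ge: "- \<bar>C\<bar> \<le> q f" if f: "f \<in> V" for f
  proof -
    have "(l f)\<^sup>2 \<le> \<bar>C\<bar> * B f f"
      using bound[OF f] nonneg[OF f] by (meson abs_ge_self mult_right_mono order_trans)
    moreover have "0 \<le> (\<bar>C\<bar> - B f f)\<^sup>2" by simp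
    ultimately have "(2 * l f)\<^sup>2 \<le> (\<bar>C\<bar> + B f f)\<^sup>2"
      by (simp add: power2_eq_square algebra_simps)
    then have "\<bar>2 * l f\<bar> \<le> \<bar>C\<bar> + B f f"
      using nonneg[OF f] by (metis abs_ge_zero abs_le_square_iff abs_of_nonneg add_nonneg_nonneg)
    then show ?thesis unfolding q_def by linarith
  qed
  define d where "d = Inf (q ` V)"
  have bdd: "bdd_below (q ` V)" using q_ge by (auto intro!: bdd_belowI)
  have d_le: "d \<le> q f" if "f \<in> V" for f
    unfolding d_def using bdd that by (auto intro!: cInf_lower)
  have "\<exists>f\<in>V. q f < d + 1 / real (Suc n)" for n
  proof -
    have "Inf (q ` V) < d + 1 / real (Suc n)" unfolding d_def by simp
    then show ?thesis using cInf_lessD[of "q ` V"] nonempty by blast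
  qed
  then obtain X where XV: "\<And>n. X n \<in> V" and qX: "\<And>n. q (X n) < d + 1 / real (Suc n)" by metis
  show thesis
  proof
    show "X n \<in> V" for n by fact
    \<comment> \<open>The value of \<open>q\<close> at the midpoint is at least \<open>d\<close>; by
      the parallelogram law, nearly minimal values then force small distances.\<close>
    have par: "B (\<lambda>x. X m x - X n x) (\<lambda>x. X m x - X n x) \<le> 2 * (q (X m) - d) + 2 * (q (X n) - d)" for m n
    proof -
      let ?z = "\<lambda>x. (1/2) * X m x + (1/2) * X n x"
      have "d \<le> B ?z ?z - 2 * l ?z" using d_le[OF lin_closed[OF XV XV]] unfolding q_def .
      also have "\<dots> = (1/4) * B (X m) (X m) + (1/2) * B (X m) (X n) + (1/4) * B (X n) (X n) - l (X m) - l (X n)"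
        unfolding quad[OF XV XV] lin[OF XV XV] by (simp add: power2_eq_square)
      finally show ?thesis unfolding q_def quad_diff[OF XV XV] by (simp add: algebra_simps)
    qed
    show "\<exists>N. \<forall>m\<ge>N. \<forall>n\<ge>N. B (\<lambda>x. X m x - X n x) (\<lambda>x. X m x - X n x) < e" if "0 < e" for e
    proof -
      obtain N where N: "1 / real (Suc N) < e / 4"
        using \<open>0 < e\<close> by (metis nat_approx_posE divide_pos_pos zero_less_numeral)
      have small: "q (X n) - d < e / 4" if "n \<ge> N" for n
      proof -
        have "1 / real (Suc n) \<le> 1 / real (Suc N)" using that by (simp add: field_simps)
        then show ?thesis using qX[of n] N by linarith
      qed
      have "B (\<lambda>x. X m x - X n x) (\<lambda>x. X m x - X n x) < e" if "m \<ge> N" "n \<ge> N" for m n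
      proof (rule order.strict_trans1[OF par])
        show "2 * (q (X m) - d) + 2 * (q (X n) - d) < e"
          using add_strict_mono[OF small[OF that(1)] small[OF that(2)]] by (simp add: field_simps)
      qed
      then show ?thesis by blast
    qed
    show "(\<lambda>n. B (X n) g) \<longlonglongrightarrow> l g" if g: "g \<in> V" for g
    proof (rule LIM_zero_cancel, rule tendsto_rabs_zero_cancel, rule tendsto_sandwich)
      \<comment> \<open>The excess over \<open>d\<close> of \<open>q\<close> at X n + s g is a
        nonnegative quadratic polynomial in s whose linear coefficient is twice B (X n) g - l g.
        Homogenising with s = b / a fits it to \<open>discriminant_nonpos\<close>.\<close>
      have le: "(B (X n) g - l g)\<^sup>2 \<le> (q (X n) - d) * B g g" for n
      proof (rule discriminant_nonpos)
        fix a b :: real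
        show "0 \<le> a\<^sup>2 * (q (X n) - d) + 2 * a * b * (B (X n) g - l g) + b\<^sup>2 * B g g"
        proof (cases "a = 0")
          case True then show ?thesis using nonneg[OF g] by simp
        next
          case False
          have "d \<le> q (\<lambda>x. 1 * X n x + (b / a) * g x)" by (intro d_le lin_closed XV g)
          also have "\<dots> = q (X n) + 2 * (b / a) * (B (X n) g - l g) + (b / a)\<^sup>2 * B g g"
            unfolding q_def quad[OF XV g] lin[OF XV g] using False by (simp add: field_simps)
          finally have "a\<^sup>2 * d \<le> a\<^sup>2 * (q (X n) + 2 * (b / a) * (B (X n) g - l g) + (b / a)\<^sup>2 * B g g)"
            by (intro mult_left_mono) auto
          also have "\<dots> = a\<^sup>2 * q (X n) + 2 * a * b * (B (X n) g - l g) + b\<^sup>2 * B g g"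
            using False by (simp add: field_simps power2_eq_square)
          finally show ?thesis by (simp add: algebra_simps)
        qed
      qed
      show "\<forall>\<^sub>F n in sequentially. 0 \<le> \<bar>B (X n) g - l g\<bar>" by simp
      show "\<forall>\<^sub>F n in sequentially. \<bar>B (X n) g - l g\<bar> \<le> sqrt (1 / real (Suc n) * B g g)"
      proof (intro always_eventually allI)
        fix n
        have "(B (X n) g - l g)\<^sup>2 \<le> 1 / real (Suc n) * B g g"
          using le[of n] mult_right_mono[OF less_imp_le nonneg[OF g], of "q (X n) - d" "1 / real (Suc n)"] qX[of n]
          by simp
        then show "\<bar>B (X n) g - l g\<bar> \<le> sqrt (1 / real (Suc n) * B g g)"
          by (metis real_sqrt_abs real_sqrt_le_iff)
      qed
      have "(\<lambda>n. sqrt (1 / real (Suc n) * B g g)) \<longlonglongrightarrow> sqrt (0 * B g g)"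
        by (intro tendsto_intros LIMSEQ_Suc[OF lim_1_over_n])
      then show "(\<lambda>n. sqrt (1 / real (Suc n) * B g g)) \<longlonglongrightarrow> 0" by simp
    qed simp
  qed
qed

end

subsection \<open>Square integrable functions\<close>

lemma L2_measurable[measurable_dest]: "f \<in> L2 M \<Longrightarrow> f \<in> borel_measurable M"
  by (simp add: L2_def)

lemma L2_square_integrable: "f \<in> L2 M \<Longrightarrow> integrable M (\<lambda>x. (f x)\<^sup>2)"
  by (simp add: L2_def)

lemma L2_mult_integrable:
  assumes f: "f \<in> L2 M" and g: "g \<in> L2 M"
  shows "integrable M (\<lambda>x. f x * g x)"
proof (rule Bochner_Integration.integrable_bound)
  show "integrable M (\<lambda>x. (f x)\<^sup>2 + (g x)\<^sup>2)" using f g by (auto simp: L2_def)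
  show "(\<lambda>x. f x * g x) \<in> borel_measurable M" using f g by (auto simp: L2_def)
  have "\<bar>a * b\<bar> \<le> a\<^sup>2 + b\<^sup>2" for a b :: real
  proof -
    have "0 \<le> \<bar>a\<bar>\<^sup>2 - 2 * (\<bar>a\<bar> * \<bar>b\<bar>) + \<bar>b\<bar>\<^sup>2"
      using zero_le_power2[of "\<bar>a\<bar> - \<bar>b\<bar>"] unfolding power2_diff by (simp add: mult.assoc)
    moreover have "0 \<le> \<bar>a\<bar> * \<bar>b\<bar>" by simp
    ultimately show ?thesis unfolding abs_mult power2_abs by linarith
  qed
  then show "AE x in M. norm (f x * g x) \<le> norm ((f x)\<^sup>2 + (g x)\<^sup>2)" by simp
qed

lemma L2_lin_closed:
  assumes f: "f \<in> L2 M" and g: "g \<in> L2 M"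
  shows "(\<lambda>x. a * f x + b * g x) \<in> L2 M"
proof -
  have "(\<lambda>x. (a * f x + b * g x)\<^sup>2) = (\<lambda>x. a\<^sup>2 * (f x)\<^sup>2 + 2 * a * b * (f x * g x) + b\<^sup>2 * (g x)\<^sup>2)"
    by (auto simp: power2_eq_square algebra_simps)
  moreover have "integrable M \<dots>"
    using L2_mult_integrable[OF f g] L2_square_integrable[OF f] L2_square_integrable[OF g] by auto
  ultimately show ?thesis using f g by (auto simp: L2_def)
qed

lemma L2_diff_closed: "f \<in> L2 M \<Longrightarrow> g \<in> L2 M \<Longrightarrow> (\<lambda>x. f x - g x) \<in> L2 M"
  using L2_lin_closed[of f M g 1 "-1"] by simp

interpretation L2: semi_inner "L2 M" "L2inner M" for M
proof
  have "(\<lambda>x. 0) \<in> L2 M" by (simp add: L2_def)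
  then show "L2 M \<noteq> {}" by auto
  fix f g h :: "'a \<Rightarrow> real" and a b :: real
  assume f: "f \<in> L2 M" and g: "g \<in> L2 M"
  show "(\<lambda>x. a * f x + b * g x) \<in> L2 M" using f g by (rule L2_lin_closed)
  show "L2inner M f g = L2inner M g f" by (simp add: L2inner_def mult.commute)
  assume h: "h \<in> L2 M"
  show "L2inner M (\<lambda>x. a * f x + b * g x) h = a * L2inner M f h + b * L2inner M g h"
    using L2_mult_integrable[OF f h] L2_mult_integrable[OF g h]
    by (simp add: L2inner_def distrib_right mult.assoc)
qed (simp add: L2inner_def)

lemma L2inner_cong_AE:
  assumes "f \<in> borel_measurable M" "f' \<in> borel_measurable M"
    "g \<in> borel_measurable M" "g' \<in> borel_measurable M"
    "AE x in M. f x = f' x" "AE x in M. g x = g' x"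
  shows "L2inner M f g = L2inner M f' g'"
  unfolding L2inner_def using assms by (intro integral_cong_AE) auto

lemma L2norm_eq: "L2norm M f = sqrt (L2inner M f f)"
  by (simp add: L2norm_def L2inner_def power2_eq_square)

lemma L2norm_power2: "f \<in> L2 M \<Longrightarrow> (L2norm M f)\<^sup>2 = L2inner M f f"
  by (simp add: L2norm_eq L2.nonneg)

lemma L2_tendsto_AE_subseq:
  assumes X: "\<And>n. X n \<in> L2 M" and f: "f \<in> L2 M"
    and lim: "(\<lambda>n. L2inner M (\<lambda>x. X n x - f x) (\<lambda>x. X n x - f x)) \<longlonglongrightarrow> 0"
  obtains r :: "nat \<Rightarrow> nat" where "strict_mono r" "AE x in M. (\<lambda>n. X (r n) x) \<longlonglongrightarrow> f x"
proof -
  have "\<exists>r. strict_mono r \<and> (AE x in M. (\<lambda>n. (X (r n) x - f x)\<^sup>2) \<longlonglongrightarrow> 0)"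
  proof (rule tendsto_L1_AE_subseq)
    show "integrable M (\<lambda>x. (X n x - f x)\<^sup>2)" for n
      using L2_diff_closed[OF X f] by (simp add: L2_def)
    show "(\<lambda>n. \<integral>x. norm ((X n x - f x)\<^sup>2) \<partial>M) \<longlonglongrightarrow> 0"
      using lim by (simp add: L2inner_def power2_eq_square)
  qed
  then obtain r :: "nat \<Rightarrow> nat" where r: "strict_mono r" "AE x in M. (\<lambda>n. (X (r n) x - f x)\<^sup>2) \<longlonglongrightarrow> 0"
    by blast
  from r(2) have "AE x in M. (\<lambda>n. X (r n) x) \<longlonglongrightarrow> f x"
  proof (rule AE_mp, intro AE_I2 impI)
    fix x assume "(\<lambda>n. (X (r n) x - f x)\<^sup>2) \<longlonglongrightarrow> 0"
    from tendsto_real_sqrt[OF this] have "(\<lambda>n. \<bar>X (r n) x - f x\<bar>) \<longlonglongrightarrow> 0" by simp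
    then show "(\<lambda>n. X (r n) x) \<longlonglongrightarrow> f x"
      by (simp add: LIM_zero_iff tendsto_rabs_zero_iff)
  qed
  with r(1) show thesis by (rule that)
qed

text \<open>Multiplying by a strictly positive square integrable weight turns an \<open>L2\<close> Cauchy sequence
  into an \<open>L1\<close> one, which supplies the almost everywhere limit.\<close>
lemma (in sigma_finite_measure) L2_complete:
  assumes X: "\<And>n. X n \<in> L2 M"
    and Cauchy: "\<And>e. 0 < e \<Longrightarrow>
      \<exists>N. \<forall>m\<ge>N. \<forall>n\<ge>N. L2inner M (\<lambda>x. X m x - X n x) (\<lambda>x. X m x - X n x) < e"
  obtains f where "f \<in> L2 M"
    "(\<lambda>n. L2inner M (\<lambda>x. X n x - f x) (\<lambda>x. X n x - f x)) \<longlonglongrightarrow> 0"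
proof -
  obtain w :: "'a \<Rightarrow> real" where w: "w \<in> borel_measurable M" "\<And>x. w x > 0" "\<And>x. w x \<le> 1" "integrable M w"
    using obtain_positive_integrable_function by blast
  note w(1)[measurable]
  have wL: "w \<in> L2 M"
  proof -
    have "integrable M (\<lambda>x. (w x)\<^sup>2)"
    proof (rule Bochner_Integration.integrable_bound[OF w(4)])
      have "(w x)\<^sup>2 \<le> w x" for x
        using w(2)[of x] w(3)[of x] by (simp add: power2_eq_square mult_left_le)
      then show "AE x in M. norm ((w x)\<^sup>2) \<le> norm (w x)"
        using w(2) by (simp add: less_imp_le)
    qed simp
    then show ?thesis by (simp add: L2_def w)
  qed
  have Xm[measurable]: "X n \<in> borel_measurable M" for n using X L2_measurable by blast
  define d where "d m n = L2inner M (\<lambda>x. X m x - X n x) (\<lambda>x. X m x - X n x)" for m n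
  have d_eq: "ennreal (d m n) = (\<integral>\<^sup>+x. ennreal ((X m x - X n x)\<^sup>2) \<partial>M)" for m n
    unfolding d_def L2inner_def using L2_square_integrable[OF L2_diff_closed[OF X X], of m n]
    by (simp add: nn_integral_eq_integral power2_eq_square)
  obtain r where r: "strict_mono r" and rC: "AE x in M. Cauchy (\<lambda>i. w x * X (r i) x)"
  proof (rule cauchy_L1_AE_cauchy_subseq)
    show "integrable M (\<lambda>x. w x * X n x)" for n by (rule L2_mult_integrable[OF wL X])
    show "\<exists>N. \<forall>i\<ge>N. \<forall>j\<ge>N. (\<integral>x. norm (w x * X i x - w x * X j x) \<partial>M) < e" if "0 < e" for e
    proof -
      \<comment> \<open>The summand 1 keeps the divisor positive even if the norm of
        \<open>w\<close> is 0.\<close>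
      let ?W = "sqrt (L2inner M w w) + 1"
      have W: "0 < ?W" using L2.nonneg[OF wL] by (smt (verit) real_sqrt_ge_zero)
      obtain N where N: "\<forall>m\<ge>N. \<forall>n\<ge>N. d m n < (e / ?W)\<^sup>2"
        using Cauchy[of "(e / ?W)\<^sup>2"] \<open>0 < e\<close> W unfolding d_def by auto
      have "(\<integral>x. norm (w x * X i x - w x * X j x) \<partial>M) < e" if "i \<ge> N" "j \<ge> N" for i j
      proof -
        let ?u = "\<lambda>x. \<bar>X i x - X j x\<bar>"
        have u: "?u \<in> L2 M" using L2_diff_closed[OF X X, of i j] by (simp add: L2_def)
        have "(\<integral>x. norm (w x * X i x - w x * X j x) \<partial>M) = L2inner M w ?u"
          unfolding L2inner_def using w(2)
          by (intro Bochner_Integration.integral_cong) (auto simp: abs_mult less_imp_le simp flip: right_diff_distrib)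
        also have "\<dots> \<le> sqrt (L2inner M w w) * sqrt (L2inner M ?u ?u)"
          using L2.cauchy_schwarz_abs[OF wL u] by linarith
        also have "L2inner M ?u ?u = d i j" unfolding d_def L2inner_def by (simp flip: abs_mult)
        also have "sqrt (L2inner M w w) * sqrt (d i j) \<le> ?W * sqrt (d i j)"
          using L2.nonneg[OF L2_diff_closed[OF X X], of i j] unfolding d_def by (intro mult_right_mono) auto
        also have "\<dots> < ?W * (e / ?W)"
        proof (rule mult_strict_left_mono[OF _ W])
          have "sqrt (d i j) < sqrt ((e / ?W)\<^sup>2)" using N that by (intro real_sqrt_less_mono) auto
          then show "sqrt (d i j) < e / ?W" using \<open>0 < e\<close> W by simp
        qed
        finally show ?thesis using W by simp
      qed
      then show ?thesis by blast
    qed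
  qed
  define f where "f x = lim (\<lambda>i. X (r i) x)" for x
  have f_meas[measurable]: "f \<in> borel_measurable M" unfolding f_def by measurable
  have flim: "AE x in M. (\<lambda>i. X (r i) x) \<longlonglongrightarrow> f x"
    using rC
  proof (rule AE_mp, intro AE_I2 impI)
    fix x assume "Cauchy (\<lambda>i. w x * X (r i) x)"
    then have "convergent (\<lambda>i. w x * X (r i) x)" by (simp add: Cauchy_convergent)
    then have "convergent (\<lambda>i. X (r i) x)"
      using w(2)[of x] by (subst (asm) convergent_mult_const_iff) auto
    then show "(\<lambda>i. X (r i) x) \<longlonglongrightarrow> f x" by (simp add: f_def convergent_LIMSEQ_iff)
  qed
  \<comment> \<open>Fatou along the subsequence carries the Cauchy bound over to the limit.
    Nonnegative integrals are used because \<open>f\<close> is not yet known to be square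
    integrable.\<close>
  have fatou: "\<exists>N. \<forall>n\<ge>N. (\<integral>\<^sup>+x. ennreal ((X n x - f x)\<^sup>2) \<partial>M) \<le> ennreal e" if "0 < e" for e
  proof -
    obtain N where N: "\<forall>m\<ge>N. \<forall>n\<ge>N. d m n < e" using Cauchy[OF \<open>0 < e\<close>] unfolding d_def by blast
    have "(\<integral>\<^sup>+x. ennreal ((X n x - f x)\<^sup>2) \<partial>M) \<le> ennreal e" if "n \<ge> N" for n
    proof -
      have "(\<integral>\<^sup>+x. ennreal ((X n x - f x)\<^sup>2) \<partial>M)
          = (\<integral>\<^sup>+x. liminf (\<lambda>i. ennreal ((X n x - X (r i) x)\<^sup>2)) \<partial>M)"
      proof (rule nn_integral_cong_AE, rule AE_mp[OF flim], intro AE_I2 impI)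
        fix x assume "(\<lambda>i. X (r i) x) \<longlonglongrightarrow> f x"
        then have "(\<lambda>i. ennreal ((X n x - X (r i) x)\<^sup>2)) \<longlonglongrightarrow> ennreal ((X n x - f x)\<^sup>2)"
          by (intro tendsto_intros) 
        then show "ennreal ((X n x - f x)\<^sup>2) = liminf (\<lambda>i. ennreal ((X n x - X (r i) x)\<^sup>2))"
          by (metis lim_imp_Liminf sequentially_bot)
      qed
      also have "\<dots> \<le> liminf (\<lambda>i. \<integral>\<^sup>+x. ennreal ((X n x - X (r i) x)\<^sup>2) \<partial>M)"
        by (rule nn_integral_liminf) simp
      also have "\<dots> \<le> ennreal e"
      proof (rule order_trans[OF Liminf_le_Limsup Limsup_bounded])
        show "\<forall>\<^sub>F i in sequentially. (\<integral>\<^sup>+x. ennreal ((X n x - X (r i) x)\<^sup>2) \<partial>M) \<le> ennreal e"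
          using eventually_ge_at_top[of N]
        proof eventually_elim
          case (elim i)
          then have "r i \<ge> N" using seq_suble[OF r, of i] by linarith
          then show ?case using N that by (auto simp flip: d_eq intro!: ennreal_leI simp: less_imp_le)
        qed
      qed simp
      finally show ?thesis .
    qed
    then show ?thesis by blast
  qed
  obtain N where N: "\<And>n. n \<ge> N \<Longrightarrow> (\<integral>\<^sup>+x. ennreal ((X n x - f x)\<^sup>2) \<partial>M) \<le> ennreal 1"
    using fatou[of 1] by auto
  have "(\<lambda>x. X N x - f x) \<in> L2 M"
    unfolding L2_def using N[of N] by (auto intro!: integrableI_nonneg simp: less_top[symmetric] top_unique)
  then have f: "f \<in> L2 M" using L2_diff_closed[OF X, of _ N] by fastforce
  show thesis
  proof (rule that[OF f])
    have "L2inner M (\<lambda>x. X n x - f x) (\<lambda>x. X n x - f x)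
        = enn2real (\<integral>\<^sup>+x. ennreal ((X n x - f x)\<^sup>2) \<partial>M)" for n
      unfolding L2inner_def by (subst integral_eq_nn_integral) (auto simp: power2_eq_square)
    then show "(\<lambda>n. L2inner M (\<lambda>x. X n x - f x) (\<lambda>x. X n x - f x)) \<longlonglongrightarrow> 0"
    proof (intro LIMSEQ_I)
      fix e :: real assume "0 < e"
      then obtain N where N: "\<And>n. n \<ge> N \<Longrightarrow> (\<integral>\<^sup>+x. ennreal ((X n x - f x)\<^sup>2) \<partial>M) \<le> ennreal (e / 2)"
        using fatou[of "e / 2"] by auto
      have "L2inner M (\<lambda>x. X n x - f x) (\<lambda>x. X n x - f x) \<le> e / 2" if "n \<ge> N" for n
        unfolding \<open>\<And>n. L2inner M (\<lambda>x. X n x - f x) (\<lambda>x. X n x - f x) = _\<close>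
        using N[OF that] \<open>0 < e\<close> by (intro enn2real_leI) auto
      then show "\<exists>N. \<forall>n\<ge>N. norm (L2inner M (\<lambda>x. X n x - f x) (\<lambda>x. X n x - f x) - 0) < e"
        using \<open>0 < e\<close> L2.nonneg[OF L2_diff_closed[OF X f]] by (intro exI[of _ N]) fastforce
    qed
  qed
qed

subsection \<open>The square root of the negative generator\<close>

text \<open>Since C * a \<le> C * (a + d), one factor a + d cancels. It is meant for a = ||H k||^2
  and d = c ||k - f||^2, which explains the two separate conclusions.\<close>

lemma le_of_square_sum_le:
  fixes a d C :: real
  assumes "0 \<le> a" "0 \<le> d" "0 \<le> C" "(a + d)\<^sup>2 \<le> C * a"
  shows "a \<le> C" "d \<le> C"
proof -
  have "0 \<le> C * d" using assms by simp
  then have "(a + d) * (a + d) \<le> C * (a + d)"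
    using assms(4) unfolding power2_eq_square distrib_left[of C] by linarith
  then have "a + d \<le> C \<or> a + d = 0" using assms(1,2)
    by (metis add_nonneg_nonneg less_le mult_le_cancel_right_pos)
  then show "a \<le> C" "d \<le> C" using assms by auto
qed

text \<open>Contractivity is the only trace of the Markov kernel in this part;
  \<open>T_contraction\<close> below supplies it.\<close>

locale sqrt_semigroup = sigma_finite_measure m for m :: "'a measure" +
  fixes T :: "real \<Rightarrow> ('a \<Rightarrow> real) \<Rightarrow> ('a \<Rightarrow> real)"
    and DH :: "('a \<Rightarrow> real) set" and H :: "('a \<Rightarrow> real) \<Rightarrow> ('a \<Rightarrow> real)"
  assumes semigroup: "strongly_continuous_semigroup m T"
    and symmetric: "symmetric_semigroup m T"
    and sqrt_gen: "is_sqrt_neg_generator m T DH H"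
    and contraction: "0 \<le> t \<Longrightarrow> f \<in> L2 m \<Longrightarrow> L2inner m (T t f) (T t f) \<le> L2inner m f f"
begin

abbreviation ip where "ip \<equiv> L2inner m"

section \<open>The symmetric semigroup and its approximating forms\<close>

lemma T_L2: "0 \<le> t \<Longrightarrow> f \<in> L2 m \<Longrightarrow> T t f \<in> L2 m"
  using semigroup[unfolded strongly_continuous_semigroup_def, THEN conjunct1] by blast

text \<open>\<open>T t\<close> is linear only almost everywhere, so linearity is stated after
  pairing with \<open>h\<close>.\<close>

lemma ip_T_lin:
  assumes "0 \<le> t" "f \<in> L2 m" "g \<in> L2 m" "h \<in> L2 m"
  shows "ip (T t (\<lambda>x. a * f x + b * g x)) h = a * ip (T t f) h + b * ip (T t g) h"
proof -
  have "AE x in m. T t (\<lambda>y. a * f y + b * g y) x = a * T t f x + b * T t g x"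
    using semigroup assms unfolding strongly_continuous_semigroup_def by blast
  then have "ip (T t (\<lambda>x. a * f x + b * g x)) h = ip (\<lambda>x. a * T t f x + b * T t g x) h"
    using assms by (intro L2inner_cong_AE L2_measurable T_L2 L2_lin_closed) auto
  also have "\<dots> = a * ip (T t f) h + b * ip (T t g) h"
    using assms by (intro L2.lin_left T_L2)
  finally show ?thesis .
qed

lemma ip_T_sym: "0 \<le> t \<Longrightarrow> f \<in> L2 m \<Longrightarrow> g \<in> L2 m \<Longrightarrow> ip (T t f) g = ip f (T t g)"
  using symmetric unfolding symmetric_semigroup_def by blast

lemma ip_T_half:
  assumes "0 \<le> t" "f \<in> L2 m"
  shows "ip (T (t / 2) f) (T (t / 2) f) = ip (T t f) f"
proof -
  have "AE x in m. T (t / 2 + t / 2) f x = T (t / 2) (T (t / 2) f) x"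
    using semigroup assms unfolding strongly_continuous_semigroup_def
    by (metis divide_nonneg_nonneg zero_le_numeral)
  then have "AE x in m. T t f x = T (t / 2) (T (t / 2) f) x" by simp
  then have "ip (T t f) f = ip (T (t / 2) (T (t / 2) f)) f"
    using assms by (intro L2inner_cong_AE L2_measurable T_L2) auto
  then show ?thesis using assms by (simp add: ip_T_sym T_L2)
qed

text \<open>Nonnegativity: \<langle>T_t f, f\<rangle> equals the squared norm of T_{t/2} f by
  symmetry, and T_{t/2} is a contraction.\<close>

lemma semi_inner_form:
  assumes t: "0 \<le> t"
  shows "semi_inner (L2 m) (\<lambda>f g. ip f g - ip (T t f) g)"
proof
  fix f g h :: "'a \<Rightarrow> real" and a b :: real
  assume f: "f \<in> L2 m" and g: "g \<in> L2 m"
  show "ip f g - ip (T t f) g = ip g f - ip (T t g) f"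
    using ip_T_sym[OF t f g] L2.sym[OF f g] L2.sym[OF f T_L2[OF t g]] by simp
  assume h: "h \<in> L2 m"
  show "ip (\<lambda>x. a * f x + b * g x) h - ip (T t (\<lambda>x. a * f x + b * g x)) h =
      a * (ip f h - ip (T t f) h) + b * (ip g h - ip (T t g) h)"
    using t f g h by (simp add: ip_T_lin L2.lin_left algebra_simps)
next
  fix f :: "'a \<Rightarrow> real"
  assume f: "f \<in> L2 m"
  have "ip (T t f) f \<le> ip f f"
    using contraction[of "t / 2" f] ip_T_half[OF t f] t f by simp
  then show "0 \<le> ip f f - ip (T t f) f" by simp
qed (use L2.nonempty in \<open>auto intro: L2_lin_closed\<close>)

text \<open>Midpoint convexity of \<open>t \<mapsto> ip (T t f) f\<close>.\<close>
lemma form_double: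
  assumes "0 \<le> t" "f \<in> L2 m"
  shows "ip f f - ip (T t f) f \<le> 2 * (ip f f - ip (T (t / 2) f) f)"
proof -
  have "0 \<le> ip (\<lambda>x. T (t / 2) f x - f x) (\<lambda>x. T (t / 2) f x - f x)"
    using assms by (intro L2.nonneg L2_diff_closed T_L2) auto
  also have "\<dots> = ip (T t f) f - 2 * ip (T (t / 2) f) f + ip f f"
    using assms by (simp add: L2.quad_diff T_L2 ip_T_half)
  finally show ?thesis by simp
qed

section \<open>Self-adjointness of the square root\<close>

lemma DH_L2: "f \<in> DH \<Longrightarrow> f \<in> L2 m"
  using sqrt_gen[unfolded is_sqrt_neg_generator_def, THEN conjunct1] by blast

lemma H_L2: "f \<in> DH \<Longrightarrow> H f \<in> L2 m"
  using sqrt_gen[unfolded is_sqrt_neg_generator_def, THEN conjunct2, THEN conjunct1] by blast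

lemma DH_dense: "g \<in> L2 m \<Longrightarrow> 0 < e \<Longrightarrow> \<exists>f\<in>DH. L2norm m (\<lambda>x. f x - g x) < e"
  using sqrt_gen[unfolded is_sqrt_neg_generator_def, THEN conjunct2, THEN conjunct2, THEN conjunct1]
  by blast

text \<open>The half of self-adjointness that produces members of \<open>DH\<close>: the adjoint has
  no larger domain than \<open>H\<close>.\<close>

lemma DH_I:
  assumes "g \<in> L2 m" "h \<in> L2 m" "\<And>f. f \<in> DH \<Longrightarrow> ip (H f) g = ip f h"
  shows "g \<in> DH"
  using sqrt_gen[unfolded is_sqrt_neg_generator_def, THEN conjunct2, THEN conjunct2, THEN conjunct2,
      THEN conjunct1, rule_format, OF assms(1)] assms(2,3) by blast

lemma ip_H_sym: "f \<in> DH \<Longrightarrow> g \<in> DH \<Longrightarrow> ip (H f) g = ip f (H g)"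
  using sqrt_gen[unfolded is_sqrt_neg_generator_def, THEN conjunct2, THEN conjunct2, THEN conjunct2,
      THEN conjunct2, THEN conjunct1] by blast

lemma H_generator: "f \<in> DH \<Longrightarrow> H f \<in> DH \<Longrightarrow> generator_limit m T f (\<lambda>x. - H (H f) x)"
  using sqrt_gen[unfolded is_sqrt_neg_generator_def, THEN conjunct2, THEN conjunct2, THEN conjunct2,
      THEN conjunct2, THEN conjunct2, THEN conjunct2, THEN conjunct2] by blast

lemma DH_seq:
  assumes "g \<in> L2 m"
  obtains X where "\<And>n. X n \<in> DH" "(\<lambda>n. ip (\<lambda>x. X n x - g x) (\<lambda>x. X n x - g x)) \<longlonglongrightarrow> 0"
proof -
  have "\<exists>f\<in>DH. L2norm m (\<lambda>x. f x - g x) < 1 / real (Suc n)" for n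
    using DH_dense[OF assms] by simp
  then obtain X where X: "\<And>n. X n \<in> DH" "\<And>n. L2norm m (\<lambda>x. X n x - g x) < 1 / real (Suc n)"
    by metis
  have d: "(\<lambda>x. X n x - g x) \<in> L2 m" for n
    by (intro L2_diff_closed assms DH_L2 X(1))
  have "(\<lambda>n. L2norm m (\<lambda>x. X n x - g x)) \<longlonglongrightarrow> 0"
  proof (rule tendsto_sandwich[where f = "\<lambda>_. 0" and h = "\<lambda>n. 1 / real (Suc n)"])
    show "(\<lambda>n. 1 / real (Suc n)) \<longlonglongrightarrow> 0" by (rule LIMSEQ_Suc[OF lim_1_over_n])
    show "\<forall>\<^sub>F n in sequentially. 0 \<le> L2norm m (\<lambda>x. X n x - g x)"
      by (simp add: L2norm_eq L2.nonneg d)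
    show "\<forall>\<^sub>F n in sequentially. L2norm m (\<lambda>x. X n x - g x) \<le> 1 / real (Suc n)"
      by (intro always_eventually allI less_imp_le X(2))
  qed simp
  from tendsto_power[OF this, of 2]
  have "(\<lambda>n. ip (\<lambda>x. X n x - g x) (\<lambda>x. X n x - g x)) \<longlonglongrightarrow> 0"
    by (simp only: L2norm_power2[OF d] zero_power2)
  with X(1) show thesis by (rule that)
qed

text \<open>Density of \<open>DH\<close> lets equality in L2 be tested on \<open>DH\<close>, where
  symmetry can move \<open>H\<close> to the other factor. The conclusion for every \<open>g\<close>
  in L2 plays the role of equality almost everywhere.\<close>

lemma DH_ip_eqI:
  assumes u: "u \<in> L2 m" and v: "v \<in> L2 m" and g: "g \<in> L2 m"
    and eq: "\<And>f. f \<in> DH \<Longrightarrow> ip u f = ip v f"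
  shows "ip u g = ip v g"
proof -
  obtain X where X: "\<And>n. X n \<in> DH" "(\<lambda>n. ip (\<lambda>x. X n x - g x) (\<lambda>x. X n x - g x)) \<longlonglongrightarrow> 0"
    using DH_seq[OF g] by blast
  have "(\<lambda>n. ip (X n) w) \<longlonglongrightarrow> ip g w" if "w \<in> L2 m" for w
    using that X DH_L2 g by (auto intro!: L2.tendsto_left)
  from this[OF u] this[OF v] have "(\<lambda>n. ip u (X n)) \<longlonglongrightarrow> ip u g" "(\<lambda>n. ip v (X n)) \<longlonglongrightarrow> ip v g"
    using u v g X(1) DH_L2 by (simp_all add: L2.sym)
  then show ?thesis using eq[OF X(1)] LIMSEQ_unique by simp
qed

text \<open>Linearity comes out of self-adjointness: the combination of \<open>H f\<close> and
  \<open>H g\<close> witnesses membership in the domain of the adjoint.\<close>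

lemma DH_lin_closed:
  assumes f: "f \<in> DH" and g: "g \<in> DH"
  shows "(\<lambda>x. a * f x + b * g x) \<in> DH"
proof (rule DH_I)
  show "(\<lambda>x. a * f x + b * g x) \<in> L2 m" "(\<lambda>x. a * H f x + b * H g x) \<in> L2 m"
    using f g by (auto intro: L2_lin_closed DH_L2 H_L2)
  show "ip (H k) (\<lambda>x. a * f x + b * g x) = ip k (\<lambda>x. a * H f x + b * H g x)" if "k \<in> DH" for k
    using that f g by (simp add: L2.lin_right DH_L2 H_L2 ip_H_sym)
qed

lemma ip_H_lin:
  assumes f: "f \<in> DH" and g: "g \<in> DH" and h: "h \<in> L2 m"
  shows "ip (H (\<lambda>x. a * f x + b * g x)) h = a * ip (H f) h + b * ip (H g) h"
proof -
  have "ip (H (\<lambda>x. a * f x + b * g x)) h = ip (\<lambda>x. a * H f x + b * H g x) h"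
  proof (rule DH_ip_eqI[OF _ _ h])
    fix k assume k: "k \<in> DH"
    have "ip (H (\<lambda>x. a * f x + b * g x)) k = ip (\<lambda>x. a * f x + b * g x) (H k)"
      using k f g by (intro ip_H_sym DH_lin_closed)
    also have "\<dots> = ip (\<lambda>x. a * H f x + b * H g x) k"
      using k f g by (simp add: L2.lin_left DH_L2 H_L2 ip_H_sym)
    finally show "ip (H (\<lambda>x. a * f x + b * g x)) k = ip (\<lambda>x. a * H f x + b * H g x) k" .
  qed (use f g in \<open>auto intro: L2_lin_closed H_L2 DH_lin_closed\<close>)
  then show ?thesis using f g h by (simp add: L2.lin_left H_L2)
qed

section \<open>Graph forms of H and resolvents of H^2\<close>

lemma DH_nonempty: "DH \<noteq> {}"
  using DH_dense[of "\<lambda>x. 0" 1] by (auto simp: L2_def)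

text \<open>A weight c > 0 gives a graph norm for the Riesz argument; c = 0 gives the energy form
  \<langle>H f, H g\<rangle> alone.\<close>

lemma semi_inner_graph:
  assumes c: "0 \<le> c" 
  shows "semi_inner DH (\<lambda>f g. ip (H f) (H g) + c * ip f g)"
proof
  fix f g h :: "'a \<Rightarrow> real" and a b :: real
  assume f: "f \<in> DH" and g: "g \<in> DH"
  show "ip (H f) (H g) + c * ip f g = ip (H g) (H f) + c * ip g f"
    using f g DH_L2 H_L2 by (simp add: L2.sym[of g] L2.sym[of "H g"])
  assume h: "h \<in> DH"
  show "ip (H (\<lambda>x. a * f x + b * g x)) (H h) + c * ip (\<lambda>x. a * f x + b * g x) h =
      a * (ip (H f) (H h) + c * ip f h) + b * (ip (H g) (H h) + c * ip g h)"
    using f g h by (simp add: ip_H_lin L2.lin_left DH_L2 H_L2 algebra_simps)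
next
  show "0 \<le> ip (H f) (H f) + c * ip f f" if "f \<in> DH" for f
    by (intro add_nonneg_nonneg mult_nonneg_nonneg c L2.nonneg H_L2 DH_L2 that)
qed (use DH_nonempty in \<open>auto intro: DH_lin_closed\<close>)

lemma ip_H_diff:
  assumes f: "f \<in> DH" and g: "g \<in> DH"
  shows "ip (H (\<lambda>x. f x - g x)) (H (\<lambda>x. f x - g x)) = ip (\<lambda>x. H f x - H g x) (\<lambda>x. H f x - H g x)"
proof -
  interpret graph: semi_inner DH "\<lambda>f g. ip (H f) (H g) + 0 * ip f g" by (rule semi_inner_graph) simp
  show ?thesis using graph.quad_diff[OF f g] L2.quad_diff[OF H_L2 H_L2, OF f g] by simp
qed

text \<open>\<open>k = (1 + H\<^sup>2 / c)\<^sup>-\<^sup>1 f\<close>\<close>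
lemma resolvent:
  assumes f: "f \<in> L2 m" and c: "0 < c"
  obtains k where "k \<in> DH" "H k \<in> DH"
    "\<And>g. g \<in> L2 m \<Longrightarrow> ip (H (H k)) g = c * (ip f g - ip k g)"
proof -
  interpret graph: semi_inner DH "\<lambda>f g. ip (H f) (H g) + c * ip f g"
    by (rule semi_inner_graph) (use c in simp)
  \<comment> \<open>Riesz for g \<mapsto> c \<langle>f, g\<rangle>: the representer k would satisfy
    \<langle>H k, H g\<rangle> + c \<langle>k, g\<rangle> = c \<langle>f, g\<rangle>, the weak form
    of H^2 k = c (f - k). At this point only a sequence approximating it is available.\<close>
  obtain X where X: "\<And>n. X n \<in> DH"
    and XC: "\<And>e. 0 < e \<Longrightarrow> \<exists>N. \<forall>i\<ge>N. \<forall>n\<ge>N. ip (H (\<lambda>x. X i x - X n x)) (H (\<lambda>x. X i x - X n x))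
        + c * ip (\<lambda>x. X i x - X n x) (\<lambda>x. X i x - X n x) < e"
    and Xl: "\<And>g. g \<in> DH \<Longrightarrow> (\<lambda>n. ip (H (X n)) (H g) + c * ip (X n) g) \<longlonglongrightarrow> c * ip f g"
  proof (rule graph.riesz_sequence)
    show "c * ip f (\<lambda>x. a * u x + b * v x) = a * (c * ip f u) + b * (c * ip f v)"
      if "u \<in> DH" "v \<in> DH" for u v a b
      using that f by (simp add: L2.lin_right DH_L2 algebra_simps)
    show "(c * ip f u)\<^sup>2 \<le> (c * ip f f) * (ip (H u) (H u) + c * ip u u)" if u: "u \<in> DH" for u
    proof -
      have "(c * ip f u)\<^sup>2 \<le> c\<^sup>2 * (ip f f * ip u u)"
        using L2.cauchy_schwarz[OF f DH_L2[OF u]] by (simp add: power_mult_distrib mult_left_mono)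
      also have "\<dots> = (c * ip f f) * (c * ip u u)" by (simp add: power2_eq_square)
      also have "\<dots> \<le> (c * ip f f) * (ip (H u) (H u) + c * ip u u)"
        using c L2.nonneg f H_L2[OF u] by (intro mult_left_mono) auto
      finally show ?thesis .
    qed
  qed blast
  have XL: "X n \<in> L2 m" and HXL: "H (X n) \<in> L2 m" for n using X DH_L2 H_L2 by auto
  obtain k where k: "k \<in> L2 m" "(\<lambda>n. ip (\<lambda>x. X n x - k x) (\<lambda>x. X n x - k x)) \<longlonglongrightarrow> 0"
  proof (rule L2_complete[of X])
    show "\<exists>N. \<forall>i\<ge>N. \<forall>n\<ge>N. ip (\<lambda>x. X i x - X n x) (\<lambda>x. X i x - X n x) < e" if "0 < e" for e
    proof -
      obtain N where N: "\<forall>i\<ge>N. \<forall>n\<ge>N. ip (H (\<lambda>x. X i x - X n x)) (H (\<lambda>x. X i x - X n x))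
        + c * ip (\<lambda>x. X i x - X n x) (\<lambda>x. X i x - X n x) < c * e"
        using XC[of "c * e"] c \<open>0 < e\<close> by auto
      have "ip (\<lambda>x. X i x - X n x) (\<lambda>x. X i x - X n x) < e" if "i \<ge> N" "n \<ge> N" for i n
      proof -
        have "0 \<le> ip (H (\<lambda>x. X i x - X n x)) (H (\<lambda>x. X i x - X n x))"
          by (intro L2.nonneg H_L2 graph.diff_closed X)
        then have "c * ip (\<lambda>x. X i x - X n x) (\<lambda>x. X i x - X n x)
            \<le> ip (H (\<lambda>x. X i x - X n x)) (H (\<lambda>x. X i x - X n x))
              + c * ip (\<lambda>x. X i x - X n x) (\<lambda>x. X i x - X n x)" by simp
        also have "\<dots> < c * e" using N that by blast
        finally show ?thesis using c by simp
      qed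
      then show ?thesis by blast
    qed
  qed (use XL in blast)+
  obtain h where h: "h \<in> L2 m" "(\<lambda>n. ip (\<lambda>x. H (X n) x - h x) (\<lambda>x. H (X n) x - h x)) \<longlonglongrightarrow> 0"
  proof (rule L2_complete[of "\<lambda>n. H (X n)"])
    show "\<exists>N. \<forall>i\<ge>N. \<forall>n\<ge>N. ip (\<lambda>x. H (X i) x - H (X n) x) (\<lambda>x. H (X i) x - H (X n) x) < e"
      if "0 < e" for e
    proof -
      obtain N where N: "\<forall>i\<ge>N. \<forall>n\<ge>N. ip (H (\<lambda>x. X i x - X n x)) (H (\<lambda>x. X i x - X n x))
        + c * ip (\<lambda>x. X i x - X n x) (\<lambda>x. X i x - X n x) < e"
        using XC[of e] \<open>0 < e\<close> by auto
      have "ip (\<lambda>x. H (X i) x - H (X n) x) (\<lambda>x. H (X i) x - H (X n) x) < e" if "i \<ge> N" "n \<ge> N" for i n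
      proof -
        have "0 \<le> c * ip (\<lambda>x. X i x - X n x) (\<lambda>x. X i x - X n x)"
          using c by (intro mult_nonneg_nonneg L2.nonneg L2_diff_closed XL) auto
        then have "ip (\<lambda>x. H (X i) x - H (X n) x) (\<lambda>x. H (X i) x - H (X n) x)
            \<le> ip (H (\<lambda>x. X i x - X n x)) (H (\<lambda>x. X i x - X n x))
              + c * ip (\<lambda>x. X i x - X n x) (\<lambda>x. X i x - X n x)"
          by (simp add: ip_H_diff[OF X X])
        also have "\<dots> < e" using N that by blast
        finally show ?thesis .
      qed
      then show ?thesis by blast
    qed
  qed (use HXL in blast)+
  \<comment> \<open>Closedness of \<open>H\<close>: with \<open>X n\<close> tending to
    \<open>k\<close> and \<open>H (X n)\<close> to \<open>h\<close>, symmetry survives the limit and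
    places \<open>k\<close> in the domain of the adjoint.\<close>
  have ip_h: "ip h g = ip k (H g)" if g: "g \<in> DH" for g
  proof (rule LIMSEQ_unique)
    show "(\<lambda>n. ip (H (X n)) g) \<longlonglongrightarrow> ip h g" using h HXL g DH_L2 by (auto intro!: L2.tendsto_left)
    have "(\<lambda>n. ip (X n) (H g)) \<longlonglongrightarrow> ip k (H g)" using k XL g H_L2 by (auto intro!: L2.tendsto_left)
    then show "(\<lambda>n. ip (H (X n)) g) \<longlonglongrightarrow> ip k (H g)" using ip_H_sym[OF X g] by simp
  qed
  have kD: "k \<in> DH"
  proof (rule DH_I[OF k(1) h(1)])
    show "ip (H g) k = ip g h" if "g \<in> DH" for g
      using ip_h[OF that] k h DH_L2[OF that] H_L2[OF that] by (simp add: L2.sym)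
  qed
  have Hk_h: "ip (H k) g = ip h g" if g: "g \<in> L2 m" for g
    by (rule DH_ip_eqI[OF H_L2[OF kD] h(1) g]) (simp add: ip_h ip_H_sym[OF kD])
  have eq: "ip (H k) (H g) + c * ip k g = c * ip f g" if g: "g \<in> DH" for g
  proof (rule LIMSEQ_unique[OF _ Xl[OF g]])
    have "(\<lambda>n. ip (H (X n)) (H g)) \<longlonglongrightarrow> ip h (H g)" using h HXL g H_L2 by (auto intro!: L2.tendsto_left)
    moreover have "(\<lambda>n. ip (X n) g) \<longlonglongrightarrow> ip k g" using k XL g DH_L2 by (auto intro!: L2.tendsto_left)
    ultimately show "(\<lambda>n. ip (H (X n)) (H g) + c * ip (X n) g) \<longlonglongrightarrow> ip (H k) (H g) + c * ip k g"
      using Hk_h[OF H_L2[OF g]] by (auto intro!: tendsto_intros)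
  qed
  \<comment> \<open>The weak equation exhibits c (f - k) as the adjoint applied to
    \<open>H k\<close>.\<close>
  have HkD: "H k \<in> DH"
  proof (rule DH_I)
    show "(\<lambda>x. c * f x + (- c) * k x) \<in> L2 m" using f k by (intro L2_lin_closed)
    show "ip (H g) (H k) = ip g (\<lambda>x. c * f x + (- c) * k x)" if "g \<in> DH" for g
      unfolding L2.lin_right[OF f k(1) DH_L2[OF that]]
      using eq[OF that] L2.sym[OF DH_L2[OF that] f] L2.sym[OF DH_L2[OF that] k(1)]
        L2.sym[OF H_L2[OF that] H_L2[OF kD]] by simp
  qed (use kD H_L2 in blast)
  have HHk: "ip (H (H k)) g = c * (ip f g - ip k g)" if g: "g \<in> L2 m" for g
  proof -
    have "ip (H (H k)) g = ip (\<lambda>x. c * f x + (- c) * k x) g"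
    proof (rule DH_ip_eqI[OF H_L2[OF HkD] L2_lin_closed[OF f k(1)] g])
      fix u assume u: "u \<in> DH"
      show "ip (H (H k)) u = ip (\<lambda>x. c * f x + (- c) * k x) u"
        unfolding L2.lin_left[OF f k(1) DH_L2[OF u]] using eq[OF u] ip_H_sym[OF HkD u] by simp
    qed
    then show ?thesis unfolding L2.lin_left[OF f k(1) g] by (simp add: algebra_simps)
  qed
  show thesis by (rule that[OF kD HkD HHk])
qed

section \<open>Approximating forms for small times and the domain of H\<close>

lemma form_derivative:
  assumes k: "k \<in> DH" "H k \<in> DH" and g: "g \<in> L2 m"
  shows "((\<lambda>t. (ip k g - ip (T t k) g) / t) \<longlongrightarrow> ip (H (H k)) g) (at_right 0)"
proof -
  note kL = DH_L2[OF k(1)] and HHk = H_L2[OF k(2)]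
  let ?w = "\<lambda>x. - H (H k) x"
  \<comment> \<open>\<open>L2.tendsto_left\<close> wants every member of the family in L2, but
    nothing is known about \<open>T t\<close> for negative t; the default 0 does not affect the
    limit at 0 from the right.\<close>
  let ?q = "\<lambda>t x. if 0 < t then (T t k x - k x) / t else 0"
  have wL: "?w \<in> L2 m" using L2_lin_closed[OF HHk HHk, of "-1" 0] by simp
  have z: "(\<lambda>x. 0) \<in> L2 m" by (simp add: L2_def)
  have qL: "?q t \<in> L2 m" for t
    using L2_lin_closed[OF T_L2[OF _ kL, of t] kL, of "1 / t" "- 1 / t"] z
    by (cases "0 < t") (simp_all add: diff_divide_distrib)
  have "((\<lambda>t. L2norm m (\<lambda>x. (T t k x - k x) / t - ?w x)) \<longlongrightarrow> 0) (at_right 0)"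
    using H_generator[OF k] unfolding generator_limit_def by blast
  then have lim: "((\<lambda>t. L2norm m (\<lambda>x. ?q t x - ?w x)) \<longlongrightarrow> 0) (at_right 0)"
    by (rule Lim_transform_eventually) (auto simp: eventually_at_right_less intro: eventually_mono[OF eventually_at_right_less])
  have d: "(\<lambda>x. ?q t x - ?w x) \<in> L2 m" for t
    by (intro L2_diff_closed qL wL)
  have "((\<lambda>t. ip (?q t) g) \<longlongrightarrow> ip ?w g) (at_right 0)"
  proof (rule L2.tendsto_left[OF qL wL g])
    show "((\<lambda>t. ip (\<lambda>x. ?q t x - ?w x) (\<lambda>x. ?q t x - ?w x)) \<longlongrightarrow> 0) (at_right 0)"
      using tendsto_power[OF lim, of 2] by (simp only: L2norm_power2[OF d] zero_power2)
  qed
  then have "((\<lambda>t. - ip (?q t) g) \<longlongrightarrow> - ip ?w g) (at_right 0)" by (rule tendsto_minus)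
  moreover have "- ip ?w g = ip (H (H k)) g"
    using L2.lin_left[OF HHk HHk g, of "-1" 0] by simp
  ultimately have lim': "((\<lambda>t. - ip (?q t) g) \<longlongrightarrow> ip (H (H k)) g) (at_right 0)" by (simp only:)
  have ev: "\<forall>\<^sub>F t in at_right 0. - ip (?q t) g = (ip k g - ip (T t k) g) / t"
    using eventually_at_right_less[of 0]
  proof eventually_elim
    case (elim t)
    have "ip (?q t) g = ip (\<lambda>x. (1 / t) * T t k x + (- 1 / t) * k x) g"
      using elim by (simp add: diff_divide_distrib)
    also have "\<dots> = (1 / t) * ip (T t k) g + (- 1 / t) * ip k g"
      using elim kL g by (intro L2.lin_left T_L2) auto
    finally show ?case by (simp add: diff_divide_distrib)
  qed
  show ?thesis by (rule Lim_transform_eventually[OF lim' ev])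
qed

text \<open>By \<open>form_double\<close> the quotient E_t k can only grow when t is halved, and
  along t / 2^n it tends to \<langle>H^2 k, k\<rangle>, the squared norm of
  \<open>H k\<close>.\<close>

lemma form_le_generator:
  assumes k: "k \<in> DH" "H k \<in> DH" and t: "0 < t"
  shows "ip k k - ip (T t k) k \<le> t * ip (H k) (H k)"
proof -
  have kL: "k \<in> L2 m" using k DH_L2 by blast
  have le: "(ip k k - ip (T t k) k) / t \<le> (ip k k - ip (T (t / 2 ^ n) k) k) / (t / 2 ^ n)" for n
  proof (induction n)
    case (Suc n)
    have "(ip k k - ip (T (t / 2 ^ n) k) k) \<le> 2 * (ip k k - ip (T (t / 2 ^ n / 2) k) k)"
      using t by (intro form_double kL) auto
    then have "(ip k k - ip (T (t / 2 ^ n) k) k) / (t / 2 ^ n)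
        \<le> 2 * (ip k k - ip (T (t / 2 ^ n / 2) k) k) / (t / 2 ^ n)"
      using t by (intro divide_right_mono) auto
    then show ?case using Suc by (simp add: field_simps)
  qed simp
  have "(\<lambda>n. t / 2 ^ n) \<longlonglongrightarrow> 0"
    using LIMSEQ_divide_realpow_zero[of 2 t] by simp
  then have "filterlim (\<lambda>n. t / 2 ^ n) (at_right 0) sequentially"
    using t by (auto simp: filterlim_at intro: always_eventually)
  from filterlim_compose[OF form_derivative[OF k kL] this]
  have "(\<lambda>n. (ip k k - ip (T (t / 2 ^ n) k) k) / (t / 2 ^ n)) \<longlonglongrightarrow> ip (H (H k)) k" .
  then have "(ip k k - ip (T t k) k) / t \<le> ip (H (H k)) k"
    using le by (intro LIMSEQ_le_const) auto
  then show ?thesis using t k by (simp add: ip_H_sym field_simps)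
qed

text \<open>Since H^2 k = c (f - k) weakly, \<langle>H^2 k, f\<rangle> splits as ||H k||^2 + c ||k -
  f||^2, and the hypothesis becomes that of \<open>le_of_square_sum_le\<close>.\<close>

lemma resolvent_bounds:
  assumes f: "f \<in> L2 m" and C: "0 \<le> C"
    and k: "k \<in> DH" "H k \<in> DH" "\<And>g. g \<in> L2 m \<Longrightarrow> ip (H (H k)) g = c * (ip f g - ip k g)" and c: "0 < c"
    and bound: "(ip (H (H k)) f)\<^sup>2 \<le> C * ip (H k) (H k)"
  shows "ip (H k) (H k) \<le> C" "ip (\<lambda>x. k x - f x) (\<lambda>x. k x - f x) \<le> C / c"
proof -
  have kL: "k \<in> L2 m" using k DH_L2 by blast
  let ?d = "ip (\<lambda>x. k x - f x) (\<lambda>x. k x - f x)"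
  have "ip (H (H k)) f = ip (H k) (H k) + c * ?d"
    using k(3)[OF f] k(3)[OF kL] ip_H_sym[OF k(2,1)] f kL
    by (simp add: L2.quad_diff L2.sym[of f m k] algebra_simps)
  then have le: "(ip (H k) (H k) + c * ?d)\<^sup>2 \<le> C * ip (H k) (H k)" using bound by simp
  have "0 \<le> ip (H k) (H k)" "0 \<le> c * ?d"
    using c by (auto intro!: mult_nonneg_nonneg L2.nonneg L2_diff_closed kL f H_L2 k(1))
  from le_of_square_sum_le[OF this C le] c
  show "ip (H k) (H k) \<le> C" "?d \<le> C / c" by (simp_all add: field_simps)
qed

text \<open>The hypothesis says that \<langle>H^2 k, f\<rangle> is bounded by a multiple of ||H k||.
  It can be checked both when \<open>f\<close> is in \<open>DH\<close> and when only the forms of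
  \<open>f\<close> are bounded, so one approximation serves both directions. The resolvent parameter
  is n + 1, whence the squared distance to \<open>f\<close> is at most C / (n + 1).\<close>

lemma resolvent_seq:
  assumes f: "f \<in> L2 m" and C: "0 \<le> C"
    and bound: "\<And>k. k \<in> DH \<Longrightarrow> H k \<in> DH \<Longrightarrow> (ip (H (H k)) f)\<^sup>2 \<le> C * ip (H k) (H k)"
  obtains K where "\<And>n. K n \<in> DH" "\<And>n. H (K n) \<in> DH" "\<And>n. ip (H (K n)) (H (K n)) \<le> C"
    "(\<lambda>n. ip (\<lambda>x. K n x - f x) (\<lambda>x. K n x - f x)) \<longlonglongrightarrow> 0"
proof -
  have "\<exists>k. k \<in> DH \<and> H k \<in> DH \<and> ip (H k) (H k) \<le> C \<and>
      ip (\<lambda>x. k x - f x) (\<lambda>x. k x - f x) \<le> C / real (Suc n)" for n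
  proof -
    obtain k where "k \<in> DH" "H k \<in> DH"
        "\<And>g. g \<in> L2 m \<Longrightarrow> ip (H (H k)) g = real (Suc n) * (ip f g - ip k g)"
      using resolvent[OF f, of "real (Suc n)"] by auto
    then show ?thesis using resolvent_bounds[OF f C, of k "real (Suc n)"] bound by auto
  qed
  then obtain K where K: "\<And>n. K n \<in> DH" "\<And>n. H (K n) \<in> DH" "\<And>n. ip (H (K n)) (H (K n)) \<le> C"
    "\<And>n. ip (\<lambda>x. K n x - f x) (\<lambda>x. K n x - f x) \<le> C / real (Suc n)" by metis
  have "(\<lambda>n. ip (\<lambda>x. K n x - f x) (\<lambda>x. K n x - f x)) \<longlonglongrightarrow> 0"
  proof (rule tendsto_sandwich[where f = "\<lambda>_. 0" and h = "\<lambda>n. C / real (Suc n)"])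
    show "(\<lambda>n. C / real (Suc n)) \<longlonglongrightarrow> 0"
      using tendsto_mult_right[OF LIMSEQ_Suc[OF lim_1_over_n], of C] by simp
    show "\<forall>\<^sub>F n in sequentially. 0 \<le> ip (\<lambda>x. K n x - f x) (\<lambda>x. K n x - f x)"
      by (intro always_eventually allI L2.nonneg L2_diff_closed f DH_L2 K)
    show "\<forall>\<^sub>F n in sequentially. ip (\<lambda>x. K n x - f x) (\<lambda>x. K n x - f x) \<le> C / real (Suc n)"
      by (intro always_eventually allI K(4))
  qed simp
  with K(1-3) show thesis by (rule that)
qed

text \<open>The resolvent approximants of \<open>f\<close> lie in the domain of H^2, where
  \<open>form_le_generator\<close> applies, and their energies do not exceed that of
  \<open>f\<close>.\<close>

lemma form_le:
  assumes f: "f \<in> DH" and t: "0 < t"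
  shows "ip f f - ip (T t f) f \<le> t * ip (H f) (H f)"
proof -
  interpret form: semi_inner "L2 m" "\<lambda>f g. ip f g - ip (T t f) g"
    by (rule semi_inner_form) (use t in simp)
  have fL: "f \<in> L2 m" using f DH_L2 by blast
  obtain K where K: "\<And>n. K n \<in> DH" "\<And>n. H (K n) \<in> DH" "\<And>n. ip (H (K n)) (H (K n)) \<le> ip (H f) (H f)"
    "(\<lambda>n. ip (\<lambda>x. K n x - f x) (\<lambda>x. K n x - f x)) \<longlonglongrightarrow> 0"
  proof (rule resolvent_seq[OF fL])
    show "0 \<le> ip (H f) (H f)" using f by (intro L2.nonneg H_L2)
    show "(ip (H (H k)) f)\<^sup>2 \<le> ip (H f) (H f) * ip (H k) (H k)" if "k \<in> DH" "H k \<in> DH" for k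
      using L2.cauchy_schwarz[of "H k" m "H f"] that f by (simp add: ip_H_sym H_L2 mult.commute)
  qed blast
  have KL: "K n \<in> L2 m" for n using K DH_L2 by blast
  \<comment> \<open>L2 convergence suffices, since \<langle>T_t d, d\<rangle> \<ge> 0 bounds the
    form of d by \<langle>d, d\<rangle>.\<close>
  have "(\<lambda>n. ip (K n) (K n) - ip (T t (K n)) (K n)) \<longlonglongrightarrow> ip f f - ip (T t f) f"
  proof (rule form.tendsto_quad[OF KL fL], rule tendsto_sandwich[OF _ _ tendsto_const K(4)])
    let ?d = "\<lambda>n x. K n x - f x"
    have d: "?d n \<in> L2 m" for n by (intro L2_diff_closed KL fL)
    have "0 \<le> ip (T t (?d n)) (?d n)" for n
      using ip_T_half[OF less_imp_le[OF t] d, of n] L2.nonneg[OF T_L2[OF _ d], of "t / 2" n] t by simp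
    then show "\<forall>\<^sub>F n in sequentially. ip (?d n) (?d n) - ip (T t (?d n)) (?d n) \<le> ip (?d n) (?d n)"
      by simp
    show "\<forall>\<^sub>F n in sequentially. 0 \<le> ip (?d n) (?d n) - ip (T t (?d n)) (?d n)"
      using form.nonneg[OF d] by simp
  qed
  moreover have "ip (K n) (K n) - ip (T t (K n)) (K n) \<le> t * ip (H f) (H f)" for n
    using form_le_generator[OF K(1,2) t, of n] mult_left_mono[OF K(3)[of n] less_imp_le[OF t]] by simp
  ultimately show ?thesis by (intro LIMSEQ_le_const2) auto
qed

text \<open>Cauchy-Schwarz for the form at time t bounds E_t(k, f)^2 by C ||H k||^2, and E_t(k, f)
  tends to \<langle>H^2 k, f\<rangle>; this is the hypothesis of \<open>resolvent_seq\<close>. The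
  approximants then show that g \<mapsto> \<langle>H g, f\<rangle> is L2 bounded on
  \<open>DH\<close>, which characterises the domain of the adjoint.\<close>

lemma DH_of_form_le:
  assumes f: "f \<in> L2 m" and C: "0 \<le> C"
    and bound: "\<And>t. 0 < t \<Longrightarrow> ip f f - ip (T t f) f \<le> t * C"
  shows "f \<in> DH" "ip (H f) (H f) \<le> C"
proof -
  obtain K where K: "\<And>n. K n \<in> DH" "\<And>n. H (K n) \<in> DH" "\<And>n. ip (H (K n)) (H (K n)) \<le> C"
    "(\<lambda>n. ip (\<lambda>x. K n x - f x) (\<lambda>x. K n x - f x)) \<longlonglongrightarrow> 0"
  proof (rule resolvent_seq[OF f C])
    fix k assume k: "k \<in> DH" "H k \<in> DH"
    have kL: "k \<in> L2 m" using k DH_L2 by blast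
    have "((\<lambda>t. ((ip k f - ip (T t k) f) / t)\<^sup>2) \<longlongrightarrow> (ip (H (H k)) f)\<^sup>2) (at_right 0)"
      by (intro tendsto_intros form_derivative k f)
    moreover have "\<forall>\<^sub>F t in at_right 0. ((ip k f - ip (T t k) f) / t)\<^sup>2 \<le> C * ip (H k) (H k)"
      using eventually_at_right_less[of 0]
    proof eventually_elim
      case (elim t)
      interpret form: semi_inner "L2 m" "\<lambda>f g. ip f g - ip (T t f) g"
        by (rule semi_inner_form) (use elim in simp)
      have "(ip k f - ip (T t k) f)\<^sup>2 \<le> (t * ip (H k) (H k)) * (t * C)"
        using form.cauchy_schwarz[OF kL f] mult_mono[OF form_le_generator[OF k elim] bound[OF elim]]
          form.nonneg[OF f] L2.nonneg[OF H_L2[OF k(1)]] elim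
        by (smt (verit) mult_nonneg_nonneg)
      then show ?case using elim by (simp add: power_divide field_simps power2_eq_square)
    qed
    ultimately show "(ip (H (H k)) f)\<^sup>2 \<le> C * ip (H k) (H k)"
      by (intro tendsto_upperbound) auto
  qed blast
  have KL: "K n \<in> L2 m" for n using K DH_L2 by blast
  \<comment> \<open>\<open>H\<close> is moved onto the approximants, whose energies are at most
    \<open>C\<close>.\<close>
  have bnd: "(ip (H g) f)\<^sup>2 \<le> C * ip g g" if g: "g \<in> DH" for g
  proof -
    have "(\<lambda>n. ip (K n) (H g)) \<longlonglongrightarrow> ip f (H g)"
      using K KL f g H_L2 by (auto intro!: L2.tendsto_left)
    then have "(\<lambda>n. (ip (K n) (H g))\<^sup>2) \<longlonglongrightarrow> (ip f (H g))\<^sup>2" by (intro tendsto_intros)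
    moreover have "(ip (K n) (H g))\<^sup>2 \<le> C * ip g g" for n
      using L2.cauchy_schwarz[of "H (K n)" m g] mult_right_mono[OF K(3)[of n], of "ip g g"] K(1)[of n] g
      by (simp add: ip_H_sym[symmetric] H_L2 DH_L2 L2.nonneg)
    ultimately have "(ip f (H g))\<^sup>2 \<le> C * ip g g" by (intro LIMSEQ_le_const2) auto
    then show ?thesis using f g by (simp add: L2.sym H_L2)
  qed
  interpret dom: semi_inner DH ip
    by standard (use DH_nonempty DH_lin_closed DH_L2 in \<open>auto intro: L2.lin_left L2.sym L2.nonneg\<close>)
  \<comment> \<open>Riesz is applied inside \<open>DH\<close> with the L2 inner product;
    \<open>DH\<close> is not complete for it, so the representer \<open>h\<close> is found only as
    an L2 limit.\<close>
  obtain X where X: "\<And>n. X n \<in> DH"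
    and XC: "\<And>e. 0 < e \<Longrightarrow> \<exists>N. \<forall>i\<ge>N. \<forall>n\<ge>N. ip (\<lambda>x. X i x - X n x) (\<lambda>x. X i x - X n x) < e"
    and Xl: "\<And>g. g \<in> DH \<Longrightarrow> (\<lambda>n. ip (X n) g) \<longlonglongrightarrow> ip (H g) f"
  proof (rule dom.riesz_sequence[of "\<lambda>g. ip (H g) f"])
    show "(ip (H g) f)\<^sup>2 \<le> C * ip g g" if "g \<in> DH" for g by (rule bnd[OF that])
  qed (use f in \<open>auto intro: ip_H_lin\<close>)
  have XL: "X n \<in> L2 m" for n using X DH_L2 by blast
  obtain h where h: "h \<in> L2 m" "(\<lambda>n. ip (\<lambda>x. X n x - h x) (\<lambda>x. X n x - h x)) \<longlonglongrightarrow> 0"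
    using L2_complete[OF XL XC] by blast
  have ip_h: "ip h g = ip (H g) f" if g: "g \<in> DH" for g
    by (rule LIMSEQ_unique[OF _ Xl[OF g]]) (use h XL g DH_L2 in \<open>auto intro: L2.tendsto_left\<close>)
  show fD: "f \<in> DH"
  proof (rule DH_I[OF f h(1)])
    show "ip (H g) f = ip g h" if "g \<in> DH" for g
      using ip_h[OF that] L2.sym[OF h(1) DH_L2[OF that]] by simp
  qed
  have Hf: "ip (H f) g = ip h g" if "g \<in> L2 m" for g
  proof (rule DH_ip_eqI[OF H_L2[OF fD] h(1) that])
    fix u assume u: "u \<in> DH"
    show "ip (H f) u = ip h u"
      using ip_h[OF u] ip_H_sym[OF fD u] L2.sym[OF f H_L2[OF u]] by simp
  qed
  have hh: "ip (H f) (H f) = ip h h"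
    using Hf[OF H_L2[OF fD]] Hf[OF h(1)] L2.sym[OF h(1) H_L2[OF fD]] by simp
  \<comment> \<open>The bound \<open>bnd\<close> holds on \<open>DH\<close>; it reaches
    \<open>h\<close> itself through \<open>X n\<close>, and then one factor ||h||^2 cancels.\<close>
  have "(\<lambda>n. (ip (X n) h)\<^sup>2) \<longlonglongrightarrow> (ip h h)\<^sup>2" using h XL by (auto intro!: tendsto_power L2.tendsto_left)
  moreover have "(\<lambda>n. C * ip (X n) (X n)) \<longlonglongrightarrow> C * ip h h" using h XL by (auto intro!: tendsto_mult_left L2.tendsto_quad)
  moreover have "(ip (X n) h)\<^sup>2 \<le> C * ip (X n) (X n)" for n
    using bnd[OF X] ip_h[OF X] L2.sym[OF XL h(1)] by simp
  ultimately have "(ip h h)\<^sup>2 \<le> C * ip h h" by (intro LIMSEQ_le) auto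
  then show "ip (H f) (H f) \<le> C"
    using le_of_square_sum_le(1)[of "ip h h" 0 C] C L2.nonneg[OF h(1)] hh by simp
qed

end

subsection \<open>Reversible Markov kernels\<close>

lemma (in prob_space) square_expectation_le:
  fixes X :: "'a \<Rightarrow> real"
  assumes "integrable M X" "integrable M (\<lambda>x. (X x)\<^sup>2)"
  shows "(expectation X)\<^sup>2 \<le> expectation (\<lambda>x. (X x)\<^sup>2)"
  using variance_eq[OF assms] variance_positive[of X] by simp

text \<open>A non-integrable \<open>X\<close> has expectation 0 by convention, and 0 \<le> c, so
  integrability need not be tracked.\<close>

lemma (in prob_space) abs_expectation_le:
  fixes X :: "'a \<Rightarrow> real"
  assumes "\<And>x. \<bar>X x\<bar> \<le> c"
  shows "\<bar>expectation X\<bar> \<le> c"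
proof (cases "integrable M X")
  case True
  moreover have "X x \<le> c" "- c \<le> X x" for x using assms[of x] by (simp_all add: abs_le_iff)
  ultimately have "expectation X \<le> c" "- c \<le> expectation X"
    by (auto intro!: integral_le_const integral_ge_const)
  then show ?thesis by simp
next
  case False
  then show ?thesis using assms[of undefined] by (simp add: not_integrable_integral_eq)
qed

text \<open>The kernel represents \<open>T\<close> only on bounded functions; truncation is how its
  consequences reach all of L2.\<close>

definition truncate :: "nat \<Rightarrow> ('a \<Rightarrow> real) \<Rightarrow> 'a \<Rightarrow> real" where
  "truncate n f x = max (- real n) (min (f x) (real n))"

lemma truncate_abs_le: "\<bar>truncate n f x\<bar> \<le> \<bar>f x\<bar>"
  and truncate_bound: "\<bar>truncate n f x\<bar> \<le> real n"
  by (auto simp: truncate_def)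

lemma truncate_L2:
  assumes "f \<in> L2 M"
  shows "truncate n f \<in> L2 M"
proof -
  have [measurable]: "f \<in> borel_measurable M" using assms by (rule L2_measurable)
  have m: "truncate n f \<in> borel_measurable M" unfolding truncate_def by measurable
  have "integrable M (\<lambda>x. (truncate n f x)\<^sup>2)"
    using m by (intro Bochner_Integration.integrable_bound[OF L2_square_integrable[OF assms]])
      (auto simp: truncate_abs_le power2_le_iff_abs_le intro!: abs_le_square_iff[THEN iffD1])
  then show ?thesis using m by (simp add: L2_def)
qed

lemma truncate_tendsto: "(\<lambda>n. truncate n f x) \<longlonglongrightarrow> f x"
proof (rule tendsto_eventually)
  show "\<forall>\<^sub>F n in sequentially. truncate n f x = f x"
    using eventually_ge_at_top[of "nat \<lceil>\<bar>f x\<bar>\<rceil>"]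
  proof eventually_elim
    case (elim n)
    then have "\<bar>f x\<bar> \<le> real n" by linarith
    then show ?case by (simp add: truncate_def)
  qed
qed

lemma truncate_tendsto_L2:
  assumes "f \<in> L2 M"
  shows "(\<lambda>n. L2inner M (\<lambda>x. truncate n f x - f x) (\<lambda>x. truncate n f x - f x)) \<longlonglongrightarrow> 0"
proof -
  have [measurable]: "f \<in> borel_measurable M" "truncate n f \<in> borel_measurable M" for n
    using assms truncate_L2[OF assms] by (auto intro: L2_measurable)
  have "(\<lambda>n. \<integral>x. (truncate n f x - f x)\<^sup>2 \<partial>M) \<longlonglongrightarrow> (\<integral>x. 0 \<partial>M)"
  proof (rule integral_dominated_convergence[where w = "\<lambda>x. (f x)\<^sup>2"])
    show "AE x in M. (\<lambda>n. (truncate n f x - f x)\<^sup>2) \<longlonglongrightarrow> 0"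
      by (auto intro!: AE_I2 tendsto_eq_intros truncate_tendsto)
    show "AE x in M. norm ((truncate n f x - f x)\<^sup>2) \<le> (f x)\<^sup>2" for n
      by (auto intro!: AE_I2 abs_le_square_iff[THEN iffD1] simp: truncate_def)
  qed (use assms in \<open>auto simp: L2_def\<close>)
  then show ?thesis by (simp add: L2inner_def power2_eq_square)
qed

lemma bounded_L2_if_integrable:
  fixes w :: "'a \<Rightarrow> real"
  assumes [measurable]: "w \<in> borel_measurable M" and nn: "\<And>x. 0 \<le> w x" and b: "\<And>x. w x \<le> c"
    and fin: "(\<integral>\<^sup>+x. ennreal (w x) \<partial>M) < \<infinity>"
  shows "w \<in> L2 M"
proof -
  have "integrable M w" using nn fin by (intro integrableI_nonneg) auto
  then have "integrable M (\<lambda>x. c * w x)" by simp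
  then have "integrable M (\<lambda>x. (w x)\<^sup>2)"
  proof (rule Bochner_Integration.integrable_bound)
    show "AE x in M. norm ((w x)\<^sup>2) \<le> norm (c * w x)"
      using nn b by (auto simp: power2_eq_square intro!: AE_I2 mult_right_mono) (smt (verit) mult_right_mono)
  qed simp
  then show ?thesis by (simp add: L2_def)
qed

locale reversible_kernel = sigma_finite_measure m for m :: "'a::t2_space measure" +
  fixes p :: "real \<Rightarrow> 'a \<Rightarrow> 'a measure"
    and T :: "real \<Rightarrow> ('a \<Rightarrow> real) \<Rightarrow> ('a \<Rightarrow> real)"
  assumes m_sets: "sets m = sets borel"
    and trans: "transition_function p"
    and semigroup: "strongly_continuous_semigroup m T"
    and represents: "represents m p T"
    and symmetric: "symmetric_semigroup m T"
begin

section \<open>Calculus of the transition kernel\<close>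

lemma m_measurable [simp]: "borel_measurable m = borel_measurable borel"
  and space_m [simp]: "space m = UNIV"
  using m_sets sets_eq_imp_space_eq[OF m_sets]
  by (auto intro!: measurable_cong_sets sets_pair_measure_cong)

lemma p_prob: "0 \<le> t \<Longrightarrow> prob_space (p t x)"
  and p_sets: "0 \<le> t \<Longrightarrow> sets (p t x) = sets borel"
  using trans unfolding transition_function_def by blast+

lemma p_space: "0 \<le> t \<Longrightarrow> space (p t x) = UNIV"
  using sets_eq_imp_space_eq[OF p_sets] by simp

lemma p_measurable [simp]: "0 \<le> t \<Longrightarrow> borel_measurable (p t x) = borel_measurable borel"
  by (intro measurable_cong_sets p_sets) auto

lemma p_0: "p 0 x = return borel x"
proof (rule measure_eqI)
  fix A assume "A \<in> sets (p 0 x)"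
  then have A: "A \<in> sets borel" by (simp add: p_sets)
  interpret prob_space "p 0 x" by (rule p_prob) simp
  have "measure (p 0 x) A = indicator A x"
    using trans A unfolding transition_function_def by blast
  then show "emeasure (p 0 x) A = emeasure (return borel x) A"
    using A by (simp add: emeasure_eq_measure split: split_indicator)
qed (simp add: p_sets)

text \<open>Nothing is known about \<open>p t\<close> for \<open>t < 0\<close>, hence the \<open>max 0\<close>.\<close>
lemma joint_kernel [measurable]:
  "(\<lambda>z. p (max 0 (fst z)) (snd z)) \<in> borel \<Otimes>\<^sub>M borel \<rightarrow>\<^sub>M prob_algebra borel"
proof (intro measurable_prob_algebraI measurable_subprob_algebra)
  fix A :: "'a set" assume A: "A \<in> sets borel"
  have "(\<lambda>z. (max 0 (fst z), snd z)) \<in>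
      (borel :: real measure) \<Otimes>\<^sub>M (borel :: 'a measure) \<rightarrow>\<^sub>M restrict_space borel {0..} \<Otimes>\<^sub>M borel"
    by (intro measurable_Pair measurable_restrict_space2) auto
  moreover have "(\<lambda>(t, x). measure (p t x) A)
      \<in> borel_measurable (restrict_space (borel :: real measure) {0..} \<Otimes>\<^sub>M (borel :: 'a measure))"
    using trans A unfolding transition_function_def by blast
  ultimately have "(\<lambda>z. measure (p (max 0 (fst z)) (snd z)) A) \<in> borel_measurable (borel \<Otimes>\<^sub>M borel)"
    by (auto dest: measurable_compose)
  moreover have "emeasure (p (max 0 (fst z)) (snd z)) A = ennreal (measure (p (max 0 (fst z)) (snd z)) A)" for z
    using p_prob[of "max 0 (fst z)" "snd z"]
    by (simp add: finite_measure.emeasure_eq_measure prob_space.finite_measure)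
  ultimately show "(\<lambda>z. emeasure (p (max 0 (fst z)) (snd z)) A) \<in> borel_measurable (borel \<Otimes>\<^sub>M borel)"
    by simp
qed (auto intro!: prob_space_imp_subprob_space p_prob simp: p_sets)

lemma kernel [measurable]: "0 \<le> t \<Longrightarrow> p t \<in> borel \<rightarrow>\<^sub>M prob_algebra borel"
  using measurable_compose[OF _ joint_kernel, of "\<lambda>x. (t, x)" borel] by (simp add: max_def)

lemma kernel_subprob: "0 \<le> t \<Longrightarrow> p t \<in> borel \<rightarrow>\<^sub>M subprob_algebra borel"
  by (intro measurable_prob_algebraD kernel)

lemma ptf_joint_measurable [measurable]:
  "f \<in> borel_measurable borel \<Longrightarrow> (\<lambda>z. ptf p (max 0 (fst z)) f (snd z)) \<in> borel_measurable (borel \<Otimes>\<^sub>M borel)"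
  unfolding ptf_def
  by (rule measurable_compose[OF measurable_prob_algebraD[OF joint_kernel] integral_measurable_subprob_algebra])

lemma ptf_measurable [measurable]:
  "0 \<le> t \<Longrightarrow> f \<in> borel_measurable borel \<Longrightarrow> ptf p t f \<in> borel_measurable borel"
  unfolding ptf_def
  by (rule measurable_compose[OF kernel_subprob integral_measurable_subprob_algebra])

lemma kernel_subprob': "0 \<le> s \<Longrightarrow> 0 \<le> t \<Longrightarrow> p t \<in> p s x \<rightarrow>\<^sub>M subprob_algebra borel"
  by (subst measurable_cong_sets[OF p_sets refl]) (auto intro: kernel_subprob)

lemma ptf_integrable:
  fixes f :: "'a \<Rightarrow> real"
  shows "0 \<le> t \<Longrightarrow> f \<in> borel_measurable borel \<Longrightarrow> (\<And>x. \<bar>f x\<bar> \<le> c) \<Longrightarrow> integrable (p t x) f"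
  using p_prob[of t x]
  by (intro finite_measure.integrable_const_bound[of _ _ c]) (auto simp: prob_space.finite_measure)

lemma ptf_bound: "0 \<le> t \<Longrightarrow> (\<And>x. \<bar>f x\<bar> \<le> c) \<Longrightarrow> \<bar>ptf p t f x\<bar> \<le> c"
  unfolding ptf_def by (intro prob_space.abs_expectation_le p_prob)

lemma ptf_nonneg: "(\<And>x. 0 \<le> f x) \<Longrightarrow> 0 \<le> ptf p t f x"
  unfolding ptf_def by simp

lemma ptf_le:
  assumes "0 \<le> t" "\<And>x. 0 \<le> f x" "\<And>x. f x \<le> c"
  shows "ptf p t f x \<le> c"
proof -
  have "\<bar>f x\<bar> \<le> c" for x using assms(2,3)[of x] by simp
  then have "\<bar>ptf p t f x\<bar> \<le> c" by (intro ptf_bound assms)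
  then show ?thesis by simp
qed

lemma ptf_diff:
  assumes "0 \<le> t" "f \<in> borel_measurable borel" "g \<in> borel_measurable borel"
    "\<And>x. \<bar>f x\<bar> \<le> c" "\<And>x. \<bar>g x\<bar> \<le> d"
  shows "ptf p t (\<lambda>x. f x - g x) x = ptf p t f x - ptf p t g x"
  unfolding ptf_def using assms by (intro Bochner_Integration.integral_diff ptf_integrable)

lemma ptf_add_const:
  assumes "0 \<le> t" "f \<in> borel_measurable borel" "\<And>x. \<bar>f x\<bar> \<le> c"
  shows "ptf p t (\<lambda>x. f x + e) x = ptf p t f x + e"
proof -
  interpret prob_space "p t x" by (rule p_prob) fact
  show ?thesis
    unfolding ptf_def using ptf_integrable[OF assms] by (simp add: prob_space)
qed

lemma ptf_0: "f \<in> borel_measurable borel \<Longrightarrow> ptf p 0 f x = f x"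
  by (simp add: ptf_def p_0 integral_return)

text \<open>The Chapman-Kolmogorov equation for sets, recast as a composition of kernels so that
  \<open>integral_bind\<close> extends it to functions.\<close>

lemma p_add:
  assumes s: "0 \<le> s" and t: "0 \<le> t"
  shows "p (s + t) x = p s x \<bind> p t"
proof (rule measure_eqI)
  note ps = kernel_subprob'[OF s t, of x]
  have sb: "sets (p s x \<bind> p t) = sets borel"
    using sets_bind[of "p s x" "p t" borel] s t by (simp add: p_sets p_space)
  show "sets (p (s + t) x) = sets (p s x \<bind> p t)"
    using s t by (simp add: sb p_sets)
  fix A assume "A \<in> sets (p (s + t) x)"
  then have A[measurable]: "A \<in> sets borel" using s t by (simp add: p_sets)
  have fin: "finite_measure (p r y)" if "0 \<le> r" for r y using p_prob[OF that] by (rule prob_space.finite_measure)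
  interpret ps: prob_space "p s x" by (rule p_prob[OF s])
  have meas: "(\<lambda>y. measure (p t y) A) \<in> borel_measurable borel"
    unfolding measure_def
    by (intro borel_measurable_enn2real measurable_compose[OF kernel_subprob[OF t] measurable_emeasure_subprob_algebra] A)
  have int: "integrable (p s x) (\<lambda>y. measure (p t y) A)"
    using meas s p_prob[OF t] by (intro ps.integrable_const_bound[where B = 1])
      (auto simp: prob_space.prob_le_1)
  have "measure (p (s + t) x) A = (\<integral>y. measure (p t y) A \<partial>(p s x))"
    using trans s t A unfolding transition_function_def by blast
  then have "emeasure (p (s + t) x) A = ennreal (\<integral>y. measure (p t y) A \<partial>(p s x))"
    using fin[of "s + t" x] s t by (simp add: finite_measure.emeasure_eq_measure)
  also have "\<dots> = (\<integral>\<^sup>+y. ennreal (measure (p t y) A) \<partial>(p s x))"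
    by (rule nn_integral_eq_integral[OF int, symmetric]) simp
  also have "\<dots> = (\<integral>\<^sup>+y. emeasure (p t y) A \<partial>(p s x))"
    using fin[OF t] by (simp add: finite_measure.emeasure_eq_measure)
  also have "\<dots> = emeasure (p s x \<bind> p t) A"
    using ps s by (intro emeasure_bind[symmetric, of _ _ borel]) (auto simp: p_space)
  finally show "emeasure (p (s + t) x) A = emeasure (p s x \<bind> p t) A" .
qed

lemma ptf_add:
  assumes s: "0 \<le> s" and t: "0 \<le> t" and f: "f \<in> borel_measurable borel" "\<And>x. \<bar>f x\<bar> \<le> c"
  shows "ptf p (s + t) f x = ptf p s (ptf p t f) x"
proof -
  interpret ps: prob_space "p s x" by (rule p_prob[OF s])
  note ps = kernel_subprob'[OF s t, of x]
  show ?thesis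
    unfolding ptf_def p_add[OF s t]
    using ps f s p_prob[OF t]
    by (intro integral_bind[where K = borel and B' = 1 and B = c])
       (auto simp: p_space ps.finite_measure_axioms prob_space.emeasure_space_1 p_prob)
qed

section \<open>The kernel as a version of the L2 semigroup\<close>

lemma T_AE:
  assumes t: "0 \<le> t" and f: "f \<in> L2 m" and b: "\<And>x. \<bar>f x\<bar> \<le> c"
  shows "AE x in m. T t f x = ptf p t f x"
proof -
  have "bounded (range f)" using b by (auto simp: bounded_iff)
  then show ?thesis using represents t f unfolding represents_def L2_def by auto
qed

lemma T_L2: "0 \<le> t \<Longrightarrow> f \<in> L2 m \<Longrightarrow> T t f \<in> L2 m"
  using semigroup[unfolded strongly_continuous_semigroup_def, THEN conjunct1] by blast

lemma ptf_L2:
  assumes t: "0 \<le> t" and f: "f \<in> L2 m" and b: "\<And>x. \<bar>f x\<bar> \<le> c"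
  shows "ptf p t f \<in> L2 m"
proof -
  have m: "f \<in> borel_measurable borel" using f by (simp add: L2_def)
  have "integrable m (\<lambda>x. (ptf p t f x)\<^sup>2) \<longleftrightarrow> integrable m (\<lambda>x. (T t f x)\<^sup>2)"
    using T_AE[OF t f b] L2_measurable[OF T_L2[OF t f]] t m by (intro integrable_cong_AE) auto
  then show ?thesis using T_L2[OF t f] m t by (simp add: L2_def)
qed

lemma ip_T_ptf:
  assumes t: "0 \<le> t" and f: "f \<in> L2 m" and b: "\<And>x. \<bar>f x\<bar> \<le> c" and g: "g \<in> L2 m"
  shows "L2inner m (T t f) g = L2inner m (ptf p t f) g"
  using T_AE[OF t f b]
  by (intro L2inner_cong_AE L2_measurable T_L2[OF t f] ptf_L2[OF t f b] g) auto

lemma ennreal_ptf: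
  assumes "0 \<le> t" "f \<in> borel_measurable borel" "\<And>x. 0 \<le> f x" "\<And>x. f x \<le> c" "0 \<le> a"
  shows "(\<integral>\<^sup>+y. ennreal (a * f y) \<partial>p t x) = ennreal (a * ptf p t f x)"
proof -
  have "\<bar>f x\<bar> \<le> c" for x using assms(3,4)[of x] by simp
  then have "integrable (p t x) (\<lambda>y. a * f y)"
    by (intro integrable_mult_right ptf_integrable assms)
  then show ?thesis unfolding ptf_def using assms by (subst nn_integral_eq_integral) auto
qed

section \<open>The symmetric measure m(dx) p_t(x, dy)\<close>

lemma kernel_nn_measurable:
  "0 \<le> t \<Longrightarrow> a \<in> borel_measurable borel \<Longrightarrow> b \<in> borel_measurable borel \<Longrightarrow>
    (\<lambda>x. \<integral>\<^sup>+y. ennreal (a x * b y) \<partial>p t x) \<in> borel_measurable borel"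
  by (rule nn_integral_measurable_subprob_algebra2[OF _ kernel_subprob, where f = "\<lambda>x y. ennreal (a x * b y)"])
    (auto simp: split_beta)

text \<open>Monotone convergence in both variables; infinite values are allowed, so no integrability
  has to be known beforehand.\<close>

lemma kernel_nn_LIMSEQ:
  assumes t: "0 \<le> t"
    and meas: "\<And>n. a n \<in> borel_measurable borel" "\<And>n. b n \<in> borel_measurable borel"
    and mono: "\<And>x. incseq (\<lambda>n. a n x)" "\<And>x. incseq (\<lambda>n. b n x)"
    and nn: "\<And>n x. 0 \<le> a n x" "\<And>n x. 0 \<le> b n x"
    and lim: "\<And>x. (\<lambda>n. a n x) \<longlonglongrightarrow> a' x" "\<And>x. (\<lambda>n. b n x) \<longlonglongrightarrow> b' x"
  shows "(\<lambda>n. \<integral>\<^sup>+x. \<integral>\<^sup>+y. ennreal (a n x * b n y) \<partial>p t x \<partial>m) \<longlonglongrightarrow>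
    (\<integral>\<^sup>+x. \<integral>\<^sup>+y. ennreal (a' x * b' y) \<partial>p t x \<partial>m)"
proof -
  have le: "ennreal (a i x * b i y) \<le> ennreal (a j x * b j y)" if "i \<le> j" for i j x y
    using that mono nn by (intro ennreal_leI mult_mono) (auto simp: incseq_def)
  show ?thesis
  proof (rule nn_integral_LIMSEQ)
    show "incseq (\<lambda>n x. \<integral>\<^sup>+y. ennreal (a n x * b n y) \<partial>p t x)"
      by (auto simp: incseq_def le_fun_def intro!: nn_integral_mono le)
    show "(\<lambda>n. \<integral>\<^sup>+y. ennreal (a n x * b n y) \<partial>p t x) \<longlonglongrightarrow> (\<integral>\<^sup>+y. ennreal (a' x * b' y) \<partial>p t x)" for x
    proof (rule nn_integral_LIMSEQ)
      show "incseq (\<lambda>n y. ennreal (a n x * b n y))" by (auto simp: incseq_def le_fun_def intro!: le)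
      show "(\<lambda>n. ennreal (a n x * b n y)) \<longlonglongrightarrow> ennreal (a' x * b' y)" for y
        by (intro tendsto_ennrealI tendsto_mult lim)
    qed (use t meas in simp)
    show "(\<lambda>x. \<integral>\<^sup>+y. ennreal (a n x * b n y) \<partial>p t x) \<in> borel_measurable m" for n
      using t meas by (simp add: kernel_nn_measurable)
  qed
qed

lemma nn_form_bounded:
  assumes t: "0 \<le> t" and a: "a \<in> L2 m" "\<And>x. 0 \<le> a x" and b: "b \<in> L2 m" "\<And>x. 0 \<le> b x" "\<And>x. b x \<le> c"
  shows "(\<integral>\<^sup>+x. \<integral>\<^sup>+y. ennreal (a x * b y) \<partial>p t x \<partial>m) = ennreal (L2inner m a (ptf p t b))"
proof -
  have bm: "b \<in> borel_measurable borel" using b(1) by (simp add: L2_def)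
  have bb: "\<bar>b x\<bar> \<le> c" for x using b(2,3)[of x] by simp
  have "(\<integral>\<^sup>+x. \<integral>\<^sup>+y. ennreal (a x * b y) \<partial>p t x \<partial>m) = (\<integral>\<^sup>+x. ennreal (a x * ptf p t b x) \<partial>m)"
    by (simp add: ennreal_ptf[OF t bm b(2,3) a(2)])
  also have "\<dots> = ennreal (L2inner m a (ptf p t b))"
    unfolding L2inner_def
    by (intro nn_integral_eq_integral L2_mult_integrable a ptf_L2[OF t b(1) bb])
      (auto intro!: mult_nonneg_nonneg a ptf_nonneg b)
  finally show ?thesis .
qed

text \<open>Symmetry of \<open>T\<close> yields this for bounded L2 functions only. Since
  \<open>m\<close> is \<sigma>-finite, every nonnegative function is an increasing limit of such
  functions.\<close>

lemma nn_form_sym: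
  assumes t: "0 \<le> t" and a: "a \<in> borel_measurable borel" "\<And>x. 0 \<le> a x"
    and b: "b \<in> borel_measurable borel" "\<And>x. 0 \<le> b x"
  shows "(\<integral>\<^sup>+x. \<integral>\<^sup>+y. ennreal (a x * b y) \<partial>p t x \<partial>m) = (\<integral>\<^sup>+x. \<integral>\<^sup>+y. ennreal (b x * a y) \<partial>p t x \<partial>m)"
proof -
  obtain A :: "nat \<Rightarrow> 'a set" where A: "range A \<subseteq> sets m" "(\<Union>i. A i) = space m"
      "\<And>i. emeasure m (A i) \<noteq> \<infinity>" "incseq A"
    using sigma_finite_incseq by blast
  have [measurable]: "A n \<in> sets borel" for n using A(1) m_sets by auto
  \<comment> \<open>Capping the value gives boundedness, and restricting to a set of finite measure
    gives square integrability.\<close>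
  define cut where "cut g n x = min (g x) (real n) * indicator (A n) x" for g :: "'a \<Rightarrow> real" and n x
  have cut: "cut g n \<in> borel_measurable borel" "cut g n \<in> L2 m" "0 \<le> cut g n x" "cut g n x \<le> real n"
      "incseq (\<lambda>n. cut g n x)" "(\<lambda>n. cut g n x) \<longlonglongrightarrow> g x"
    if g[measurable]: "g \<in> borel_measurable borel" and g0: "\<And>x. 0 \<le> g x" for g n x
  proof -
    show meas[measurable]: "cut g n \<in> borel_measurable borel" for n unfolding cut_def by measurable
    show nn: "0 \<le> cut g n x" for n x using g0 by (simp add: cut_def)
    show le: "cut g n x \<le> real n" for n x by (simp add: cut_def split: split_indicator)
    show "cut g n \<in> L2 m"
    proof (rule bounded_L2_if_integrable[OF _ nn le])
      have "(\<integral>\<^sup>+x. ennreal (cut g n x) \<partial>m) \<le> (\<integral>\<^sup>+x. ennreal (real n) * indicator (A n) x \<partial>m)"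
        by (intro nn_integral_mono) (auto simp: cut_def split: split_indicator intro!: ennreal_leI)
      also have "\<dots> = ennreal (real n) * emeasure m (A n)"
        using A(1) by (intro nn_integral_cmult_indicator) auto
      also have "\<dots> < \<infinity>" using A(3) by (simp add: ennreal_mult_less_top less_top)
      finally show "(\<integral>\<^sup>+x. ennreal (cut g n x) \<partial>m) < \<infinity>" .
    qed simp
    show "incseq (\<lambda>n. cut g n x)"
    proof (rule incseq_SucI)
      fix n
      have "A n \<subseteq> A (Suc n)" using A(4) by (simp add: incseq_SucD)
      then show "cut g n x \<le> cut g (Suc n) x"
        using g0[of x] by (auto simp: cut_def split: split_indicator)
    qed
    obtain k where k: "x \<in> A k" using A(2) by auto
    show "(\<lambda>n. cut g n x) \<longlonglongrightarrow> g x"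
    proof (rule tendsto_eventually)
      show "\<forall>\<^sub>F n in sequentially. cut g n x = g x"
        using eventually_ge_at_top[of "max k (nat \<lceil>g x\<rceil>)"]
      proof eventually_elim
        case (elim n)
        then have "g x \<le> real n" "x \<in> A n" using A(4) k by (auto simp: incseq_def le_nat_iff nat_le_iff) linarith
        then show ?case by (simp add: cut_def)
      qed
    qed
  qed
  have eq: "(\<integral>\<^sup>+x. \<integral>\<^sup>+y. ennreal (cut a n x * cut b n y) \<partial>p t x \<partial>m)
      = (\<integral>\<^sup>+x. \<integral>\<^sup>+y. ennreal (cut b n x * cut a n y) \<partial>p t x \<partial>m)" for n
  proof -
    have ab: "\<bar>cut a n x\<bar> \<le> real n" "\<bar>cut b n x\<bar> \<le> real n" for x
      using cut(3,4)[OF a, of n x] cut(3,4)[OF b, of n x] by simp_all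
    have "L2inner m (cut a n) (ptf p t (cut b n)) = L2inner m (T t (cut b n)) (cut a n)"
      using ip_T_ptf[OF t cut(2)[OF b] ab(2) cut(2)[OF a]]
        L2.sym[OF cut(2)[OF a] ptf_L2[OF t cut(2)[OF b] ab(2)]] by simp
    also have "\<dots> = L2inner m (cut b n) (T t (cut a n))"
      using symmetric t cut(2)[OF a] cut(2)[OF b] unfolding symmetric_semigroup_def by blast
    also have "\<dots> = L2inner m (cut b n) (ptf p t (cut a n))"
      using ip_T_ptf[OF t cut(2)[OF a] ab(1) cut(2)[OF b]]
        L2.sym[OF cut(2)[OF b] ptf_L2[OF t cut(2)[OF a] ab(1)]]
        L2.sym[OF cut(2)[OF b] T_L2[OF t cut(2)[OF a]]] by simp
    finally show ?thesis
      using nn_form_bounded[OF t cut(2,3)[OF a] cut(2-4)[OF b], of n n]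
        nn_form_bounded[OF t cut(2,3)[OF b] cut(2-4)[OF a], of n n] by simp
  qed
  show ?thesis
  proof (rule LIMSEQ_unique)
    show "(\<lambda>n. \<integral>\<^sup>+x. \<integral>\<^sup>+y. ennreal (cut a n x * cut b n y) \<partial>p t x \<partial>m)
        \<longlonglongrightarrow> (\<integral>\<^sup>+x. \<integral>\<^sup>+y. ennreal (a x * b y) \<partial>p t x \<partial>m)"
      using cut[OF a] cut[OF b] by (intro kernel_nn_LIMSEQ t)
    show "(\<lambda>n. \<integral>\<^sup>+x. \<integral>\<^sup>+y. ennreal (cut a n x * cut b n y) \<partial>p t x \<partial>m)
        \<longlonglongrightarrow> (\<integral>\<^sup>+x. \<integral>\<^sup>+y. ennreal (b x * a y) \<partial>p t x \<partial>m)"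
      unfolding eq using cut[OF a] cut[OF b] by (intro kernel_nn_LIMSEQ t)
  qed
qed

text \<open>Symmetry tested against the constant 1. This constant is not in L2 when \<open>m\<close>
  is infinite, hence the generality of \<open>nn_form_sym\<close>.\<close>

lemma ptf_invariant:
  assumes t: "0 \<le> t" and b: "b \<in> borel_measurable borel" "\<And>x. 0 \<le> b x" "\<And>x. b x \<le> c"
  shows "(\<integral>\<^sup>+x. ennreal (ptf p t b x) \<partial>m) = (\<integral>\<^sup>+x. ennreal (b x) \<partial>m)"
proof -
  have "(\<integral>\<^sup>+x. ennreal (ptf p t b x) \<partial>m) = (\<integral>\<^sup>+x. \<integral>\<^sup>+y. ennreal (1 * b y) \<partial>p t x \<partial>m)"
    by (subst ennreal_ptf[OF t b]) auto
  also have "\<dots> = (\<integral>\<^sup>+x. \<integral>\<^sup>+y. ennreal (b x * 1) \<partial>p t x \<partial>m)"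
    using b by (intro nn_form_sym[OF t]) auto
  also have "\<dots> = (\<integral>\<^sup>+x. ennreal (b x) \<partial>m)"
    using prob_space.emeasure_space_1[OF p_prob[OF t]] by simp
  finally show ?thesis .
qed

section \<open>L2 contraction and passage to unbounded functions\<close>

lemma ptf_contraction:
  assumes t: "0 \<le> t" and f: "f \<in> L2 m" and b: "\<And>x. \<bar>f x\<bar> \<le> c"
  shows "L2inner m (ptf p t f) (ptf p t f) \<le> L2inner m f f"
proof -
  have fm[measurable]: "f \<in> borel_measurable borel" using f by (simp add: L2_def)
  have b2: "(f x)\<^sup>2 \<le> c\<^sup>2" for x using b[of x] by (metis abs_ge_zero abs_le_square_iff abs_of_nonneg order_trans)
  have le: "(ptf p t f x)\<^sup>2 \<le> ptf p t (\<lambda>x. (f x)\<^sup>2) x" for x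
    unfolding ptf_def using t p_prob[OF t] ptf_integrable[OF t fm b] ptf_integrable[OF t, of "\<lambda>x. (f x)\<^sup>2" "c\<^sup>2"] b2
    by (intro prob_space.square_expectation_le) auto
  have nn_eq: "ennreal (L2inner m g g) = (\<integral>\<^sup>+x. ennreal ((g x)\<^sup>2) \<partial>m)" if "g \<in> L2 m" for g
    using L2_square_integrable[OF that] by (simp add: L2inner_def nn_integral_eq_integral power2_eq_square)
  have "ennreal (L2inner m (ptf p t f) (ptf p t f)) \<le> (\<integral>\<^sup>+x. ennreal (ptf p t (\<lambda>x. (f x)\<^sup>2) x) \<partial>m)"
    unfolding nn_eq[OF ptf_L2[OF t f b]] by (intro nn_integral_mono ennreal_leI le)
  also have "\<dots> = (\<integral>\<^sup>+x. ennreal ((f x)\<^sup>2) \<partial>m)" using b2 by (intro ptf_invariant t) auto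
  also have "\<dots> = ennreal (L2inner m f f)" using nn_eq[OF f] by simp
  finally show ?thesis using L2.nonneg[OF f] by (simp add: ennreal_le_iff)
qed

text \<open>Only the operator bound in the definition of a semigroup may be used, because
  contractivity is deduced from this limit.\<close>

lemma T_truncate_tendsto:
  assumes t: "0 \<le> t" and f: "f \<in> L2 m"
  shows "(\<lambda>n. L2inner m (\<lambda>x. T t (truncate n f) x - T t f x) (\<lambda>x. T t (truncate n f) x - T t f x)) \<longlonglongrightarrow> 0"
proof -
  let ?d = "\<lambda>n x. truncate n f x - f x"
  have d: "?d n \<in> L2 m" for n by (intro L2_diff_closed truncate_L2 f)
  obtain C where C: "\<And>g. g \<in> L2 m \<Longrightarrow> L2norm m (T t g) \<le> C * L2norm m g"
    using semigroup[unfolded strongly_continuous_semigroup_def, THEN conjunct2, THEN conjunct2,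
        THEN conjunct2, THEN conjunct1, rule_format, OF t] by blast
  have "AE x in m. T t (\<lambda>y. 1 * truncate n f y + (- 1) * f y) x = 1 * T t (truncate n f) x + (- 1) * T t f x" for n
    by (rule semigroup[unfolded strongly_continuous_semigroup_def, THEN conjunct2, THEN conjunct2,
      THEN conjunct1, rule_format, OF t truncate_L2[OF f] f])
  then have AE: "AE x in m. T t (?d n) x = T t (truncate n f) x - T t f x" for n by simp
  have eq: "L2inner m (\<lambda>x. T t (truncate n f) x - T t f x) (\<lambda>x. T t (truncate n f) x - T t f x)
      = (L2norm m (T t (?d n)))\<^sup>2" for n
    unfolding L2norm_power2[OF T_L2[OF t d]]
    using AE[of n] by (intro L2inner_cong_AE L2_measurable L2_diff_closed T_L2 t d truncate_L2 f) auto
  show ?thesis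
    unfolding eq
  proof (rule tendsto_sandwich[where f = "\<lambda>_. 0" and h = "\<lambda>n. C\<^sup>2 * L2inner m (?d n) (?d n)"])
    show "\<forall>\<^sub>F n in sequentially. (L2norm m (T t (?d n)))\<^sup>2 \<le> C\<^sup>2 * L2inner m (?d n) (?d n)"
    proof (intro always_eventually allI)
      fix n
      have "(L2norm m (T t (?d n)))\<^sup>2 \<le> (C * L2norm m (?d n))\<^sup>2"
        by (intro power_mono C d) (simp add: L2norm_eq L2.nonneg T_L2 t d)
      then show "(L2norm m (T t (?d n)))\<^sup>2 \<le> C\<^sup>2 * L2inner m (?d n) (?d n)"
        by (simp only: power_mult_distrib L2norm_power2[OF d])
    qed
    show "(\<lambda>n. C\<^sup>2 * L2inner m (?d n) (?d n)) \<longlonglongrightarrow> 0"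
      using tendsto_mult_left[OF truncate_tendsto_L2[OF f], of "C\<^sup>2"] by simp
  qed simp_all
qed

lemma T_contraction:
  assumes t: "0 \<le> t" and f: "f \<in> L2 m"
  shows "L2inner m (T t f) (T t f) \<le> L2inner m f f"
proof (rule LIMSEQ_le)
  show "(\<lambda>n. L2inner m (T t (truncate n f)) (T t (truncate n f))) \<longlonglongrightarrow> L2inner m (T t f) (T t f)"
    by (intro L2.tendsto_quad T_L2 t truncate_L2 f T_truncate_tendsto)
  show "(\<lambda>n. L2inner m (truncate n f) (truncate n f)) \<longlonglongrightarrow> L2inner m f f"
    by (intro L2.tendsto_quad truncate_L2 f truncate_tendsto_L2)
  have "L2inner m (T t (truncate n f)) (T t (truncate n f)) \<le> L2inner m (truncate n f) (truncate n f)" for n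
  proof -
    note * = truncate_L2[OF f, of n] truncate_bound[of n f]
    have "L2inner m (T t (truncate n f)) (T t (truncate n f)) = L2inner m (ptf p t (truncate n f)) (ptf p t (truncate n f))"
      using T_AE[OF t *] by (intro L2inner_cong_AE L2_measurable T_L2[OF t] * ptf_L2[OF t *]) auto
    then show ?thesis using ptf_contraction[OF t *] by simp
  qed
  then show "\<exists>N. \<forall>n\<ge>N. L2inner m (T t (truncate n f)) (T t (truncate n f)) \<le> L2inner m (truncate n f) (truncate n f)"
    by blast
qed

text \<open>Along truncations the left side converges monotonically and the right side by L2
  continuity.\<close>

lemma nn_form_eq:
  assumes t: "0 \<le> t" and f: "f \<in> L2 m" and nn: "\<And>x. 0 \<le> f x"
  shows "(\<integral>\<^sup>+x. \<integral>\<^sup>+y. ennreal (f x * f y) \<partial>p t x \<partial>m) = ennreal (L2inner m (T t f) f)"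
proof (rule LIMSEQ_unique)
  let ?f = "\<lambda>n. truncate n f"
  have nn': "0 \<le> ?f n x" "?f n x \<le> real n" for n x using nn[of x] by (auto simp: truncate_def)
  have inc: "incseq (\<lambda>n. ?f n x)" for x
    using nn[of x] by (auto simp: incseq_def truncate_def)
  show "(\<lambda>n. \<integral>\<^sup>+x. \<integral>\<^sup>+y. ennreal (?f n x * ?f n y) \<partial>p t x \<partial>m)
      \<longlonglongrightarrow> (\<integral>\<^sup>+x. \<integral>\<^sup>+y. ennreal (f x * f y) \<partial>p t x \<partial>m)"
    using L2_measurable[OF truncate_L2[OF f]] by (intro kernel_nn_LIMSEQ t inc nn' truncate_tendsto) auto
  have eq: "(\<integral>\<^sup>+x. \<integral>\<^sup>+y. ennreal (?f n x * ?f n y) \<partial>p t x \<partial>m) = ennreal (L2inner m (T t (?f n)) (?f n))" for n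
  proof -
    note * = truncate_L2[OF f, of n] truncate_bound[of n f]
    show ?thesis
      using nn_form_bounded[OF t truncate_L2[OF f] nn'(1) truncate_L2[OF f] nn'(1) nn'(2), of n n]
        ip_T_ptf[OF t * truncate_L2[OF f, of n]]
        L2.sym[OF truncate_L2[OF f, of n] ptf_L2[OF t *]] by simp
  qed
  show "(\<lambda>n. \<integral>\<^sup>+x. \<integral>\<^sup>+y. ennreal (?f n x * ?f n y) \<partial>p t x \<partial>m) \<longlonglongrightarrow> ennreal (L2inner m (T t f) f)"
    unfolding eq
    by (intro tendsto_ennrealI L2.tendsto_inner T_L2 t truncate_L2 f T_truncate_tendsto truncate_tendsto_L2)
qed

text \<open>\<open>ennreal\<close> sends negative reals to 0, so this sign is what lets an
  inequality obtained from \<open>nn_form_eq\<close> be read back in the reals.\<close>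

lemma form_T_nonneg:
  assumes t: "0 \<le> t" and f: "f \<in> L2 m" and nn: "\<And>x. 0 \<le> f x"
  shows "0 \<le> L2inner m (T t f) f"
proof (rule LIMSEQ_le_const)
  show "(\<lambda>n. L2inner m (T t (truncate n f)) (truncate n f)) \<longlonglongrightarrow> L2inner m (T t f) f"
    by (intro L2.tendsto_inner T_L2 t truncate_L2 f T_truncate_tendsto truncate_tendsto_L2)
  have "0 \<le> L2inner m (T t (truncate n f)) (truncate n f)" for n
  proof -
    note * = truncate_L2[OF f, of n] truncate_bound[of n f]
    have nn': "0 \<le> truncate n f x" for x using nn[of x] by (simp add: truncate_def)
    have "L2inner m (T t (truncate n f)) (truncate n f) = (\<integral>x. ptf p t (truncate n f) x * truncate n f x \<partial>m)"
      using ip_T_ptf[OF t * truncate_L2[OF f, of n]] by (simp add: L2inner_def)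
    then show ?thesis
      by (simp only:) (intro Bochner_Integration.integral_nonneg mult_nonneg_nonneg ptf_nonneg nn')
  qed
  then show "\<exists>N. \<forall>n\<ge>N. 0 \<le> L2inner m (T t (truncate n f)) (truncate n f)" by blast
qed

end

subsection \<open>Time averages\<close>

text \<open>The uniform distribution on (0, r]. With time as a probability space, Jensen and Fubini
  apply directly to time averages.\<close>

definition unif :: "real \<Rightarrow> real measure" where
  "unif r = density lborel (\<lambda>s. ennreal (indicator {0<..r} s / r))"

lemma sets_unif [simp, measurable_cong]: "sets (unif r) = sets borel"
  and space_unif [simp]: "space (unif r) = UNIV"
  by (simp_all add: unif_def)

lemma prob_space_unif: "0 < r \<Longrightarrow> prob_space (unif r)"
proof
  assume r: "0 < r"
  have "emeasure (unif r) (space (unif r)) = (\<integral>\<^sup>+s. ennreal (1 / r) * indicator {0<..r} s \<partial>lborel)"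
    unfolding unif_def by (auto simp: emeasure_density intro!: nn_integral_cong split: split_indicator)
  also have "\<dots> = ennreal (1 / r) * ennreal r"
    using r by (subst nn_integral_cmult_indicator) auto
  also have "\<dots> = 1" using r by (simp flip: ennreal_mult)
  finally show "emeasure (unif r) (space (unif r)) = 1" .
qed

lemma AE_unif: "0 < r \<Longrightarrow> AE s in unif r. 0 < s \<and> s \<le> r"
  unfolding unif_def by (subst AE_density) (auto split: split_indicator)

lemma measurable_unif [simp]: "borel_measurable (unif r) = borel_measurable borel"
  by (intro measurable_cong_sets) auto

lemma integral_unif:
  fixes g :: "real \<Rightarrow> real"
  assumes "0 < r" "g \<in> borel_measurable borel"
  shows "r * (\<integral>s. g s \<partial>unif r) = (\<integral>s. indicator {0<..r} s * g s \<partial>lborel)"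
proof -
  have "(\<integral>s. g s \<partial>unif r) = (\<integral>s. (1 / r) * (indicator {0<..r} s * g s) \<partial>lborel)"
    unfolding unif_def using assms by (subst integral_density) auto
  also have "\<dots> = (1 / r) * (\<integral>s. indicator {0<..r} s * g s \<partial>lborel)"
    by (rule integral_mult_right_zero)
  finally show ?thesis using assms(1) by simp
qed

context reversible_kernel
begin

text \<open>The average of p_s w over (0, r]. The \<open>max 0\<close> supplies joint measurability
  and changes the integrand only where \<open>unif r\<close> has no mass.\<close>

definition avg :: "real \<Rightarrow> ('a \<Rightarrow> real) \<Rightarrow> 'a \<Rightarrow> real" where
  "avg r w x = (\<integral>s. ptf p (max 0 s) w x \<partial>unif r)"

lemma ptf_section_measurable [measurable]:
  "w \<in> borel_measurable borel \<Longrightarrow> (\<lambda>s. ptf p (max 0 s) w x) \<in> borel_measurable borel"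
  using measurable_compose[OF _ ptf_joint_measurable, of "\<lambda>s. (s, x)" borel w] by simp

lemma D1v_eq_avg:
  assumes "0 < r" "0 \<le> \<eta>" and u: "u \<in> borel_measurable borel"
  shows "D1v p u r \<eta> = avg r (ptf p \<eta> u)"
proof
  fix x
  have "(LBINT s=0..r. ptf p s (ptf p \<eta> u) x) = (\<integral>s. indicator {0<..r} s * ptf p s (ptf p \<eta> u) x \<partial>lborel)"
    using assms(1) interval_integral_Ioc[of 0 r "\<lambda>s. ptf p s (ptf p \<eta> u) x"]
    by (simp add: set_lebesgue_integral_def zero_ereal_def)
  also have "\<dots> = (\<integral>s. indicator {0<..r} s * ptf p (max 0 s) (ptf p \<eta> u) x \<partial>lborel)"
    by (intro Bochner_Integration.integral_cong) (auto split: split_indicator)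
  also have "\<dots> = r * avg r (ptf p \<eta> u) x"
    unfolding avg_def using assms by (intro integral_unif[symmetric]) auto
  finally show "D1v p u r \<eta> x = avg r (ptf p \<eta> u) x"
    using assms(1) by (simp add: D1v_def)
qed

lemma avg_measurable [measurable]:
  assumes "0 < r" and w[measurable]: "w \<in> borel_measurable borel"
  shows "avg r w \<in> borel_measurable borel"
proof -
  interpret prob_space "unif r" by (rule prob_space_unif) fact
  have "(\<lambda>z. (snd z, fst z)) \<in> (borel :: 'a measure) \<Otimes>\<^sub>M unif r \<rightarrow>\<^sub>M borel \<Otimes>\<^sub>M borel" by simp
  from measurable_compose[OF this ptf_joint_measurable[OF w]]
  show ?thesis unfolding avg_def by (intro borel_measurable_lebesgue_integral) (simp add: split_beta)
qed

lemma avg_bound: "0 < r \<Longrightarrow> (\<And>x. \<bar>w x\<bar> \<le> c) \<Longrightarrow> \<bar>avg r w x\<bar> \<le> c"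
  unfolding avg_def by (intro prob_space.abs_expectation_le prob_space_unif ptf_bound) auto

lemma avg_nonneg: "(\<And>x. 0 \<le> w x) \<Longrightarrow> 0 \<le> avg r w x"
  unfolding avg_def by (intro Bochner_Integration.integral_nonneg ptf_nonneg)

lemma ptf_unif_integrable:
  assumes "0 < r" "w \<in> borel_measurable borel" "\<And>x. \<bar>w x\<bar> \<le> c"
  shows "integrable (unif r) (\<lambda>s. ptf p (max 0 s) w x)"
proof -
  interpret prob_space "unif r" by (rule prob_space_unif) fact
  have "AE s in unif r. norm (ptf p (max 0 s) w x) \<le> c"
    by (intro AE_I2) (simp add: ptf_bound assms(3))
  then show ?thesis using assms(2) by (intro integrable_const_bound) auto
qed

lemma avg_diff:
  assumes r: "0 < r" and f: "f \<in> borel_measurable borel" "\<And>x. \<bar>f x\<bar> \<le> c"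
    and g: "g \<in> borel_measurable borel" "\<And>x. \<bar>g x\<bar> \<le> d"
  shows "avg r (\<lambda>x. f x - g x) x = avg r f x - avg r g x"
proof -
  have "ptf p (max 0 s) (\<lambda>x. f x - g x) x = ptf p (max 0 s) f x - ptf p (max 0 s) g x" for s
    by (rule ptf_diff[OF _ f(1) g(1) f(2) g(2)]) simp
  then show ?thesis
    unfolding avg_def using ptf_unif_integrable[OF r f] ptf_unif_integrable[OF r g] by simp
qed

lemma avg_ptf:
  assumes r: "0 < r" and h: "0 \<le> h" and w: "w \<in> borel_measurable borel" "\<And>x. \<bar>w x\<bar> \<le> c"
  shows "ptf p h (avg r w) x = avg r (ptf p h w) x"
proof -
  interpret U: prob_space "unif r" by (rule prob_space_unif[OF r])
  interpret ph: prob_space "p h x" by (rule p_prob[OF h])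
  interpret pair_prob_space "unif r" "p h x" ..
  have "sets (unif r \<Otimes>\<^sub>M p h x) = sets (borel \<Otimes>\<^sub>M borel)"
    using p_sets[OF h] by (intro sets_pair_measure_cong) auto
  then have meas: "(\<lambda>z. ptf p (max 0 (fst z)) w (snd z)) \<in> borel_measurable (unif r \<Otimes>\<^sub>M p h x)"
    using ptf_joint_measurable[OF w(1)] by (simp cong: measurable_cong_sets)
  have "integrable (unif r \<Otimes>\<^sub>M p h x) (\<lambda>(s, y). ptf p (max 0 s) w y)"
    using meas by (intro P.integrable_const_bound[where B = c])
      (auto simp: split_beta intro!: AE_I2 ptf_bound w)
  from Fubini_integral[OF this]
  have "ptf p h (avg r w) x = (\<integral>s. ptf p h (ptf p (max 0 s) w) x \<partial>unif r)"
    unfolding ptf_def[of p h] avg_def .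
  also have "\<dots> = avg r (ptf p h w) x"
    unfolding avg_def
  proof (intro Bochner_Integration.integral_cong refl)
    fix s
    have "ptf p h (ptf p (max 0 s) w) x = ptf p (h + max 0 s) w x"
      by (rule ptf_add[OF h _ w, symmetric]) simp
    also have "\<dots> = ptf p (max 0 s) (ptf p h w) x"
      unfolding add.commute[of h] by (rule ptf_add[OF _ h w]) simp
    finally show "ptf p h (ptf p (max 0 s) w) x = ptf p (max 0 s) (ptf p h w) x" .
  qed
  finally show ?thesis .
qed

text \<open>Both sides are \<open>G (r + h) - G r - G h\<close> for the primitive \<open>G\<close> of \<open>s \<mapsto> ptf p s w x\<close>.\<close>
lemma avg_exchange:
  assumes r: "0 < r" and h: "0 < h" and w: "w \<in> borel_measurable borel" "\<And>x. \<bar>w x\<bar> \<le> c"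
  shows "r * (avg r (ptf p h w) x - avg r w x) = h * (avg h (ptf p r w) x - avg h w x)"
proof -
  define g where "g s = ptf p (max 0 s) w x" for s
  have g[measurable]: "g \<in> borel_measurable borel" unfolding g_def using w(1) by measurable
  define G where "G a = (\<integral>s. indicator {0<..a} s * g s \<partial>lborel)" for a :: real
  have gb: "\<bar>g s\<bar> \<le> c" for s unfolding g_def by (intro ptf_bound w) simp
  have int: "integrable lborel (\<lambda>s. indicator {0<..a} s * g s)" for a
  proof (rule Bochner_Integration.integrable_bound)
    show "integrable lborel (\<lambda>s. c * indicator {0<..a} s :: real)"
      by (cases "0 \<le> a") (auto intro!: integrable_mult_right integrable_real_indicator)
    show "AE s in lborel. norm (indicator {0<..a} s * g s) \<le> norm (c * indicator {0<..a} s :: real)"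
      using gb by (intro AE_I2) (auto split: split_indicator intro: order_trans[OF gb abs_ge_self])
  qed simp
  have avg: "a * avg a w x = G a" if "0 < a" for a
    unfolding G_def avg_def g_def[symmetric] by (rule integral_unif[OF that g])
  have shift: "a * avg a (ptf p b w) x = G (a + b) - G b" if a: "0 < a" and b: "0 < b" for a b
  proof -
    have "a * avg a (ptf p b w) x = (\<integral>s. indicator {0<..a} s * ptf p (max 0 s) (ptf p b w) x \<partial>lborel)"
      unfolding avg_def using b w(1) by (intro integral_unif a) auto
    also have "\<dots> = (\<integral>s. indicator {b<..a + b} (b + 1 * s) * g (b + 1 * s) \<partial>lborel)"
    proof (intro Bochner_Integration.integral_cong refl)
      fix s
      show "indicator {0<..a} s * ptf p (max 0 s) (ptf p b w) x
          = indicator {b<..a + b} (b + 1 * s) * g (b + 1 * s)"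
        using ptf_add[of "max 0 s" b w c x] b w
        by (auto simp: g_def add.commute split: split_indicator)
    qed
    also have "\<dots> = (\<integral>s. indicator {b<..a + b} s * g s \<partial>lborel)"
      by (subst (2) lborel_integral_real_affine[of 1 _ b]) auto
    also have "\<dots> = (\<integral>s. indicator {0<..a + b} s * g s - indicator {0<..b} s * g s \<partial>lborel)"
      using a b by (intro Bochner_Integration.integral_cong) (auto split: split_indicator)
    also have "\<dots> = G (a + b) - G b"
      unfolding G_def by (intro Bochner_Integration.integral_diff int)
    finally show ?thesis .
  qed
  show ?thesis
    unfolding right_diff_distrib avg[OF r] avg[OF h] shift[OF r h] shift[OF h r]
    by (simp add: add.commute)
qed

text \<open>The time increment of an average is itself an average, over the increment
  \<open>h\<close>, of p_r w - w divided by r. This gives a Lipschitz bound in time and, as h tends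
  to 0, the function that D_1 assigns as generator.\<close>

lemma ptf_avg_diff:
  assumes r: "0 < r" and h: "0 < h" and w: "w \<in> borel_measurable borel" "\<And>x. \<bar>w x\<bar> \<le> c"
  shows "ptf p h (avg r w) x - avg r w x = (h / r) * (avg h (ptf p r w) x - avg h w x)"
  using avg_exchange[OF assms] avg_ptf[OF r less_imp_le[OF h] w] r by (simp add: field_simps)

text \<open>Jensen in time, then Tonelli. The choice b = 0 gives square integrability of averages, b
  = w their convergence.\<close>

lemma nn_avg_dist:
  assumes r: "0 < r" and w[measurable]: "w \<in> borel_measurable borel" "\<And>x. \<bar>w x\<bar> \<le> c"
    and b[measurable]: "b \<in> borel_measurable borel" "\<And>x. \<bar>b x\<bar> \<le> d"
  shows "(\<integral>\<^sup>+x. ennreal ((avg r w x - b x)\<^sup>2) \<partial>m)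
    \<le> (\<integral>\<^sup>+s. \<integral>\<^sup>+x. ennreal ((ptf p (max 0 s) w x - b x)\<^sup>2) \<partial>m \<partial>unif r)"
proof -
  interpret U: prob_space "unif r" by (rule prob_space_unif[OF r])
  interpret pair_sigma_finite "unif r" m ..
  have "ennreal ((avg r w x - b x)\<^sup>2) \<le> (\<integral>\<^sup>+s. ennreal ((ptf p (max 0 s) w x - b x)\<^sup>2) \<partial>unif r)" for x
  proof -
    have bd: "\<bar>ptf p (max 0 s) w x - b x\<bar> \<le> c + d" for s
      using ptf_bound[of "max 0 s" w c x] w(2) b(2)[of x] by (simp add: abs_le_iff)
    have i1: "integrable (unif r) (\<lambda>s. ptf p (max 0 s) w x - b x)"
      using ptf_unif_integrable[OF r w] by simp
    have "(ptf p (max 0 s) w x - b x)\<^sup>2 \<le> (c + d)\<^sup>2" for s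
      using bd[of s] by (metis abs_ge_zero abs_le_square_iff abs_of_nonneg order_trans)
    then have i2: "integrable (unif r) (\<lambda>s. (ptf p (max 0 s) w x - b x)\<^sup>2)"
      using i1 by (intro U.integrable_const_bound[where B = "(c + d)\<^sup>2"]) auto
    have "avg r w x - b x = (\<integral>s. ptf p (max 0 s) w x - b x \<partial>unif r)"
      unfolding avg_def using ptf_unif_integrable[OF r w] U.prob_space by simp
    then have "(avg r w x - b x)\<^sup>2 \<le> (\<integral>s. (ptf p (max 0 s) w x - b x)\<^sup>2 \<partial>unif r)"
      using U.square_expectation_le[OF i1 i2] by simp
    then show ?thesis using i2 by (simp add: nn_integral_eq_integral ennreal_leI)
  qed
  then have "(\<integral>\<^sup>+x. ennreal ((avg r w x - b x)\<^sup>2) \<partial>m)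
      \<le> (\<integral>\<^sup>+x. \<integral>\<^sup>+s. ennreal ((ptf p (max 0 s) w x - b x)\<^sup>2) \<partial>unif r \<partial>m)"
    by (intro nn_integral_mono)
  also have "\<dots> = (\<integral>\<^sup>+s. \<integral>\<^sup>+x. ennreal ((ptf p (max 0 s) w x - b x)\<^sup>2) \<partial>m \<partial>unif r)"
  proof -
    have "sets (unif r \<Otimes>\<^sub>M m) = sets (borel \<Otimes>\<^sub>M borel)"
      by (intro sets_pair_measure_cong m_sets sets_unif)
    then have "(\<lambda>z. ennreal ((ptf p (max 0 (fst z)) w (snd z) - b (snd z))\<^sup>2)) \<in> borel_measurable (unif r \<Otimes>\<^sub>M m)"
      by (simp cong: measurable_cong_sets)
    from Fubini[OF this] show ?thesis by simp
  qed
  finally show ?thesis .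
qed

lemma nn_L2inner: "g \<in> L2 m \<Longrightarrow> (\<integral>\<^sup>+x. ennreal ((g x)\<^sup>2) \<partial>m) = ennreal (L2inner m g g)"
  using L2_square_integrable[of g m] by (simp add: L2inner_def nn_integral_eq_integral power2_eq_square)

lemma avg_L2:
  assumes r: "0 < r" and w: "w \<in> L2 m" "\<And>x. \<bar>w x\<bar> \<le> c"
  shows "avg r w \<in> L2 m"
proof -
  have wm: "w \<in> borel_measurable borel" using w(1) by (simp add: L2_def)
  interpret U: prob_space "unif r" by (rule prob_space_unif[OF r])
  have "(\<integral>\<^sup>+x. ennreal ((avg r w x)\<^sup>2) \<partial>m) \<le> (\<integral>\<^sup>+s. \<integral>\<^sup>+x. ennreal ((ptf p (max 0 s) w x)\<^sup>2) \<partial>m \<partial>unif r)"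
    using nn_avg_dist[OF r wm w(2), of "\<lambda>x. 0" 0] by simp
  also have "\<dots> \<le> (\<integral>\<^sup>+s. ennreal (L2inner m w w) \<partial>unif r)"
    using ptf_contraction[OF _ w] by (intro nn_integral_mono) (simp add: nn_L2inner ptf_L2[OF _ w] ennreal_leI)
  also have "\<dots> = ennreal (L2inner m w w)" by (simp add: U.emeasure_space_1[simplified])
  finally have "(\<integral>\<^sup>+x. ennreal ((avg r w x)\<^sup>2) \<partial>m) < \<infinity>" by (simp add: le_less_trans)
  then show ?thesis using r wm by (auto simp: L2_def intro!: integrableI_nonneg)
qed

lemma ptf_continuous:
  assumes w: "w \<in> L2 m" "\<And>x. \<bar>w x\<bar> \<le> c"
  shows "((\<lambda>s. L2inner m (\<lambda>x. ptf p (max 0 s) w x - w x) (\<lambda>x. ptf p (max 0 s) w x - w x)) \<longlongrightarrow> 0) (at_right 0)"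
proof -
  have "((\<lambda>s. L2norm m (\<lambda>x. T s w x - w x)) \<longlongrightarrow> 0) (at_right 0)"
    using semigroup w(1) unfolding strongly_continuous_semigroup_def by blast
  then have "((\<lambda>s. (L2norm m (\<lambda>x. T s w x - w x))\<^sup>2) \<longlongrightarrow> 0\<^sup>2) (at_right 0)" by (rule tendsto_power)
  then have lim: "((\<lambda>s. (L2norm m (\<lambda>x. T s w x - w x))\<^sup>2) \<longlongrightarrow> 0) (at_right 0)" by (simp only: zero_power2)
  have "\<forall>\<^sub>F s in at_right 0. (L2norm m (\<lambda>x. T s w x - w x))\<^sup>2
      = L2inner m (\<lambda>x. ptf p (max 0 s) w x - w x) (\<lambda>x. ptf p (max 0 s) w x - w x)"
    using eventually_at_right_less[of 0]
  proof eventually_elim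
    case (elim s)
    then have s: "0 \<le> s" "max 0 s = s" by auto
    show ?case
      unfolding L2norm_power2[OF L2_diff_closed[OF T_L2[OF s(1) w(1)] w(1)]] s(2)
      using T_AE[OF s(1) w]
      by (intro L2inner_cong_AE L2_measurable L2_diff_closed T_L2 ptf_L2[OF s(1) w] s w(1)) auto
  qed
  then show ?thesis by (rule Lim_transform_eventually[OF lim])
qed

text \<open>Strong continuity makes p_s w close to w for all small s, and \<open>nn_avg_dist\<close>
  averages this closeness.\<close>

lemma avg_tendsto:
  assumes w: "w \<in> L2 m" "\<And>x. \<bar>w x\<bar> \<le> c"
  shows "(\<lambda>n. L2inner m (\<lambda>x. avg (1 / real (Suc n)) w x - w x) (\<lambda>x. avg (1 / real (Suc n)) w x - w x)) \<longlonglongrightarrow> 0"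
proof (rule LIMSEQ_I)
  fix e :: real assume e: "0 < e"
  have wm: "w \<in> borel_measurable borel" using w(1) by (simp add: L2_def)
  let ?q = "\<lambda>s. L2inner m (\<lambda>x. ptf p (max 0 s) w x - w x) (\<lambda>x. ptf p (max 0 s) w x - w x)"
  let ?D = "\<lambda>n x. avg (1 / real (Suc n)) w x - w x"
  have D: "?D n \<in> L2 m" for n by (intro L2_diff_closed avg_L2[OF _ w] w(1)) auto
  have "\<forall>\<^sub>F s in at_right 0. ?q s < e / 2"
    using order_tendstoD(2)[OF ptf_continuous[OF w], of "e / 2"] e by simp
  then obtain b where b: "0 < b" "\<And>s. 0 < s \<Longrightarrow> s < b \<Longrightarrow> ?q s < e / 2"
    unfolding eventually_at_right_field by blast
  obtain N where N: "1 / real (Suc N) < b" using nat_approx_posE[OF b(1)] by blast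
  have "L2inner m (?D n) (?D n) \<le> e / 2" if "n \<ge> N" for n
  proof -
    let ?r = "1 / real (Suc n)"
    have "?r \<le> 1 / real (Suc N)" using that by (intro divide_left_mono) auto
    then have r: "0 < ?r" "?r < b" using N by (simp, linarith)
    interpret U: prob_space "unif ?r" by (rule prob_space_unif[OF r(1)])
    have "ennreal (L2inner m (?D n) (?D n)) \<le> (\<integral>\<^sup>+s. \<integral>\<^sup>+x. ennreal ((ptf p (max 0 s) w x - w x)\<^sup>2) \<partial>m \<partial>unif ?r)"
      unfolding nn_L2inner[OF D, symmetric] by (rule nn_avg_dist[OF r(1) wm w(2) wm w(2)])
    also have "\<dots> = (\<integral>\<^sup>+s. ennreal (?q s) \<partial>unif ?r)"
      by (simp add: nn_L2inner L2_diff_closed ptf_L2[OF _ w] w(1))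
    also have "\<dots> \<le> (\<integral>\<^sup>+s. ennreal (e / 2) \<partial>unif ?r)"
    proof (rule nn_integral_mono_AE, rule eventually_mono[OF AE_unif[OF r(1)]])
      fix s assume "0 < s \<and> s \<le> ?r"
      then have "?q s < e / 2" using b(2)[of s] r(2) by linarith
      then show "ennreal (?q s) \<le> ennreal (e / 2)" by (intro ennreal_leI less_imp_le)
    qed
    also have "\<dots> = ennreal (e / 2)" using U.emeasure_space_1 by simp
    finally show ?thesis using e by (simp add: ennreal_le_iff)
  qed
  then show "\<exists>N. \<forall>n\<ge>N. norm (L2inner m (?D n) (?D n) - 0) < e"
    using e L2.nonneg[OF D] by (intro exI[of _ N]) fastforce
qed

lemma nn_avg:
  assumes r: "0 < r" and w[measurable]: "w \<in> borel_measurable borel" "\<And>x. 0 \<le> w x" "\<And>x. w x \<le> c"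
  shows "(\<integral>\<^sup>+x. ennreal (avg r w x) \<partial>m) = (\<integral>\<^sup>+x. ennreal (w x) \<partial>m)"
proof -
  interpret U: prob_space "unif r" by (rule prob_space_unif[OF r])
  interpret pair_sigma_finite "unif r" m ..
  have b: "\<bar>w x\<bar> \<le> c" for x using w(2,3)[of x] by simp
  have "(\<integral>\<^sup>+x. ennreal (avg r w x) \<partial>m) = (\<integral>\<^sup>+x. \<integral>\<^sup>+s. ennreal (ptf p (max 0 s) w x) \<partial>unif r \<partial>m)"
    unfolding avg_def using ptf_unif_integrable[OF r w(1) b]
    by (intro nn_integral_cong) (simp add: nn_integral_eq_integral ptf_nonneg w)
  also have "\<dots> = (\<integral>\<^sup>+s. \<integral>\<^sup>+x. ennreal (ptf p (max 0 s) w x) \<partial>m \<partial>unif r)"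
  proof -
    have "sets (unif r \<Otimes>\<^sub>M m) = sets (borel \<Otimes>\<^sub>M borel)"
      by (intro sets_pair_measure_cong m_sets sets_unif)
    then have "(\<lambda>z. ennreal (ptf p (max 0 (fst z)) w (snd z))) \<in> borel_measurable (unif r \<Otimes>\<^sub>M m)"
      by (simp cong: measurable_cong_sets)
    from Fubini[OF this] show ?thesis by simp
  qed
  also have "\<dots> = (\<integral>\<^sup>+x. ennreal (w x) \<partial>m)"
    by (simp add: ptf_invariant[OF _ w] U.emeasure_space_1[simplified])
  finally show ?thesis .
qed

section \<open>Stability of the class D under the kernel and time averages\<close>

lemma Dset_bound:
  assumes "u \<in> Dset m"
  shows "\<exists>c. \<forall>x. u x \<le> c \<and> \<bar>u x\<bar> \<le> c"
proof -
  obtain c where "\<forall>y\<in>range u. norm y \<le> c" using assms unfolding Dset_def bounded_iff by blast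
  then have c: "\<bar>u x\<bar> \<le> c" for x by simp
  then have "u x \<le> c" for x by (metis abs_le_D1)
  with c show ?thesis by blast
qed

lemma DsetD:
  assumes "u \<in> Dset m"
  shows "u \<in> borel_measurable borel" "\<And>x. 0 \<le> u x" "(\<integral>\<^sup>+x. ennreal (u x) \<partial>m) < \<infinity>" "u \<in> L2 m"
proof -
  show *: "u \<in> borel_measurable borel" "\<And>x. 0 \<le> u x" "(\<integral>\<^sup>+x. ennreal (u x) \<partial>m) < \<infinity>"
    using assms by (auto simp: Dset_def)
  obtain c where c: "\<And>x. u x \<le> c" "\<And>x. \<bar>u x\<bar> \<le> c" using Dset_bound[OF assms] by blast
  show "u \<in> L2 m" using * by (intro bounded_L2_if_integrable[OF _ _ c(1)]) auto
qed

lemma DsetI: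
  assumes "u \<in> borel_measurable borel" "\<And>x. 0 \<le> u x" "\<And>x. u x \<le> c" "(\<integral>\<^sup>+x. ennreal (u x) \<partial>m) < \<infinity>"
  shows "u \<in> Dset m"
  using assms unfolding Dset_def bounded_iff by auto

lemma ptf_Dset:
  assumes t: "0 \<le> t" and u: "u \<in> Dset m"
  shows "ptf p t u \<in> Dset m"
proof -
  obtain c where c: "\<And>x. u x \<le> c" "\<And>x. \<bar>u x\<bar> \<le> c" using Dset_bound[OF u] by blast
  show ?thesis
    using ptf_invariant[OF t DsetD(1,2)[OF u] c(1)] DsetD(3)[OF u] ptf_le[OF t DsetD(2)[OF u] c(1)]
    by (intro DsetI[of _ c] ptf_measurable ptf_nonneg DsetD[OF u] t) auto
qed

lemma avg_Dset:
  assumes r: "0 < r" and u: "u \<in> Dset m"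
  shows "avg r u \<in> Dset m"
proof -
  obtain c where c: "\<And>x. u x \<le> c" "\<And>x. \<bar>u x\<bar> \<le> c" using Dset_bound[OF u] by blast
  have "\<bar>avg r u x\<bar> \<le> c" for x by (rule avg_bound[OF r c(2)])
  then have "avg r u x \<le> c" for x by (metis abs_le_D1)
  then show ?thesis
    using nn_avg[OF r DsetD(1,2)[OF u] c(1)] DsetD(3)[OF u]
    by (intro DsetI[of _ c] avg_measurable avg_nonneg DsetD[OF u] r) auto
qed

end

subsection \<open>Comparison of the rate functional with the approximating forms\<close>

text \<open>The difference of the sides is a square over z w. Each term on the right is written as a
  factor for one point times a factor for the other, the shape \<open>nn_form_sym\<close> can
  swap.\<close>

lemma weighted_AM_GM:
  fixes a b z w :: real
  assumes "0 < z" "0 < w"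
  shows "2 * (a * b) \<le> a\<^sup>2 / z * w + z * (b\<^sup>2 / w)"
proof -
  have "a\<^sup>2 / z * w + z * (b\<^sup>2 / w) - 2 * (a * b) = (a * w - b * z)\<^sup>2 / (z * w)"
    using assms by (simp add: field_simps power2_eq_square)
  also have "0 \<le> \<dots>" using assms by simp
  finally show ?thesis by simp
qed

lemma integrable_square_mult:
  assumes f: "f \<in> L2 M" and [measurable]: "g \<in> borel_measurable M" and b: "\<And>x. \<bar>g x\<bar> \<le> c"
  shows "integrable M (\<lambda>x. (f x)\<^sup>2 * g x)"
proof (rule Bochner_Integration.integrable_bound)
  have [measurable]: "f \<in> borel_measurable M" using f by (rule L2_measurable)
  show "integrable M (\<lambda>x. c * (f x)\<^sup>2)" using L2_square_integrable[OF f] by simp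
  have "\<bar>(f x)\<^sup>2 * g x\<bar> \<le> \<bar>c * (f x)\<^sup>2\<bar>" for x
    using mult_left_mono[OF order_trans[OF b abs_ge_self], of "(f x)\<^sup>2" x] by (simp add: abs_mult mult.commute)
  then show "AE x in M. norm ((f x)\<^sup>2 * g x) \<le> norm (c * (f x)\<^sup>2)" by simp
  show "(\<lambda>x. (f x)\<^sup>2 * g x) \<in> borel_measurable M" by measurable
qed

text \<open>The Riemann sums on the right approximate the integral of a logarithmic derivative.\<close>
lemma telescoping_ratio:
  fixes a V :: "nat \<Rightarrow> real"
  assumes e: "0 < e" and a: "\<And>k. e \<le> a k" and V: "\<And>k. e \<le> V k"
    and da: "\<And>k. \<bar>a k - a (Suc k)\<bar> \<le> d" and dV: "\<And>k. \<bar>V k - a (Suc k)\<bar> \<le> d"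
  shows "1 - a n / a 0 - real n * (d\<^sup>2 / e\<^sup>2) \<le> (\<Sum>k<n. (a k - a (Suc k)) / V k)"
proof -
  have pos: "0 < a k" "0 < V k" for k using e a[of k] V[of k] by linarith+
  have d: "0 \<le> d" using da[of 0] by linarith
  \<comment> \<open>The denominator is moved to \<open>a (Suc k)\<close>, not \<open>a k\<close>:
    only then does ln y \<le> y - 1 with y = a k / a (Suc k) point in the required direction. The
    move costs a product of two differences of size \<open>d\<close> over two denominators of size
    at least \<open>e\<close>.\<close>
  have step: "ln (a k) - ln (a (Suc k)) - d\<^sup>2 / e\<^sup>2 \<le> (a k - a (Suc k)) / V k" for k
  proof -
    have "\<bar>(a k - a (Suc k)) / V k - (a k - a (Suc k)) / a (Suc k)\<bar>
        = \<bar>(a k - a (Suc k)) * (a (Suc k) - V k) / (V k * a (Suc k))\<bar>"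
      using pos[of k] pos[of "Suc k"] by (simp add: field_simps)
    also have "\<dots> = (\<bar>a k - a (Suc k)\<bar> * \<bar>V k - a (Suc k)\<bar>) / (V k * a (Suc k))"
      using pos[of k] pos[of "Suc k"] by (simp add: abs_mult abs_minus_commute)
    also have "\<dots> \<le> (d * d) / (e * e)"
      using e d a V da dV by (intro frac_le mult_mono mult_pos_pos) (auto simp: less_imp_le[OF pos(2)])
    finally have 1: "\<bar>(a k - a (Suc k)) / V k - (a k - a (Suc k)) / a (Suc k)\<bar> \<le> d\<^sup>2 / e\<^sup>2"
      by (simp add: power2_eq_square)
    have "ln (a k / a (Suc k)) \<le> a k / a (Suc k) - 1"
      using pos by (intro ln_le_minus_one) simp
    also have "\<dots> = (a k - a (Suc k)) / a (Suc k)" using pos[of "Suc k"] by (simp add: field_simps)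
    finally have "ln (a k) - ln (a (Suc k)) \<le> (a k - a (Suc k)) / a (Suc k)"
      using pos[of k] pos[of "Suc k"] by (simp add: ln_div)
    with 1 show ?thesis by linarith
  qed
  have "ln (a 0) - ln (a n) - real n * (d\<^sup>2 / e\<^sup>2) \<le> (\<Sum>k<n. (a k - a (Suc k)) / V k)"
  proof (induction n)
    case (Suc n)
    have "ln (a 0) - ln (a (Suc n)) - real (Suc n) * (d\<^sup>2 / e\<^sup>2)
        = (ln (a 0) - ln (a n) - real n * (d\<^sup>2 / e\<^sup>2)) + (ln (a n) - ln (a (Suc n)) - d\<^sup>2 / e\<^sup>2)"
      by (simp add: distrib_right add_divide_distrib)
    also have "\<dots> \<le> (\<Sum>k<n. (a k - a (Suc k)) / V k) + (a n - a (Suc n)) / V n"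
      by (intro add_mono Suc.IH step)
    finally show ?case by simp
  qed simp
  moreover have "ln (a n / a 0) \<le> a n / a 0 - 1" using pos by (intro ln_le_minus_one) simp
  ultimately show ?thesis using pos[of 0] pos[of n] by (simp add: ln_div)
qed

locale density_kernel = reversible_kernel +
  fixes f :: "'a \<Rightarrow> real" and \<mu> :: "'a measure"
  assumes f_L2: "f \<in> L2 m" and f_nonneg: "\<And>x. 0 \<le> f x"
    and mu_eq: "\<mu> = density m (\<lambda>x. ennreal ((f x)\<^sup>2))"
    and mu_prob: "prob_space \<mu>"
begin

sublocale mu: prob_space \<mu> by (rule mu_prob)

lemma f_measurable [measurable]: "f \<in> borel_measurable borel"
  using f_L2 by (simp add: L2_def)

lemma mu_measurable [simp]: "borel_measurable \<mu> = borel_measurable borel"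
  unfolding mu_eq by (simp add: m_sets cong: measurable_cong_sets)

lemma integral_mu:
  "g \<in> borel_measurable borel \<Longrightarrow> (\<integral>x. g x \<partial>\<mu>) = (\<integral>x. (f x)\<^sup>2 * g x \<partial>m)"
  for g :: "'a \<Rightarrow> real"
  unfolding mu_eq by (subst integral_density) auto

lemma AE_mu: "AE x in m. P x \<Longrightarrow> AE x in \<mu>. P x"
  unfolding mu_eq by (subst AE_density) auto

lemma mu_integrable: 
  fixes g :: "'a \<Rightarrow> real"
  shows "g \<in> borel_measurable borel \<Longrightarrow> (\<And>x. \<bar>g x\<bar> \<le> c) \<Longrightarrow> integrable \<mu> g"
  by (intro mu.integrable_const_bound[where B = c]) auto

section \<open>Form bounds imply bounds on the rate functional\<close>

lemma form_le_ratio: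
  assumes h: "0 \<le> h" and z[measurable]: "z \<in> borel_measurable borel"
    and e: "0 < e" "\<And>x. e \<le> z x" and c: "\<And>x. z x \<le> c"
  shows "L2inner m (T h f) f \<le> (\<integral>x. ptf p h z x / z x \<partial>\<mu>)"
proof -
  have zpos: "0 < z x" for x using e(1) e(2)[of x] by linarith
  let ?r = "\<lambda>x. ptf p h z x / z x"
  have r[measurable]: "?r \<in> borel_measurable borel" using h by measurable
  have pz: "0 \<le> ptf p h z x" "ptf p h z x \<le> c" for x
    by (intro ptf_nonneg less_imp_le zpos) (rule ptf_le[OF h less_imp_le[OF zpos] c])
  have rb: "\<bar>?r x\<bar> \<le> c / e" for x
    using pz[of x] zpos[of x] e order_trans[OF e(2)[of x] c[of x]]
    by (auto simp: abs_of_nonneg intro!: frac_le)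
  define I where "I = (\<integral>\<^sup>+x. \<integral>\<^sup>+y. ennreal (f x * f y) \<partial>p h x \<partial>m)"
  define S where "S = (\<integral>\<^sup>+x. \<integral>\<^sup>+y. ennreal ((f x)\<^sup>2 / z x * z y) \<partial>p h x \<partial>m)"
  have S_eq: "S = ennreal (\<integral>x. ?r x \<partial>\<mu>)"
  proof -
    have "S = (\<integral>\<^sup>+x. ennreal ((f x)\<^sup>2 * ?r x) \<partial>m)"
      unfolding S_def using zpos by (subst ennreal_ptf[OF h z _ c]) (auto simp: less_imp_le)
    also have "\<dots> = ennreal (\<integral>x. (f x)\<^sup>2 * ?r x \<partial>m)"
      using pz zpos by (intro nn_integral_eq_integral integrable_square_mult[OF f_L2 _ rb]) (auto simp: less_imp_le)
    finally show ?thesis by (simp add: integral_mu)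
  qed
  have "I + I = (\<integral>\<^sup>+x. \<integral>\<^sup>+y. ennreal (f x * f y) + ennreal (f x * f y) \<partial>p h x \<partial>m)"
    unfolding I_def using h
    by (subst nn_integral_add[symmetric]) (auto simp: kernel_nn_measurable nn_integral_add)
  also have "\<dots> \<le> (\<integral>\<^sup>+x. \<integral>\<^sup>+y. ennreal ((f x)\<^sup>2 / z x * z y) + ennreal (z x * ((f y)\<^sup>2 / z y)) \<partial>p h x \<partial>m)"
    using weighted_AM_GM[OF zpos zpos] zpos f_nonneg
    by (intro nn_integral_mono) (simp add: less_imp_le ennreal_leI flip: ennreal_plus)
  also have "\<dots> = S + (\<integral>\<^sup>+x. \<integral>\<^sup>+y. ennreal (z x * ((f y)\<^sup>2 / z y)) \<partial>p h x \<partial>m)"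
    unfolding S_def using h kernel_nn_measurable[OF h, of "\<lambda>x. (f x)\<^sup>2 / z x" z]
      kernel_nn_measurable[OF h, of z "\<lambda>x. (f x)\<^sup>2 / z x"]
    by (subst nn_integral_add[symmetric]) (auto simp: nn_integral_add)
  \<comment> \<open>Reversibility exchanges the two points, so both halves of the weighted
    inequality integrate to the same \<open>S\<close>.\<close>
  also have "(\<integral>\<^sup>+x. \<integral>\<^sup>+y. ennreal (z x * ((f y)\<^sup>2 / z y)) \<partial>p h x \<partial>m) = S"
    unfolding S_def using zpos by (intro nn_form_sym h) (auto simp: less_imp_le)
  finally have "I + I \<le> S + S" .
  moreover have "I = ennreal (L2inner m (T h f) f)"
    unfolding I_def by (rule nn_form_eq[OF h f_L2 f_nonneg])
  moreover have "0 \<le> (\<integral>x. ?r x \<partial>\<mu>)" using pz zpos by (intro Bochner_Integration.integral_nonneg) (simp add: less_imp_le)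
  ultimately show ?thesis
    by (cases "0 \<le> L2inner m (T h f) f") (auto simp: S_eq simp flip: ennreal_plus)
qed

lemma L2inner_f: "L2inner m f f = 1"
  using integral_mu[of "\<lambda>x. 1"] mu.prob_space by (simp add: L2inner_def power2_eq_square)

text \<open>With z = v + e and g = w - p_t w, \<open>ptf_avg_diff\<close> gives (1 - p_h z / z) / h
  = avg h g / (t z). The integral of the left side is at most the form quotient at h, and the right
  side tends to g / (t z), the negated integrand of the functional.\<close>

lemma rate_functional_le:
  assumes bound: "\<And>h. 0 < h \<Longrightarrow> L2inner m f f - L2inner m (T h f) f \<le> h * C"
    and u: "u \<in> Dset m" and t: "0 < t" and eta: "0 \<le> \<eta>" and e: "0 < e"
  shows "- (\<integral>x. D1Lv p u t \<eta> x / (D1v p u t \<eta> x + e) \<partial>\<mu>) \<le> C"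
proof -
  define w where "w = ptf p \<eta> u"
  define z where "z = (\<lambda>x. avg t w x + e)"
  have z_app: "z x = avg t w x + e" for x by (simp add: z_def)
  define g where "g x = w x - ptf p t w x" for x
  have wD: "w \<in> Dset m" unfolding w_def by (rule ptf_Dset[OF eta u])
  obtain c where c: "\<And>x. w x \<le> c" "\<And>x. \<bar>w x\<bar> \<le> c" using Dset_bound[OF wD] by blast
  note w = DsetD[OF wD]
  note [measurable] = w(1)
  have pw: "ptf p t w \<in> Dset m" using t by (intro ptf_Dset wD) simp
  have pwb: "\<bar>ptf p t w x\<bar> \<le> c" for x using t by (intro ptf_bound c) simp
  note [measurable] = DsetD(1)[OF pw]
  have g: "g \<in> L2 m" "\<bar>g x\<bar> \<le> 2 * c" for x
    using L2_diff_closed[OF w(4) DsetD(4)[OF pw]] c(2)[of x] pwb[of x] by (auto simp: g_def[abs_def])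
  have gm[measurable]: "g \<in> borel_measurable borel" unfolding g_def by measurable
  have v[measurable]: "avg t w \<in> borel_measurable borel" using t by measurable
  have vb: "\<bar>avg t w x\<bar> \<le> c" "0 \<le> avg t w x" for x
    by (auto intro!: avg_bound avg_nonneg t c w)
  have zm[measurable]: "z \<in> borel_measurable borel" unfolding z_def by measurable
  have zb: "e \<le> z x" "z x \<le> c + e" for x using vb[of x] by (auto simp: z_app abs_le_iff)
  have zpos: "0 < z x" for x using zb(1)[of x] e by linarith
  have bd: "\<bar>k x / (t * z x)\<bar> \<le> 2 * c / (t * e)" if "\<And>x. \<bar>k x\<bar> \<le> 2 * c" for k :: "'a \<Rightarrow> real" and x
    using that[of x] t e zb(1)[of x] zpos[of x] by (auto simp: abs_mult intro!: frac_le)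
  have int_le: "(\<integral>x. avg h g x / (t * z x) \<partial>\<mu>) \<le> C" if h: "0 < h" for h
  proof -
    have "avg h g x / (t * z x) = (1 - ptf p h z x / z x) / h" for x
    proof -
      have "ptf p h z x = ptf p h (avg t w) x + e"
        unfolding z_def by (rule ptf_add_const[OF less_imp_le[OF h] v vb(1)])
      also have "ptf p h (avg t w) x = avg t w x + (h / t) * (avg h (ptf p t w) x - avg h w x)"
        using ptf_avg_diff[OF t h w(1) c(2), of x] by simp
      also have "avg h (ptf p t w) x - avg h w x = - avg h g x"
        unfolding g_def by (subst avg_diff[OF h w(1) c(2) DsetD(1)[OF pw] pwb]) simp
      finally have "ptf p h z x = z x - (h / t) * avg h g x" unfolding z_app by simp
      then show ?thesis using h t zpos[of x] by (simp add: field_simps)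
    qed
    then have "(\<integral>x. avg h g x / (t * z x) \<partial>\<mu>) = (\<integral>x. 1 - ptf p h z x / z x \<partial>\<mu>) / h"
      by simp
    also have "(\<integral>x. 1 - ptf p h z x / z x \<partial>\<mu>) = 1 - (\<integral>x. ptf p h z x / z x \<partial>\<mu>)"
    proof -
      have pz: "0 \<le> ptf p h z x" "ptf p h z x \<le> c + e" for x
        by (intro ptf_nonneg less_imp_le zpos) (rule ptf_le[OF less_imp_le[OF h] less_imp_le[OF zpos] zb(2)])
      have "\<bar>ptf p h z x / z x\<bar> \<le> (c + e) / e" for x
        using pz[of x] zpos[of x] e zb(1) order_trans[OF zb(1)[of x] zb(2)[of x]] by (auto intro!: frac_le)
      then have "integrable \<mu> (\<lambda>x. ptf p h z x / z x)"
        using h by (intro mu_integrable) auto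
      then show ?thesis by (simp add: mu.prob_space)
    qed
    also have "\<dots> \<le> L2inner m f f - L2inner m (T h f) f"
      using form_le_ratio[OF less_imp_le[OF h] zm e zb] L2inner_f by simp
    also have "\<dots> \<le> h * C" by (rule bound[OF h])
    finally show ?thesis using h by (simp add: divide_right_mono field_simps)
  qed
  \<comment> \<open>The averages converge only in L2; the pointwise convergence needed under \<mu>
    comes from a subsequence and from \<mu> having a density.\<close>
  obtain r :: "nat \<Rightarrow> nat" where r: "strict_mono r"
    and lim: "AE x in m. (\<lambda>n. avg (1 / real (Suc (r n))) g x) \<longlonglongrightarrow> g x"
    using L2_tendsto_AE_subseq[OF _ g(1) avg_tendsto[OF g]] avg_L2[OF _ g] by auto
  have "(\<lambda>n. \<integral>x. avg (1 / real (Suc (r n))) g x / (t * z x) \<partial>\<mu>) \<longlonglongrightarrow> (\<integral>x. g x / (t * z x) \<partial>\<mu>)"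
  proof (rule integral_dominated_convergence[where w = "\<lambda>x. 2 * c / (t * e)"])
    show "AE x in \<mu>. (\<lambda>n. avg (1 / real (Suc (r n))) g x / (t * z x)) \<longlonglongrightarrow> g x / (t * z x)"
      using AE_mu[OF lim]
    proof eventually_elim
      case (elim x)
      then show ?case using t zpos[of x] by (intro tendsto_divide tendsto_const) auto
    qed
    show "AE x in \<mu>. norm (avg (1 / real (Suc (r n))) g x / (t * z x)) \<le> 2 * c / (t * e)" for n
    proof -
      have "\<bar>avg (1 / real (Suc (r n))) g y\<bar> \<le> 2 * c" for y by (rule avg_bound[OF _ g(2)]) simp
      then show ?thesis unfolding real_norm_def by (intro AE_I2 bd)
    qed
    show "(\<lambda>x. avg (1 / real (Suc (r n))) g x / (t * z x)) \<in> borel_measurable \<mu>" for n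
    proof -
      have "0 < 1 / real (Suc (r n))" by simp
      note [measurable] = avg_measurable[OF this gm]
      show ?thesis by simp
    qed
  qed simp_all
  then have "(\<integral>x. g x / (t * z x) \<partial>\<mu>) \<le> C"
    by (rule LIMSEQ_le_const2) (use int_le in auto)
  moreover have "D1Lv p u t \<eta> x / (D1v p u t \<eta> x + e) = - (g x / (t * z x))" for x
    using t zpos[of x] DsetD(1)[OF u]
    by (simp add: D1Lv_def D1v_eq_avg[OF t eta] g_def z_app w_def divide_simps)
  ultimately show ?thesis by simp
qed

section \<open>A bounded rate functional bounds the forms\<close>

context
  fixes C :: real
  assumes rate: "\<And>u t \<eta> e. u \<in> Dset m \<Longrightarrow> 0 < t \<Longrightarrow> 0 \<le> \<eta> \<Longrightarrow> 0 < e \<Longrightarrow>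
    - (\<integral>x. D1Lv p u t \<eta> x / (D1v p u t \<eta> x + e) \<partial>\<mu>) \<le> C"
begin

text \<open>The interval [0, t] is cut into n steps of length h, and the rate bound is used for the
  average over h started at \<eta> = k h. The n inequalities, each weighted by h, add up to t C and
  are compared with the logarithmic increment by \<open>telescoping_ratio\<close>.\<close>

lemma ratio_le_lipschitz:
  assumes u: "u \<in> Dset m" and t: "0 < t" and e: "0 < e"
    and lip: "\<And>s h x. 0 \<le> s \<Longrightarrow> 0 \<le> h \<Longrightarrow> \<bar>ptf p (s + h) u x - ptf p s u x\<bar> \<le> K * h"
  shows "(\<integral>x. 1 - (ptf p t u x + e) / (u x + e) \<partial>\<mu>) \<le> t * C"
proof -
  note um[measurable] = DsetD(1)[OF u]
  obtain c where c: "\<And>x. u x \<le> c" "\<And>x. \<bar>u x\<bar> \<le> c" using Dset_bound[OF u] by blast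
  have K: "0 \<le> K" using lip[of 0 1 undefined] by simp
  have pt: "0 \<le> ptf p s u x" "ptf p s u x \<le> c" if "0 \<le> s" for s x
    using that by (auto intro!: ptf_nonneg ptf_le DsetD(2)[OF u] c)
  have step: "(\<integral>x. 1 - (ptf p t u x + e) / (u x + e) \<partial>\<mu>) - K\<^sup>2 * t\<^sup>2 / e\<^sup>2 * (1 / real (Suc j)) \<le> t * C" for j
  proof -
    define n where "n = Suc j"
    define h where "h = t / real n"
    have h: "0 < h" using t by (simp add: h_def n_def)
    have nh: "real n * h = t" by (simp add: h_def n_def)
    define a where "a x k = ptf p (real k * h) u x + e" for x k
    define V where "V x k = avg h (ptf p (real k * h) u) x + e" for x k
    have kh: "0 \<le> real k * h" for k using h by simp
    note [measurable] = ptf_measurable[OF kh um] avg_measurable[OF h ptf_measurable[OF kh um]]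
    have a_ge: "e \<le> a x k" for x k using pt(1)[OF kh] by (simp add: a_def)
    have V_ge: "e \<le> V x k" for x k unfolding V_def by (simp add: avg_nonneg pt(1)[OF kh])
    have Suc_h: "real (Suc k) * h = real k * h + h" for k by (simp add: distrib_right)
    have da: "\<bar>a x k - a x (Suc k)\<bar> \<le> K * h" for x k
      using lip[OF kh less_imp_le[OF h], of k x] unfolding a_def Suc_h by (simp add: abs_minus_commute)
    \<comment> \<open>For s in (0, h] the time k h + s precedes (k + 1) h by at most h, so the
      Lipschitz bound holds for every value being averaged.\<close>
    have dV: "\<bar>V x k - a x (Suc k)\<bar> \<le> K * h" for x k
    proof -
      interpret U: prob_space "unif h" by (rule prob_space_unif[OF h])
      let ?X = "\<lambda>s. ptf p (max 0 s) (ptf p (real k * h) u) x"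
      have pb: "\<bar>ptf p (real k * h) u y\<bar> \<le> c" for y using pt[OF kh, of k y] by simp
      have int: "integrable (unif h) ?X"
        by (rule ptf_unif_integrable[OF h ptf_measurable[OF kh um] pb])
      have AE: "AE s in unif h. \<bar>?X s - ptf p (real k * h + h) u x\<bar> \<le> K * h"
        using AE_unif[OF h]
      proof eventually_elim
        case (elim s)
        then have s: "max 0 s = s" "0 \<le> s" "s \<le> h" by auto
        have "?X s = ptf p (real k * h + s) u x"
          unfolding s(1) using ptf_add[OF s(2) kh um c(2), of k x] by (simp add: add.commute)
        moreover have "\<bar>ptf p ((real k * h + s) + (h - s)) u x - ptf p (real k * h + s) u x\<bar> \<le> K * (h - s)"
          using s kh[of k] by (intro lip) auto
        moreover have "K * (h - s) \<le> K * h" using s K by (intro mult_left_mono) auto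
        ultimately show ?case by (simp add: abs_minus_commute)
      qed
      have "\<bar>U.expectation (\<lambda>s. ?X s - ptf p (real k * h + h) u x)\<bar> \<le> K * h"
      proof (rule abs_leI)
        show "U.expectation (\<lambda>s. ?X s - ptf p (real k * h + h) u x) \<le> K * h"
          using int AE by (intro U.integral_le_const) (auto elim: eventually_mono)
        have "- (K * h) \<le> U.expectation (\<lambda>s. ?X s - ptf p (real k * h + h) u x)"
          using int AE by (intro U.integral_ge_const) (auto elim: eventually_mono)
        then show "- U.expectation (\<lambda>s. ?X s - ptf p (real k * h + h) u x) \<le> K * h" by simp
      qed
      then show ?thesis using int unfolding V_def a_def avg_def Suc_h by (simp add: U.prob_space[simplified])
    qed
    have sum_le: "1 - a x n / a x 0 - real n * ((K * h)\<^sup>2 / e\<^sup>2) \<le> (\<Sum>k<n. (a x k - a x (Suc k)) / V x k)" for x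
      by (rule telescoping_ratio[where a = "a x" and V = "V x", OF e a_ge V_ge da dV])
    have ratio_int: "integrable \<mu> (\<lambda>x. (a x k - a x (Suc k)) / V x k)" for k
    proof (rule mu_integrable)
      show "(\<lambda>x. (a x k - a x (Suc k)) / V x k) \<in> borel_measurable borel" unfolding a_def V_def by measurable
      show "\<bar>(a x k - a x (Suc k)) / V x k\<bar> \<le> K * h / e" for x
        using da[of x k] V_ge[of x k] e K h by (auto intro!: frac_le)
    qed
    have ratio_le: "(\<integral>x. (a x k - a x (Suc k)) / V x k \<partial>\<mu>) \<le> h * C" for k
    proof -
      have "D1Lv p u h (real k * h) x / (D1v p u h (real k * h) x + e)
          = (- 1 / h) * ((a x k - a x (Suc k)) / V x k)" for x
        using ptf_add[OF less_imp_le[OF h] kh um c(2), of k x] h V_ge[of x k] e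
        unfolding D1Lv_def D1v_eq_avg[OF h kh um] a_def V_def Suc_h
        by (simp add: add.commute divide_simps)
      then have "- ((- 1 / h) * (\<integral>x. (a x k - a x (Suc k)) / V x k \<partial>\<mu>)) \<le> C"
        using rate[OF u h kh e, of k] by (simp only: integral_mult_right_zero)
      then show ?thesis using h by (simp add: field_simps)
    qed
    have int0: "integrable \<mu> (\<lambda>x. 1 - a x n / a x 0)"
    proof (rule mu_integrable)
      show "(\<lambda>x. 1 - a x n / a x 0) \<in> borel_measurable borel" unfolding a_def by measurable
      have ratio_b: "\<bar>a x n / a x 0\<bar> \<le> (c + e) / e" for x
        using pt(2)[OF kh, of n x] a_ge[of x n] a_ge[of x 0] e unfolding a_def by (auto intro!: frac_le)
      show "\<bar>1 - a x n / a x 0\<bar> \<le> 1 + (c + e) / e" for x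
        using ratio_b[of x] by linarith
    qed
    have "(\<integral>x. 1 - a x n / a x 0 \<partial>\<mu>) - real n * ((K * h)\<^sup>2 / e\<^sup>2)
        = (\<integral>x. 1 - a x n / a x 0 - real n * ((K * h)\<^sup>2 / e\<^sup>2) \<partial>\<mu>)"
      using int0 by (simp add: mu.prob_space)
    also have "\<dots> \<le> (\<integral>x. (\<Sum>k<n. (a x k - a x (Suc k)) / V x k) \<partial>\<mu>)"
      using int0 ratio_int sum_le by (intro integral_mono) auto
    also have "\<dots> = (\<Sum>k<n. \<integral>x. (a x k - a x (Suc k)) / V x k \<partial>\<mu>)"
      using ratio_int by (rule Bochner_Integration.integral_sum)
    also have "\<dots> \<le> (\<Sum>k<n. h * C)" by (intro sum_mono ratio_le)
    also have "\<dots> = t * C" using nh by (simp add: mult.assoc[symmetric])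
    finally have "(\<integral>x. 1 - a x n / a x 0 \<partial>\<mu>) - real n * ((K * h)\<^sup>2 / e\<^sup>2) \<le> t * C" .
    \<comment> \<open>The n errors are quadratic in h = t / n, so their sum is of order 1 /
      n.\<close>
    moreover have "real n * ((K * h)\<^sup>2 / e\<^sup>2) = K\<^sup>2 * t\<^sup>2 / e\<^sup>2 * (1 / real (Suc j))"
      unfolding h_def n_def by (simp add: power_mult_distrib power_divide power2_eq_square mult_ac)
    moreover have "a x n = ptf p t u x + e" "a x 0 = u x + e" for x
      unfolding a_def nh by (simp_all add: ptf_0)
    ultimately show ?thesis by simp
  qed
  have "(\<lambda>j. (\<integral>x. 1 - (ptf p t u x + e) / (u x + e) \<partial>\<mu>) - K\<^sup>2 * t\<^sup>2 / e\<^sup>2 * (1 / real (Suc j)))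
      \<longlonglongrightarrow> (\<integral>x. 1 - (ptf p t u x + e) / (u x + e) \<partial>\<mu>) - K\<^sup>2 * t\<^sup>2 / e\<^sup>2 * 0"
    by (intro tendsto_intros LIMSEQ_Suc[OF lim_1_over_n])
  then show ?thesis using LIMSEQ_le_const2[of _ "(\<integral>x. 1 - (ptf p t u x + e) / (u x + e) \<partial>\<mu>)" "t * C"] step by simp
qed

text \<open>The uniform bounds and e > 0 keep the ratios bounded, and \<mu> is finite, so dominated
  convergence passes the inequality to almost everywhere limits. It removes first the time averaging
  and then the integrability of u.\<close>

lemma ratio_tendsto:
  fixes v w :: "nat \<Rightarrow> 'a \<Rightarrow> real" and v' w' :: "'a \<Rightarrow> real"
  assumes e: "0 < e" and c: "0 \<le> c"
    and v: "\<And>n. v n \<in> borel_measurable borel" "\<And>n x. 0 \<le> v n x" "\<And>n x. v n x \<le> c"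
    and w: "\<And>n. w n \<in> borel_measurable borel" "\<And>n x. 0 \<le> w n x" "\<And>n x. w n x \<le> c"
    and v': "v' \<in> borel_measurable borel" "\<And>x. 0 \<le> v' x" and w': "w' \<in> borel_measurable borel"
    and lim: "AE x in m. (\<lambda>n. v n x) \<longlonglongrightarrow> v' x" "AE x in m. (\<lambda>n. w n x) \<longlonglongrightarrow> w' x"
    and le: "\<And>n. (\<integral>x. 1 - (w n x + e) / (v n x + e) \<partial>\<mu>) \<le> b"
  shows "(\<integral>x. 1 - (w' x + e) / (v' x + e) \<partial>\<mu>) \<le> b"
proof (rule LIMSEQ_le_const2)
  note [measurable] = v(1) w(1) v'(1) w'(1)
  show "(\<lambda>n. \<integral>x. 1 - (w n x + e) / (v n x + e) \<partial>\<mu>) \<longlonglongrightarrow> (\<integral>x. 1 - (w' x + e) / (v' x + e) \<partial>\<mu>)"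
  proof (rule integral_dominated_convergence[where w = "\<lambda>x. 1 + (c + e) / e"])
    show "AE x in \<mu>. (\<lambda>n. 1 - (w n x + e) / (v n x + e)) \<longlonglongrightarrow> 1 - (w' x + e) / (v' x + e)"
      using AE_mu[OF lim(1)] AE_mu[OF lim(2)]
    proof eventually_elim
      case (elim x)
      then show ?case using e v'(2)[of x] by (intro tendsto_intros) auto
    qed
    show "AE x in \<mu>. norm (1 - (w n x + e) / (v n x + e)) \<le> 1 + (c + e) / e" for n
    proof (intro AE_I2)
      fix x
      have "0 \<le> (w n x + e) / (v n x + e)" using e v(2)[of n x] w(2)[of n x] by simp
      moreover have "(w n x + e) / (v n x + e) \<le> (c + e) / e"
        using e c v(2)[of n x] w(3)[of n x] by (intro frac_le) auto
      ultimately show "norm (1 - (w n x + e) / (v n x + e)) \<le> 1 + (c + e) / e" by simp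
    qed
  qed simp_all
qed (use le in blast)

text \<open>A general \<open>u\<close> need not be Lipschitz along the semigroup, but its average
  over a window of length r is, with constant 2 c / r. The constant disappears from the Lipschitz
  case, so r may tend to 0.\<close>

lemma ratio_le_Dset:
  assumes u: "u \<in> Dset m" and t: "0 < t" and e: "0 < e"
  shows "(\<integral>x. 1 - (ptf p t u x + e) / (u x + e) \<partial>\<mu>) \<le> t * C"
proof -
  note um = DsetD[OF u]
  obtain c where c: "\<And>x. u x \<le> c" "\<And>x. \<bar>u x\<bar> \<le> c" using Dset_bound[OF u] by blast
  have pD: "ptf p t u \<in> Dset m" using t by (intro ptf_Dset u) simp
  have pb: "\<bar>ptf p t u x\<bar> \<le> c" for x using t by (intro ptf_bound c) simp
  let ?X = "\<lambda>n. avg (1 / real (Suc n)) u" and ?Y = "\<lambda>n. avg (1 / real (Suc n)) (ptf p t u)"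
  have r: "0 < 1 / real (Suc n)" for n by simp
  have XL: "?X n \<in> L2 m" for n by (rule avg_L2[OF r um(4) c(2)])
  have YL: "?Y n \<in> L2 m" for n by (rule avg_L2[OF r DsetD(4)[OF pD] pb])
  obtain r1 :: "nat \<Rightarrow> nat" where r1: "strict_mono r1" "AE x in m. (\<lambda>n. ?X (r1 n) x) \<longlonglongrightarrow> u x"
    by (rule L2_tendsto_AE_subseq[OF XL um(4) avg_tendsto[OF um(4) c(2)]])
  \<comment> \<open>Numerator and denominator must converge along a common subsequence, so the
    second one is extracted from the first.\<close>
  obtain r2 :: "nat \<Rightarrow> nat" where r2: "strict_mono r2" "AE x in m. (\<lambda>n. ?Y (r1 (r2 n)) x) \<longlonglongrightarrow> ptf p t u x"
  proof (rule L2_tendsto_AE_subseq[of "\<lambda>n. ?Y (r1 n)", OF YL DsetD(4)[OF pD]])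
    show "(\<lambda>n. L2inner m (\<lambda>x. ?Y (r1 n) x - ptf p t u x) (\<lambda>x. ?Y (r1 n) x - ptf p t u x)) \<longlonglongrightarrow> 0"
      using LIMSEQ_subseq_LIMSEQ[OF avg_tendsto[OF DsetD(4)[OF pD] pb] r1(1)] by (simp add: comp_def)
  qed
  let ?r = "\<lambda>n. 1 / real (Suc (r1 (r2 n)))"
  show ?thesis
  proof (rule ratio_tendsto[where v = "\<lambda>n. avg (?r n) u" and w = "\<lambda>n. avg (?r n) (ptf p t u)" and c = c])
    show "AE x in m. (\<lambda>n. avg (?r n) u x) \<longlonglongrightarrow> u x"
      using r1(2) by eventually_elim (use LIMSEQ_subseq_LIMSEQ[OF _ r2(1)] in \<open>auto simp: comp_def\<close>)
    show "AE x in m. (\<lambda>n. avg (?r n) (ptf p t u) x) \<longlonglongrightarrow> ptf p t u x" by (rule r2(2))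
    show "avg (?r n) u x \<le> c" "avg (?r n) (ptf p t u) x \<le> c" for n x
    proof -
      have "\<bar>avg (?r n) u x\<bar> \<le> c" "\<bar>avg (?r n) (ptf p t u) x\<bar> \<le> c"
        by (rule avg_bound[OF r c(2)], rule avg_bound[OF r pb])
      then show "avg (?r n) u x \<le> c" "avg (?r n) (ptf p t u) x \<le> c" by (simp_all only: abs_le_iff)
    qed
    show "0 \<le> c" using c(2)[of undefined] by simp
    show "(\<integral>x. 1 - (avg (?r n) (ptf p t u) x + e) / (avg (?r n) u x + e) \<partial>\<mu>) \<le> t * C" for n
    proof -
      let ?s = "?r n"
      have "(\<integral>x. 1 - (ptf p t (avg ?s u) x + e) / (avg ?s u x + e) \<partial>\<mu>) \<le> t * C"
      proof (rule ratio_le_lipschitz[OF avg_Dset[OF r u] t e])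
        fix b h :: real and x
        assume b: "0 \<le> b" and h: "0 \<le> h"
        \<comment> \<open>By \<open>ptf_avg_diff\<close> the increment is h / ?s times a difference
          of two averages, each bounded by \<open>c\<close>.\<close>
        show "\<bar>ptf p (b + h) (avg ?s u) x - ptf p b (avg ?s u) x\<bar> \<le> (2 * c / ?s) * h"
        proof (cases "h = 0")
          case False
          with h have h: "0 < h" by simp
          have gm: "ptf p b u \<in> borel_measurable borel" using b um(1) by simp
          have gb: "\<bar>ptf p b u y\<bar> \<le> c" for y by (intro ptf_bound b c)
          have pgb: "\<bar>ptf p ?s (ptf p b u) y\<bar> \<le> c" for y by (intro ptf_bound gb) simp
          have ab: "\<bar>avg ?s u y\<bar> \<le> c" for y by (rule avg_bound[OF r c(2)])
          have "ptf p (b + h) (avg ?s u) x = ptf p h (ptf p b (avg ?s u)) x"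
            unfolding add.commute[of b] by (rule ptf_add[OF less_imp_le[OF h] b avg_measurable[OF r um(1)] ab])
          moreover have eq: "ptf p b (avg ?s u) = avg ?s (ptf p b u)"
            by (rule ext) (rule avg_ptf[OF r b um(1) c(2)])
          ultimately have "ptf p (b + h) (avg ?s u) x - ptf p b (avg ?s u) x
              = (h / ?s) * (avg h (ptf p ?s (ptf p b u)) x - avg h (ptf p b u) x)"
            using ptf_avg_diff[OF r h gm gb] by simp
          moreover have "\<bar>avg h (ptf p ?s (ptf p b u)) x\<bar> \<le> c" "\<bar>avg h (ptf p b u) x\<bar> \<le> c"
            by (rule avg_bound[OF h pgb], rule avg_bound[OF h gb])
          then have "\<bar>avg h (ptf p ?s (ptf p b u)) x - avg h (ptf p b u) x\<bar> \<le> 2 * c" by linarith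
          then have "(h / ?s) * \<bar>avg h (ptf p ?s (ptf p b u)) x - avg h (ptf p b u) x\<bar> \<le> (h / ?s) * (2 * c)"
            using h by (intro mult_left_mono) auto
          ultimately show ?thesis using h by (simp only: abs_mult abs_of_pos[OF divide_pos_pos[OF h r]]) (simp add: mult.commute)
        qed simp
      qed
      moreover have "ptf p t (avg ?s u) x = avg ?s (ptf p t u) x" for x
        using t by (intro avg_ptf[OF r _ um(1) c(2)]) simp
      ultimately show ?thesis by simp
    qed
  qed (use r um DsetD[OF pD] e in \<open>auto intro!: avg_measurable avg_nonneg\<close>)
qed

text \<open>Truncations of \<open>f\<close> are square integrable but may fail to be integrable when
  \<open>m\<close> is infinite. Cutting \<open>u\<close> to sets of finite measure reaches them from
  \<open>Dset m\<close>.\<close>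

lemma ratio_le_bounded:
  assumes u: "u \<in> borel_measurable borel" "\<And>x. 0 \<le> u x" "\<And>x. u x \<le> c" and t: "0 < t" and e: "0 < e"
  shows "(\<integral>x. 1 - (ptf p t u x + e) / (u x + e) \<partial>\<mu>) \<le> t * C"
proof -
  obtain A :: "nat \<Rightarrow> 'a set" where A: "range A \<subseteq> sets m" "(\<Union>i. A i) = space m"
      "\<And>i. emeasure m (A i) \<noteq> \<infinity>" "incseq A"
    using sigma_finite_incseq by blast
  have [measurable]: "A n \<in> sets borel" for n using A(1) m_sets by auto
  note um[measurable] = u(1)
  have c: "0 \<le> c" using u(2,3)[of undefined] by simp
  define v where "v n x = u x * indicator (A n) x" for n x
  have vm[measurable]: "v n \<in> borel_measurable borel" for n unfolding v_def by measurable
  have vb: "0 \<le> v n x" "v n x \<le> c" for n x using u c by (auto simp: v_def split: split_indicator)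
  have vD: "v n \<in> Dset m" for n
  proof (rule DsetI[OF vm vb])
    have "(\<integral>\<^sup>+x. ennreal (v n x) \<partial>m) \<le> (\<integral>\<^sup>+x. ennreal c * indicator (A n) x \<partial>m)"
      using u by (intro nn_integral_mono) (auto simp: v_def split: split_indicator intro!: ennreal_leI)
    also have "\<dots> = ennreal c * emeasure m (A n)"
      using A(1) by (intro nn_integral_cmult_indicator) auto
    also have "\<dots> < \<infinity>" using A(3) by (simp add: ennreal_mult_less_top less_top)
    finally show "(\<integral>\<^sup>+x. ennreal (v n x) \<partial>m) < \<infinity>" .
  qed
  have v_lim: "(\<lambda>n. v n x) \<longlonglongrightarrow> u x" for x
  proof -
    obtain k where k: "x \<in> A k" using A(2) by auto
    have "\<forall>\<^sub>F n in sequentially. v n x = u x"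
      using eventually_ge_at_top[of k]
    proof eventually_elim
      case (elim n)
      then have "x \<in> A n" using A(4) k by (auto simp: incseq_def)
      then show ?case by (simp add: v_def)
    qed
    then show ?thesis by (rule tendsto_eventually)
  qed
  have p_lim: "(\<lambda>n. ptf p t (v n) x) \<longlonglongrightarrow> ptf p t u x" for x
  proof -
    interpret ps: prob_space "p t x" using t by (intro p_prob) simp
    show ?thesis
      unfolding ptf_def
      by (rule integral_dominated_convergence[where w = "\<lambda>_. c"])
        (use t vb v_lim in \<open>auto simp: abs_of_nonneg\<close>)
  qed
  have pt: "0 \<le> ptf p t (v n) x" "ptf p t (v n) x \<le> c" for n x
    using t by (auto intro!: ptf_nonneg ptf_le vb)
  show ?thesis
    by (rule ratio_tendsto[where v = v and w = "\<lambda>n. ptf p t (v n)" and c = c])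
      (use e c vb pt t u v_lim p_lim ratio_le_Dset[OF vD t e] in \<open>auto intro!: AE_I2\<close>)
qed

text \<open>With u = min f n, the integral of f^2 (p_t u + e) / (u + e) is compared with that of f
  p_t u, which is at most \<langle>T_t f, f\<rangle>. The discrepancy is dominated by f^2 and
  vanishes in the limit.\<close>

lemma form_le_rate:
  assumes t: "0 < t"
  shows "L2inner m f f - L2inner m (T t f) f \<le> t * C"
proof -
  define u where "u n x = min (f x) (real n)" for n x
  define e where "e n = 1 / real (Suc n)" for n
  have e: "0 < e n" for n by (simp add: e_def)
  have um[measurable]: "u n \<in> borel_measurable borel" for n unfolding u_def by measurable
  have ub: "0 \<le> u n x" "u n x \<le> real n" "u n x \<le> f x" for n x using f_nonneg[of x] by (auto simp: u_def)
  have pm[measurable]: "ptf p t (u n) \<in> borel_measurable borel" for n by (rule ptf_measurable[OF less_imp_le[OF t] um])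
  have pb: "0 \<le> ptf p t (u n) x" "ptf p t (u n) x \<le> real n" for n x
    using t by (auto intro!: ptf_nonneg ptf_le ub)
  \<comment> \<open>Where f \<le> n, f^2 / (f + e) \<le> f, and the summand e of the numerator
    leaves f^2 e / (f + e). Where f > n, p_t u \<le> n = u, so the ratio is at most 1 and f^2 is a
    crude bound. One index drives both the truncation and e.\<close>
  define err where "err n x = (f x)\<^sup>2 * (if f x \<le> real n then e n / (f x + e n) else 1)" for n x
  have err_m[measurable]: "err n \<in> borel_measurable borel" for n unfolding err_def by measurable
  have err_b: "0 \<le> err n x" "err n x \<le> (f x)\<^sup>2" for n x
  proof -
    have "e n / (f x + e n) \<le> 1" "0 \<le> e n / (f x + e n)" using e[of n] f_nonneg[of x] by simp_all
    then show "0 \<le> err n x" "err n x \<le> (f x)\<^sup>2" by (auto simp: err_def mult_left_le)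
  qed
  have err_int: "integrable m (err n)" for n
    using err_b by (intro Bochner_Integration.integrable_bound[OF L2_square_integrable[OF f_L2]]) auto
  have err_lim: "(\<lambda>n. \<integral>x. err n x \<partial>m) \<longlonglongrightarrow> 0"
  proof -
    have "(\<lambda>n. \<integral>x. err n x \<partial>m) \<longlonglongrightarrow> (\<integral>x. 0 \<partial>m)"
    proof (rule integral_dominated_convergence[where w = "\<lambda>x. (f x)\<^sup>2"])
      show "AE x in m. (\<lambda>n. err n x) \<longlonglongrightarrow> 0"
      proof (intro AE_I2)
        fix x
        have e_lim: "e \<longlonglongrightarrow> 0" unfolding e_def by (rule LIMSEQ_Suc[OF lim_1_over_n])
        have "(\<lambda>n. (f x)\<^sup>2 * (e n / (f x + e n))) \<longlonglongrightarrow> 0"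
        \<comment> \<open>At zeros of \<open>f\<close> the ratio stays 1, but the factor f^2
          vanishes.\<close>
        proof (cases "f x = 0")
          case False
          then have "(\<lambda>n. (f x)\<^sup>2 * (e n / (f x + e n))) \<longlonglongrightarrow> (f x)\<^sup>2 * (0 / (f x + 0))"
            by (intro tendsto_intros e_lim) auto
          then show ?thesis by simp
        qed simp
        moreover have "\<forall>\<^sub>F n in sequentially. (f x)\<^sup>2 * (e n / (f x + e n)) = err n x"
          using eventually_ge_at_top[of "nat \<lceil>f x\<rceil>"]
        proof eventually_elim
          case (elim n)
          then have "f x \<le> real n" by linarith
          then show ?case by (simp add: err_def)
        qed
        ultimately show "(\<lambda>n. err n x) \<longlonglongrightarrow> 0" by (rule Lim_transform_eventually)
      qed
    qed (use err_b L2_square_integrable[OF f_L2] in auto)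
    then show ?thesis by simp
  qed
  have le: "L2inner m f f - t * C \<le> L2inner m (T t f) f + (\<integral>x. err n x \<partial>m)" for n
  proof -
    let ?q = "\<lambda>x. (ptf p t (u n) x + e n) / (u n x + e n)"
    have uL: "u n \<in> L2 m"
      using ub f_nonneg by (auto simp: L2_def intro!: power_mono Bochner_Integration.integrable_bound[OF L2_square_integrable[OF f_L2]])
    have "\<bar>u n x\<bar> \<le> real n" for x using ub[of n x] by simp
    from ptf_L2[OF less_imp_le[OF t] uL this]
    have pL: "ptf p t (u n) \<in> L2 m" .
    have qb: "\<bar>?q x\<bar> \<le> (real n + e n) / e n" for x
      using pb[of n x] ub(1)[of n x] e[of n] by (auto intro!: frac_le)
    have qm[measurable]: "?q \<in> borel_measurable borel" by measurable
    have "(\<integral>x. 1 - ?q x \<partial>\<mu>) \<le> t * C" by (rule ratio_le_bounded[OF um ub(1,2) t e])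
    then have "L2inner m f f - t * C \<le> (\<integral>x. ?q x \<partial>\<mu>)"
      using mu_integrable[OF qm qb] by (simp add: mu.prob_space L2inner_f)
    also have "\<dots> = (\<integral>x. (f x)\<^sup>2 * ?q x \<partial>m)" by (rule integral_mu[OF qm])
    also have "\<dots> \<le> (\<integral>x. f x * ptf p t (u n) x + err n x \<partial>m)"
    proof (rule integral_mono)
      show "integrable m (\<lambda>x. (f x)\<^sup>2 * ?q x)" using qm by (intro integrable_square_mult[OF f_L2 _ qb]) simp
      show "integrable m (\<lambda>x. f x * ptf p t (u n) x + err n x)"
        by (intro Bochner_Integration.integrable_add L2_mult_integrable f_L2 pL err_int)
      fix x
      show "(f x)\<^sup>2 * ?q x \<le> f x * ptf p t (u n) x + err n x"
      proof (cases "f x \<le> real n")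
        case True
        have pos: "0 < f x + e n" using f_nonneg[of x] e[of n] by linarith
        have "(f x)\<^sup>2 * ?q x = (f x)\<^sup>2 / (f x + e n) * ptf p t (u n) x + err n x"
          using True by (simp add: u_def err_def add_divide_distrib distrib_left)
        moreover have "(f x)\<^sup>2 / (f x + e n) \<le> f x"
          using pos f_nonneg[of x] e[of n] by (simp add: field_simps power2_eq_square)
        ultimately show ?thesis using mult_right_mono[of "(f x)\<^sup>2 / (f x + e n)" "f x", OF _ pb(1)[of n x]] by simp
      next
        case False
        then have "?q x \<le> 1" using pb(2)[of n x] e[of n] by (simp add: u_def)
        then have "(f x)\<^sup>2 * ?q x \<le> (f x)\<^sup>2 * 1" by (intro mult_left_mono) auto
        then show ?thesis using False f_nonneg[of x] pb(1)[of n x] by (simp add: err_def add_increasing)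
      qed
    qed
    also have "\<dots> = (\<integral>x. f x * ptf p t (u n) x \<partial>m) + (\<integral>x. err n x \<partial>m)"
      by (intro Bochner_Integration.integral_add L2_mult_integrable f_L2 pL err_int)
    \<comment> \<open>The comparison u \<le> f is made in extended integrals, because
      \<open>represents\<close> does not cover an unbounded \<open>f\<close>.\<close>
    also have "(\<integral>x. f x * ptf p t (u n) x \<partial>m) \<le> L2inner m (T t f) f"
    proof -
      have "ennreal (L2inner m f (ptf p t (u n))) = (\<integral>\<^sup>+x. \<integral>\<^sup>+y. ennreal (f x * u n y) \<partial>p t x \<partial>m)"
        by (rule nn_form_bounded[OF less_imp_le[OF t] f_L2 f_nonneg uL ub(1,2), symmetric])
      also have "\<dots> \<le> (\<integral>\<^sup>+x. \<integral>\<^sup>+y. ennreal (f x * f y) \<partial>p t x \<partial>m)"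
        by (intro nn_integral_mono ennreal_leI mult_left_mono ub f_nonneg)
      also have "\<dots> = ennreal (L2inner m (T t f) f)"
        by (rule nn_form_eq[OF less_imp_le[OF t] f_L2 f_nonneg])
      finally show ?thesis
        using form_T_nonneg[OF less_imp_le[OF t] f_L2 f_nonneg] by (simp add: ennreal_le_iff L2inner_def)
    qed
    finally show ?thesis by simp
  qed
  have "(\<lambda>n. L2inner m (T t f) f + (\<integral>x. err n x \<partial>m)) \<longlonglongrightarrow> L2inner m (T t f) f + 0"
    by (intro tendsto_intros err_lim)
  then have "L2inner m f f - t * C \<le> L2inner m (T t f) f + 0"
    by (rule LIMSEQ_le_const) (use le in auto)
  then show ?thesis by simp
qed

end

end

section \<open>The equivalence and the value of the rate\<close>

theorem theorem1p17:
  fixes g :: "'b::polish_space \<Rightarrow> 'a::t2_space"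
    and m :: "'a measure"
    and p :: "real \<Rightarrow> 'a \<Rightarrow> 'a measure"
    and T :: "real \<Rightarrow> ('a \<Rightarrow> real) \<Rightarrow> ('a \<Rightarrow> real)"
    and DH :: "('a \<Rightarrow> real) set"
    and H :: "('a \<Rightarrow> real) \<Rightarrow> ('a \<Rightarrow> real)"
    and \<mu> :: "'a measure"
  assumes lusin: "lusin_image g"
    and borel_gen: "borel_gen_by_continuous TYPE('a)"
    and m_sets: "sets m = sets borel"
    and m_sigma: "sigma_finite_measure m"
    and m_pos: "emeasure m UNIV > 0"
    and p_trans: "transition_function p"
    and T_sg: "strongly_continuous_semigroup m T"
    and T_rep: "represents m p T"
    and T_symm: "symmetric_semigroup m T"
    and H_sqrt: "is_sqrt_neg_generator m T DH H"
    and mu_prob: "prob_space \<mu>"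
    and mu_sets: "sets \<mu> = sets borel"
    and mu_ac: "absolutely_continuous m \<mu>"
  defines "f \<equiv> (\<lambda>x. sqrt (enn2real (RN_deriv m \<mu> x)))"
  shows "(Irate m p \<mu> < \<infinity> \<longleftrightarrow> f \<in> DH) \<and>
         (f \<in> DH \<longrightarrow> Irate m p \<mu> = ereal (\<integral>x. (H f x)\<^sup>2 \<partial>m))"
proof -
  interpret K: reversible_kernel m p T
    using m_sigma by (intro reversible_kernel.intro reversible_kernel_axioms.intro m_sets p_trans T_sg T_rep T_symm)
  interpret S: sqrt_semigroup m T DH H
    by (intro sqrt_semigroup.intro sqrt_semigroup_axioms.intro m_sigma T_sg T_symm H_sqrt K.T_contraction)
  interpret mu: prob_space \<mu> by (rule mu_prob)
  have sets: "sets \<mu> = sets m" using mu_sets m_sets by simp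
  \<comment> \<open>Finiteness almost everywhere makes \<open>enn2real\<close> harmless, so f^2 is
    the density of \<mu>.\<close>
  have fin: "AE x in m. RN_deriv m \<mu> x \<noteq> \<infinity>"
    by (rule K.RN_deriv_finite[OF _ mu_ac sets]) unfold_locales
  have f_nonneg: "0 \<le> f x" for x by (simp add: f_def)
  have f_meas: "f \<in> borel_measurable m" unfolding f_def by measurable
  have mu_eq: "\<mu> = density m (\<lambda>x. ennreal ((f x)\<^sup>2))"
  proof -
    have "density m (\<lambda>x. ennreal ((f x)\<^sup>2)) = density m (RN_deriv m \<mu>)"
      using fin f_meas borel_measurable_RN_deriv[of m \<mu>] by (intro density_cong) (auto simp: f_def less_top elim!: eventually_mono)
    then show ?thesis using K.density_RN_deriv[OF mu_ac sets] by simp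
  qed
  have f_L2: "f \<in> L2 m"
  proof -
    have "(\<integral>\<^sup>+x. ennreal ((f x)\<^sup>2) \<partial>m) = emeasure \<mu> (space m)"
    proof -
      have "emeasure \<mu> (space m) = (\<integral>\<^sup>+x. ennreal ((f x)\<^sup>2) * indicator (space m) x \<partial>m)"
        using f_meas by (subst mu_eq, intro emeasure_density sets.top) simp
      then show ?thesis by simp
    qed
    also have "\<dots> < \<infinity>" using mu.emeasure_finite[of "space m"] unfolding less_top infinity_ennreal_def .
    finally show ?thesis using f_meas by (auto simp: L2_def intro!: integrableI_nonneg)
  qed
  interpret D: density_kernel m p T f \<mu>
    by (intro density_kernel.intro density_kernel_axioms.intro K.reversible_kernel_axioms f_L2 f_nonneg mu_eq mu_prob)
  have Irate_eq: "Irate m p \<mu> = Ihat m p \<mu>" using mu_ac by (simp add: Irate_def)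
  have norm_eq: "(\<integral>x. (H f x)\<^sup>2 \<partial>m) = L2inner m (H f) (H f)"
    by (simp add: L2inner_def power2_eq_square)
  let ?c = "\<lambda>u t \<eta> e. \<integral>x. D1Lv p u t \<eta> x / (D1v p u t \<eta> x + e) \<partial>\<mu>"
  have upper: "Irate m p \<mu> \<le> ereal (L2inner m (H f) (H f))" if fD: "f \<in> DH"
  proof -
    have "- ?c u t \<eta> e \<le> L2inner m (H f) (H f)" if "u \<in> Dset m" "0 < t" "0 \<le> \<eta>" "0 < e" for u t \<eta> e
      by (rule D.rate_functional_le[OF S.form_le[OF fD] that])
    then have "ereal (- L2inner m (H f) (H f)) \<le> ereal (?c u t \<eta> e)"
      if "u \<in> Dset m" "0 < t" "0 \<le> \<eta>" "0 < e" for u t \<eta> e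
      using that by (simp add: minus_le_iff)
    then show ?thesis
      unfolding Irate_eq Ihat_def
      by (subst ereal_minus_le_minus[symmetric]) (auto intro!: INF_greatest)
  qed
  have lower: "f \<in> DH \<and> ereal (L2inner m (H f) (H f)) \<le> Irate m p \<mu>" if "Irate m p \<mu> < \<infinity>"
  proof -
    have le: "ereal (- ?c u t \<eta> e) \<le> Irate m p \<mu>" if "u \<in> Dset m" "0 < t" "0 \<le> \<eta>" "0 < e" for u t \<eta> e
    proof -
      have "(INF z \<in> {(u, t, \<eta>, e). u \<in> Dset m \<and> t > 0 \<and> \<eta> \<ge> 0 \<and> e > 0}.
          (case z of (u, t, \<eta>, e) \<Rightarrow> ereal (?c u t \<eta> e))) \<le> ereal (?c u t \<eta> e)"
        using that by (intro INF_lower2[of "(u, t, \<eta>, e)"]) auto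
      then show ?thesis
        unfolding Irate_eq Ihat_def using ereal_minus_le_minus by fastforce
    qed
    \<comment> \<open>The zero function bounds the rate below by a real number; with the assumed
      upper bound the rate becomes a real \<open>C\<close>.\<close>
    have "(\<lambda>x. 0) \<in> Dset m" by (simp add: Dset_def)
    from le[OF this, of 1 0 1] obtain C where C: "Irate m p \<mu> = ereal C"
      using \<open>Irate m p \<mu> < \<infinity>\<close> by (cases "Irate m p \<mu>") auto
    have "- ?c u t \<eta> e \<le> C" if "u \<in> Dset m" "0 < t" "0 \<le> \<eta>" "0 < e" for u t \<eta> e
      using le[OF that] by (simp add: C)
    then have form: "L2inner m f f - L2inner m (T t f) f \<le> t * C" if "0 < t" for t
      using that by (rule D.form_le_rate)
    \<comment> \<open>Nonnegativity of the form at time 1 yields 0 \<le> C, which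
      \<open>S.DH_of_form_le\<close> requires.\<close>
    have "0 \<le> L2inner m f f - L2inner m (T 1 f) f"
      using semi_inner.nonneg[OF S.semi_inner_form[of 1] f_L2] by simp
    then have "0 \<le> C" using form[of 1] by simp
    then show ?thesis using S.DH_of_form_le[OF f_L2 _ form] by (simp add: C)
  qed
  show ?thesis
  proof (intro conjI iffI impI)
    assume fD: "f \<in> DH"
    show *: "Irate m p \<mu> < \<infinity>" by (rule le_less_trans[OF upper[OF fD]]) simp
    then show "Irate m p \<mu> = ereal (\<integral>x. (H f x)\<^sup>2 \<partial>m)"
      unfolding norm_eq using upper[OF fD] lower by (intro antisym) auto
  qed (use lower in blast)
qed

end
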